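(* Let $\nu>0$ and let $u_0\in\chi^{-1}$ be divergence free. There exists a positive time $T$ such that the system $(GNS_\nu)$ has a unique (mild) solution $u$ in $L^2([0,T];\chi^0)$, and this solution also belongs to $$C([0,T];\chi^{-1})\cap L^1([0,T];\chi^1)\cap L^\infty([0,T];\chi^{-1}).$$ Let $T_{u_0}$ denote the maximal time of existence of such a solution. Then: (i) There exists a constant $C>0$ such that if $\|u_0\|_{\chi^{-1}}\leq C\nu$, then $T_{u_0}=\infty$. (ii) If $T_{u_0}$ is finite, then $\int_0^{T_{u_0}}\|u(t)\|_{\chi^0}^2\,dt=\infty$.
   Context: For $i\in\{-1,0,1\}$, $\chi^{i}=\{f\in\mathcal{S}'(\mathbb{R}^3;\mathbb{R}^3) : \|f\|_{\chi^i}:=\int_{\mathbb{R}^3}|\xi|^{i}|\hat f(\xi)|\,d\xi<\infty\}$, where $\hat f$ is the Fourier transform. The generalized Navier–Stokes system $(GNS_\nu)$ is $$\partial_t u-\nu\Delta u=Q(u,u),\quad t>0,\ x\in\mathbb{R}^3,\qquad u(x,0)=u_0,$$ where $\nu>0$ and the bilinear operator $Q$ is given by $Q^j(u,v)=\sum_{k,l,m=1}^3 q^{j,m}_{k,l}\,\partial_m(u^kv^l)$, $j=1,2,3$, with $q^{j,m}_{k,l}(a)=\sum_{n,p=1}^3 a^{j,m,p,n}_{k,l}\,\mathcal{F}^{-1}\big(\tfrac{\xi_n\xi_p}{|\xi|^2}\hat a(\xi)\big)$ and $a^{j,m,p,n}_{k,l}$ fixed real numbers. Let $B(u,v)$ denote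 the solution of $\partial_t B-\nu\Delta B=Q(u,v)$, $B|_{t=0}=0$, i.e. $B(u,v)(t)=\int_0^t e^{\nu(t-s)\Delta}Q(u,v)(s)\,ds$. A (mild) solution of $(GNS_\nu)$ on $[0,T]$ is a function $u$ satisfying $u=e^{t\nu\Delta}u_0+B(u,u)$ on $[0,T]$. *)

theory Defs
  imports "HOL-Analysis.Analysis"
begin

text \<open>Every field in the spaces chi^i is represented by its Fourier transform
  F = hat f : real^3 => complex^3, with the convention
  hat f(xi) = integral of exp(-i x.xi) f(x) dx, so that
  hat(f g) = (2 pi)^(-3) (hat f * hat g),  hat(d_m g) = i xi_m hat g.\<close>

type_synonym fvec = "real^3 \<Rightarrow> complex^3"

definition chi_norm :: "int \<Rightarrow> fvec \<Rightarrow> ennreal" where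
  "chi_norm i F = (\<integral>\<^sup>+\<xi>. ennreal (norm \<xi> powi i * norm (F \<xi>)) \<partial>lborel)"

text \<open>f is real valued iff its Fourier transform is Hermitian.\<close>
definition real_field :: "fvec \<Rightarrow> bool" where
  "real_field F \<longleftrightarrow> (AE \<xi> in lborel. F (- \<xi>) = (\<chi> j. cnj (F \<xi> $ j)))"

definition in_chi :: "int \<Rightarrow> fvec \<Rightarrow> bool" where
  "in_chi i F \<longleftrightarrow> F \<in> borel_measurable lborel \<and> real_field F \<and> chi_norm i F < \<infinity>"

definition div_free :: "fvec \<Rightarrow> bool" where
  "div_free F \<longleftrightarrow> (AE \<xi> in lborel. (\<Sum>j\<in>UNIV. complex_of_real (\<xi> $ j) * F \<xi> $ j) = 0)"

definition prod_hat :: "fvec \<Rightarrow> fvec \<Rightarrow> 3 \<Rightarrow> 3 \<Rightarrow> real^3 \<Rightarrow> complex" where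
  "prod_hat U V k l \<xi> =
     complex_of_real ((2 * pi) powi (-3)) * (\<integral>\<eta>. U (\<xi> - \<eta>) $ k * V \<eta> $ l \<partial>lborel)"

text \<open>Fourier transform of Q(u,v), coefficients a j m p n k l = a^{j,m,p,n}_{k,l}.\<close>
definition Q_hat :: "(3 \<Rightarrow> 3 \<Rightarrow> 3 \<Rightarrow> 3 \<Rightarrow> 3 \<Rightarrow> 3 \<Rightarrow> real) \<Rightarrow> fvec \<Rightarrow> fvec \<Rightarrow> fvec" where
  "Q_hat a U V \<xi> = (\<chi> j. \<Sum>k\<in>UNIV. \<Sum>l\<in>UNIV. \<Sum>m\<in>UNIV. \<Sum>n\<in>UNIV. \<Sum>p\<in>UNIV.
       complex_of_real (a j m p n k l) * \<i> * complex_of_real (\<xi> $ m)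
       * complex_of_real (\<xi> $ n * \<xi> $ p / (norm \<xi>)\<^sup>2) * prod_hat U V k l \<xi>)"

text \<open>Mild solution on [0,T] (Fourier side): for every t in [0,T],
  hat u(t) = exp(-nu t |xi|^2) hat u0 + int_0^t exp(-nu (t-s)|xi|^2) hat Q(u,u)(s) ds
  as tempered distributions, i.e. for a.e. xi.\<close>
definition mild_sol :: "(3 \<Rightarrow> 3 \<Rightarrow> 3 \<Rightarrow> 3 \<Rightarrow> 3 \<Rightarrow> 3 \<Rightarrow> real) \<Rightarrow> real \<Rightarrow> fvec \<Rightarrow> real
      \<Rightarrow> (real \<Rightarrow> fvec) \<Rightarrow> bool" where
  "mild_sol a \<nu> U0 T U \<longleftrightarrow>
     (\<forall>t\<in>{0..T}. AE \<xi> in lborel.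
        U t \<xi> = (\<chi> j. complex_of_real (exp (- \<nu> * t * (norm \<xi>)\<^sup>2)) * U0 \<xi> $ j
                 + (LINT s:{0..t}|lborel.
                      complex_of_real (exp (- \<nu> * (t - s) * (norm \<xi>)\<^sup>2)) * Q_hat a (U s) (U s) \<xi> $ j)))"

text \<open>Bochner-type measurability: joint measurability of (t,xi) |-> hat u(t,xi).\<close>
definition tmeas :: "real \<Rightarrow> (real \<Rightarrow> fvec) \<Rightarrow> bool" where
  "tmeas T U \<longleftrightarrow> (\<lambda>(t, \<xi>). U t \<xi>) \<in> borel_measurable (restrict_space lborel {0..T} \<Otimes>\<^sub>M lborel)"

definition L2_chi0 :: "real \<Rightarrow> (real \<Rightarrow> fvec) \<Rightarrow> bool" where
  "L2_chi0 T U \<longleftrightarrow> tmeas T U \<and> (AE t in restrict_space lborel {0..T}. in_chi 0 (U t))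
     \<and> (\<integral>\<^sup>+t\<in>{0..T}. (chi_norm 0 (U t))\<^sup>2 \<partial>lborel) < \<infinity>"

definition C_chim1 :: "real \<Rightarrow> (real \<Rightarrow> fvec) \<Rightarrow> bool" where
  "C_chim1 T U \<longleftrightarrow> (\<forall>t\<in>{0..T}. in_chi (-1) (U t))
     \<and> (\<forall>t0\<in>{0..T}. ((\<lambda>t. chi_norm (-1) (\<lambda>\<xi>. U t \<xi> - U t0 \<xi>)) \<longlongrightarrow> 0) (at t0 within {0..T}))"

definition L1_chi1 :: "real \<Rightarrow> (real \<Rightarrow> fvec) \<Rightarrow> bool" where
  "L1_chi1 T U \<longleftrightarrow> tmeas T U \<and> (AE t in restrict_space lborel {0..T}. in_chi 1 (U t))
     \<and> (\<integral>\<^sup>+t\<in>{0..T}. chi_norm 1 (U t) \<partial>lborel) < \<infinity>"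

definition Linf_chim1 :: "real \<Rightarrow> (real \<Rightarrow> fvec) \<Rightarrow> bool" where
  "Linf_chim1 T U \<longleftrightarrow> tmeas T U \<and> (AE t in restrict_space lborel {0..T}. in_chi (-1) (U t))
     \<and> (\<exists>M::real. AE t in restrict_space lborel {0..T}. chi_norm (-1) (U t) \<le> ennreal M)"

definition Tmax :: "(3 \<Rightarrow> 3 \<Rightarrow> 3 \<Rightarrow> 3 \<Rightarrow> 3 \<Rightarrow> 3 \<Rightarrow> real) \<Rightarrow> real \<Rightarrow> fvec \<Rightarrow> ereal" where
  "Tmax a \<nu> U0 = Sup (ereal ` {T. 0 < T \<and> (\<exists>U. mild_sol a \<nu> U0 T U \<and> L2_chi0 T U)})"

end

theory Submission
  imports Defs
begin

text \<open>On the Fourier side the mild equation is u = H u0 + B(u,u), where H is multiplication by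
  exp (-\<nu> t |\<xi>|^2) and |B(u,v)| \<le> c D(|u| * |v|) with * the convolution in \<xi> and D the Duhamel
  integral with kernel |\<xi>| exp (-\<nu> (t-s) |\<xi>|^2). Tonelli bounds D m in L^\<infinity> chi^(-1) and, up to a
  factor 1/\<nu>, in L^1 chi^1 by the space-time integral of m; interpolating the chi^0 norm between the
  chi^(-1) and chi^1 norms (Cauchy-Schwarz) then bounds D m in L^2 chi^0.

  Existence is by majorants: the iteration for the scalar equation M = H |u0| + c D(M * M) started
  at 0 increases and stays bounded in L^2 chi^0 when H |u0| is small there, and the increments of the
  Picard iterates of the system are dominated pointwise by its increments, so the iterates converge
  wherever sup M is finite. The term H |u0| is small on short time intervals, and on every interval if
  the data are small compared to \<nu>. Uniqueness is a quadratic Gronwall argument. A solution with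
  finite L^2 chi^0 norm up to the maximal time has a value in chi^(-1) there and can be restarted.\<close>

section \<open>Parabolic estimates for nonnegative functions on the Fourier side\<close>

text \<open>The estimates close because two facts match: the Duhamel integral of m has squared L^2
  chi^0 norm at most 1/\<nu> times the square of the space-time integral of m, and for m = |u| * |u|
  that space-time integral is exactly the squared L^2 chi^0 norm of u. The obstacle is the null
  sets. A fixed point in L^2 chi^0 would be a class of functions, but the mild equation is required
  at every single t, for almost every \<xi>. The majorant M yields pointwise limits instead, and one
  null set of frequencies, off which the time integral of M * M is finite, serves all times in [0,T]
  at once; the time integral of |u| * |u| plays the same part in regularity and uniqueness. Size
  bounds are stated with extended nonnegative integrals and hold unconditionally: the Bochner
  integral of a nonintegrable function is 0 and obeys its bound. Finiteness is needed where such an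
  integral is split or a limit is taken inside it. Joint measurability is given only on [0,T];
  freezing time outside that interval extends it to all times.\<close>

lemma measurable_mem_atLeastAtMost [measurable (raw)]:
  fixes f g h :: "'a \<Rightarrow> real"
  assumes [measurable]: "f \<in> borel_measurable M" "g \<in> borel_measurable M" "h \<in> borel_measurable M"
  shows "Measurable.pred M (\<lambda>x. f x \<in> {g x..h x})"
  unfolding atLeastAtMost_iff by measurable

lemma borel_measurable_power_int [measurable (raw)]:
  fixes f :: "'a \<Rightarrow> real"
  assumes [measurable]: "f \<in> borel_measurable M"
  shows "(\<lambda>x. f x powi i) \<in> borel_measurable M"
  by (cases "i \<ge> 0") (simp_all add: power_int_def)

lemma lborel_distr_unit_affine:
  fixes t :: "'a::euclidean_space"
  assumes "\<bar>c\<bar> = 1"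
  shows "distr lborel borel (\<lambda>x. t + c *\<^sub>R x) = lborel"
proof -
  have "c \<noteq> 0" using assms by auto
  from lborel_affine[OF this, of t] show ?thesis
    using assms by (simp add: density_1)
qed

lemma lborel_distr_reflect:
  fixes t :: "'a::euclidean_space"
  shows "distr lborel borel (\<lambda>x. t - x) = lborel"
  using lborel_distr_unit_affine[of "-1" t] by simp

lemma nn_integral_translate:
  fixes t :: "'a::euclidean_space"
  assumes [measurable]: "f \<in> borel_measurable borel"
  shows "(\<integral>\<^sup>+x. f (x - t) \<partial>lborel) = (\<integral>\<^sup>+x. f x \<partial>lborel)"
  by (subst (2) lborel_distr_unit_affine[of 1 "-t", symmetric]) (simp_all add: nn_integral_distr)

lemma integral_reflect:
  fixes t :: "'a::euclidean_space" and f :: "'a \<Rightarrow> 'b::{banach, second_countable_topology}"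
  assumes [measurable]: "f \<in> borel_measurable borel"
  shows "(\<integral>x. f (t - x) \<partial>lborel) = (\<integral>x. f x \<partial>lborel)"
  by (subst (2) lborel_distr_reflect[of t, symmetric]) (simp add: integral_distr)

lemma AE_lborel_reflect:
  fixes t :: "'a::euclidean_space"
  assumes "AE x in lborel. P x"
  shows "AE x in lborel. P (t - x)"
proof -
  have "AE x in distr lborel borel (\<lambda>x. t - x). P x"
    using assms unfolding lborel_distr_reflect .
  then show ?thesis
    by (rule AE_distrD[rotated]) measurable
qed

lemma AE_lborel_nonzero: "AE x in lborel. x \<noteq> (0 :: 'a::euclidean_space)"
  by (rule AE_lborel_singleton)

text \<open>The chi^i norm for functions that are already absolute values and may be infinite. For i
  = -1 the weight at the origin is 0, because the inverse of 0 is 0; this concerns a null set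
  only.\<close>

definition wint :: "int \<Rightarrow> ('a::euclidean_space \<Rightarrow> ennreal) \<Rightarrow> ennreal" where
  "wint i f = (\<integral>\<^sup>+x. ennreal (norm x powi i) * f x \<partial>lborel)"

definition conv :: "('a::euclidean_space \<Rightarrow> ennreal) \<Rightarrow> ('a \<Rightarrow> ennreal) \<Rightarrow> 'a \<Rightarrow> ennreal" where
  "conv f g x = (\<integral>\<^sup>+y. f (x - y) * g y \<partial>lborel)"

definition flux :: "real \<Rightarrow> (real \<Rightarrow> 'a::euclidean_space \<Rightarrow> ennreal) \<Rightarrow> ennreal" where
  "flux T m = (\<integral>\<^sup>+t\<in>{0..T}. wint 0 (m t) \<partial>lborel)"

text \<open>This is the square of the L^2([0,T]; chi^0) norm. It is kept squared so that no root of
  an extended number is ever taken.\<close>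

definition energy :: "real \<Rightarrow> (real \<Rightarrow> 'a::euclidean_space \<Rightarrow> ennreal) \<Rightarrow> ennreal" where
  "energy T m = (\<integral>\<^sup>+t\<in>{0..T}. (wint 0 (m t))\<^sup>2 \<partial>lborel)"

definition heat :: "real \<Rightarrow> ('a::euclidean_space \<Rightarrow> ennreal) \<Rightarrow> real \<Rightarrow> 'a \<Rightarrow> ennreal" where
  "heat \<nu> f t x = ennreal (exp (- \<nu> * t * (norm x)\<^sup>2)) * f x"

text \<open>The factor \<open>norm x\<close> is the size of the first-order symbol of Q; thus
  \<open>m\<close> stands for the size of the product alone.\<close>

definition duhamel :: "real \<Rightarrow> (real \<Rightarrow> 'a::euclidean_space \<Rightarrow> ennreal) \<Rightarrow> real \<Rightarrow> 'a \<Rightarrow> ennreal" where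
  "duhamel \<nu> m t x =
     (\<integral>\<^sup>+s\<in>{0..t}. ennreal (exp (- \<nu> * (t - s) * (norm x)\<^sup>2) * norm x) * m s x \<partial>lborel)"

lemma wint_0: "wint 0 f = (\<integral>\<^sup>+x. f x \<partial>lborel)"
  by (simp add: wint_def)

lemma wint_1: "wint 1 f = (\<integral>\<^sup>+x. ennreal (norm x) * f x \<partial>lborel)"
  by (simp add: wint_def)

lemma chi_norm_eq_wint: "chi_norm i F = wint i (\<lambda>\<xi>. ennreal (norm (F \<xi>)))"
  by (simp add: chi_norm_def wint_def ennreal_mult)

lemma wint_mono_AE:
  assumes "AE x in lborel. f x \<le> g x"
  shows "wint i f \<le> wint i g"
  unfolding wint_def by (rule nn_integral_mono_AE, use assms in eventually_elim) (rule mult_left_mono, auto)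

lemma wint_add:
  assumes [measurable]: "f \<in> borel_measurable borel" "g \<in> borel_measurable borel"
  shows "wint i (\<lambda>x. f x + g x) = wint i f + wint i g"
  unfolding wint_def by (simp add: distrib_left nn_integral_add)

lemma wint_cmult:
  assumes [measurable]: "f \<in> borel_measurable borel"
  shows "wint i (\<lambda>x. c * f x) = c * wint i f"
  unfolding wint_def by (subst nn_integral_cmult[symmetric]) (auto simp: ac_simps)

lemma measurable_wint [measurable (raw)]:
  assumes [measurable]: "case_prod f \<in> borel_measurable (M \<Otimes>\<^sub>M borel)"
  shows "(\<lambda>t. wint i (f t)) \<in> borel_measurable M"
  unfolding wint_def by measurable

lemma measurable_conv [measurable (raw)]:
  assumes [measurable]: "case_prod f \<in> borel_measurable (M \<Otimes>\<^sub>M borel)"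
    "case_prod g \<in> borel_measurable (M \<Otimes>\<^sub>M borel)" "h \<in> borel_measurable M"
  shows "(\<lambda>t. conv (f t) (g t) (h t)) \<in> borel_measurable M"
  unfolding conv_def by measurable

lemma measurable_heat [measurable (raw)]:
  fixes f :: "'a::euclidean_space \<Rightarrow> ennreal"
  assumes [measurable]: "f \<in> borel_measurable borel" "g \<in> borel_measurable M" "h \<in> borel_measurable M"
  shows "(\<lambda>z. heat \<nu> f (g z) (h z)) \<in> borel_measurable M"
  unfolding heat_def by measurable

lemma measurable_duhamel [measurable (raw)]:
  fixes m :: "real \<Rightarrow> 'a::euclidean_space \<Rightarrow> ennreal"
  assumes [measurable]: "case_prod m \<in> borel_measurable (borel \<Otimes>\<^sub>M borel)"
    "g \<in> borel_measurable M" "h \<in> borel_measurable M"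
  shows "(\<lambda>z. duhamel \<nu> m (g z) (h z)) \<in> borel_measurable M"
  unfolding duhamel_def by measurable

text \<open>Tonelli and translation invariance. It says that chi^0 is an algebra under products in
  physical space.\<close>

lemma wint_0_conv:
  fixes f g :: "'a::euclidean_space \<Rightarrow> ennreal"
  assumes [measurable]: "f \<in> borel_measurable borel" "g \<in> borel_measurable borel"
  shows "wint 0 (conv f g) = wint 0 f * wint 0 g"
proof -
  have "wint 0 (conv f g) = (\<integral>\<^sup>+y. \<integral>\<^sup>+x. f (x - y) * g y \<partial>lborel \<partial>lborel)"
    unfolding wint_0 conv_def by (rule lborel_pair.Fubini'[symmetric]) measurable
  also have "\<dots> = wint 0 f * wint 0 g"
    by (simp add: nn_integral_multc nn_integral_cmult nn_integral_translate wint_0)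
  finally show ?thesis .
qed

text \<open>Cauchy-Schwarz for 1 = |x|^(-1/2) |x|^(1/2) off the origin. Taking \<open>f\<close> as
  the density of the measure avoids a square root of \<open>f\<close>.\<close>

lemma wint_0_squared_le:
  fixes f :: "'a::euclidean_space \<Rightarrow> ennreal"
  assumes [measurable]: "f \<in> borel_measurable borel"
  shows "(wint 0 f)\<^sup>2 \<le> wint (-1) f * wint 1 f"
proof -
  let ?M = "density lborel f"
  let ?p = "\<lambda>x::'a. ennreal (norm x powr (-1/2))" and ?q = "\<lambda>x::'a. ennreal (norm x powr (1/2))"
  have 0: "AE x in ?M. x \<noteq> 0"
    using AE_lborel_nonzero by (subst AE_density) auto
  have "wint 0 f = (\<integral>\<^sup>+x. 1 \<partial>?M)"
    by (subst nn_integral_density) (simp_all add: wint_0)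
  also have "\<dots> = (\<integral>\<^sup>+x. ?p x * ?q x \<partial>?M)"
    by (rule nn_integral_cong_AE, use 0 in eventually_elim)
      (simp add: ennreal_mult[symmetric] powr_add[symmetric])
  finally have "(wint 0 f)\<^sup>2 \<le> (\<integral>\<^sup>+x. ?p x ^ 2 \<partial>?M) * (\<integral>\<^sup>+x. ?q x ^ 2 \<partial>?M)"
    by (simp add: Cauchy_Schwarz_nn_integral)
  also have "(\<integral>\<^sup>+x. ?p x ^ 2 \<partial>?M) = wint (-1) f"
  proof -
    have "(\<integral>\<^sup>+x. ?p x ^ 2 \<partial>?M) = (\<integral>\<^sup>+x. ennreal (norm x powi (-1)) \<partial>?M)"
      by (rule nn_integral_cong_AE, use 0 in eventually_elim)
        (simp add: ennreal_mult[symmetric] powr_add[symmetric] power2_eq_square powr_neg_one power_int_minus inverse_eq_divide del: powr_minus)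
    then show ?thesis
      by (simp add: nn_integral_density wint_def mult.commute)
  qed
  also have "(\<integral>\<^sup>+x. ?q x ^ 2 \<partial>?M) = wint 1 f"
  proof -
    have "(\<integral>\<^sup>+x. ?q x ^ 2 \<partial>?M) = (\<integral>\<^sup>+x. ennreal (norm x) \<partial>?M)"
      by (rule nn_integral_cong_AE, use 0 in eventually_elim)
        (simp add: ennreal_mult[symmetric] powr_add[symmetric] power2_eq_square)
    then show ?thesis
      by (simp add: nn_integral_density wint_1 mult.commute)
  qed
  finally show ?thesis .
qed

lemma energy_le_mult:
  fixes m :: "real \<Rightarrow> 'a::euclidean_space \<Rightarrow> ennreal"
  assumes [measurable]: "case_prod m \<in> borel_measurable (borel \<Otimes>\<^sub>M borel)"
    and A: "\<And>t. t \<in> {0..T} \<Longrightarrow> wint (-1) (m t) \<le> A"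
  shows "energy T m \<le> A * (\<integral>\<^sup>+t\<in>{0..T}. wint 1 (m t) \<partial>lborel)"
proof -
  have "energy T m \<le> (\<integral>\<^sup>+t. A * (wint 1 (m t) * indicator {0..T} t) \<partial>lborel)"
    unfolding energy_def
  proof (rule nn_integral_mono)
    fix t
    have "(wint 0 (m t))\<^sup>2 \<le> A * wint 1 (m t)" if "t \<in> {0..T}"
    proof -
      have "(wint 0 (m t))\<^sup>2 \<le> wint (-1) (m t) * wint 1 (m t)"
        by (rule wint_0_squared_le) measurable
      also have "\<dots> \<le> A * wint 1 (m t)"
        by (intro mult_right_mono A that) simp
      finally show ?thesis .
    qed
    then show "(wint 0 (m t))\<^sup>2 * indicator {0..T} t \<le> A * (wint 1 (m t) * indicator {0..T} t)"
      by (auto simp: indicator_def)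
  qed
  also have "\<dots> = A * (\<integral>\<^sup>+t\<in>{0..T}. wint 1 (m t) \<partial>lborel)"
    by (rule nn_integral_cmult) measurable
  finally show ?thesis .
qed

text \<open>The integrand is the derivative of -exp (-\<nu> (t-s) r^2) / \<nu>. The bound depends
  neither on r nor on T: integrating in time pays for two powers of the frequency at the price
  1/\<nu>.\<close>

lemma nn_integral_heat_kernel_le:
  fixes \<nu> r s T :: real
  assumes "\<nu> > 0"
  shows "(\<integral>\<^sup>+t\<in>{s..T}. ennreal (r\<^sup>2 * exp (- \<nu> * (t - s) * r\<^sup>2)) \<partial>lborel) \<le> ennreal (1 / \<nu>)"
proof (cases "s \<le> T")
  case True
  have "(\<integral>\<^sup>+t\<in>{s..T}. ennreal (r\<^sup>2 * exp (- \<nu> * (t - s) * r\<^sup>2)) \<partial>lborel)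
    = ennreal (- exp (- \<nu> * (T - s) * r\<^sup>2) / \<nu> - (- exp (- \<nu> * (s - s) * r\<^sup>2) / \<nu>))"
  proof (rule nn_integral_FTC_Icc[OF _ _ _ True])
    fix t show "((\<lambda>t. - exp (- \<nu> * (t - s) * r\<^sup>2) / \<nu>) has_real_derivative
        r\<^sup>2 * exp (- \<nu> * (t - s) * r\<^sup>2)) (at t)"
      using assms by (auto intro!: derivative_eq_intros simp: field_simps)
  qed auto
  also have "\<dots> \<le> ennreal (1 / \<nu>)"
    using assms by (intro ennreal_leI) simp
  finally show ?thesis .
next
  case False
  then show ?thesis by simp
qed

section \<open>Bounds for the free heat evolution\<close>

lemma wint_heat_le:
  fixes f :: "'a::euclidean_space \<Rightarrow> ennreal"
  assumes "\<nu> > 0" "t \<ge> 0"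
  shows "wint i (heat \<nu> f t) \<le> wint i f"
proof (rule wint_mono_AE, rule AE_I2)
  fix x :: 'a
  have "ennreal (exp (- \<nu> * t * (norm x)\<^sup>2)) \<le> 1"
    using assms by simp
  from mult_right_mono[OF this, of "f x"] show "heat \<nu> f t x \<le> f x"
    by (simp add: heat_def)
qed

lemma nn_integral_wint_1_heat_le:
  fixes f :: "'a::euclidean_space \<Rightarrow> ennreal"
  assumes "\<nu> > 0" and [measurable]: "f \<in> borel_measurable borel"
  shows "(\<integral>\<^sup>+t\<in>{0..T}. wint 1 (heat \<nu> f t) \<partial>lborel) \<le> ennreal (1 / \<nu>) * wint (-1) f"
proof -
  have "(\<integral>\<^sup>+t\<in>{0..T}. wint 1 (heat \<nu> f t) \<partial>lborel)
    = (\<integral>\<^sup>+t. \<integral>\<^sup>+x. ennreal (norm x) * heat \<nu> f t x * indicator {0..T} t \<partial>lborel \<partial>lborel)"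
    unfolding wint_1 by (subst nn_integral_multc) auto
  also have "\<dots> = (\<integral>\<^sup>+x. \<integral>\<^sup>+t. ennreal (norm x) * heat \<nu> f t x * indicator {0..T} t \<partial>lborel \<partial>lborel)"
    by (rule lborel_pair.Fubini'[symmetric]) measurable
  also have "\<dots> = (\<integral>\<^sup>+x. \<integral>\<^sup>+t. (ennreal (norm x powi (-1)) * f x) *
      (ennreal ((norm x)\<^sup>2 * exp (- \<nu> * (t - 0) * (norm x)\<^sup>2)) * indicator {0..T} t) \<partial>lborel \<partial>lborel)"
  proof (intro nn_integral_cong)
    fix x :: 'a and t :: real
    let ?e = "exp (- \<nu> * t * (norm x)\<^sup>2)"
    \<comment> \<open>The weight |x| is |x|^(-1) times |x|^2, and the square is absorbed by the time
      integral of the heat kernel. At the origin both sides are 0.\<close>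
    have "norm x * ?e = norm x powi (-1) * ((norm x)\<^sup>2 * ?e)"
      by (cases "x = 0") (auto simp: power_int_minus power2_eq_square)
    then have "ennreal (norm x) * ennreal ?e = ennreal (norm x powi (-1)) * ennreal ((norm x)\<^sup>2 * ?e)"
      by (simp add: ennreal_mult[symmetric])
    then show "ennreal (norm x) * heat \<nu> f t x * indicator {0..T} t = (ennreal (norm x powi (-1)) * f x) *
      (ennreal ((norm x)\<^sup>2 * exp (- \<nu> * (t - 0) * (norm x)\<^sup>2)) * indicator {0..T} t)"
      by (simp add: heat_def mult.assoc[symmetric]) (simp add: ac_simps)
  qed
  also have "\<dots> = (\<integral>\<^sup>+x. (ennreal (norm x powi (-1)) * f x) *
      (\<integral>\<^sup>+t\<in>{0..T}. ennreal ((norm x)\<^sup>2 * exp (- \<nu> * (t - 0) * (norm x)\<^sup>2)) \<partial>lborel) \<partial>lborel)"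
    by (intro nn_integral_cong nn_integral_cmult) measurable
  also have "\<dots> \<le> (\<integral>\<^sup>+x. (ennreal (norm x powi (-1)) * f x) * ennreal (1 / \<nu>) \<partial>lborel)"
    by (intro nn_integral_mono mult_left_mono nn_integral_heat_kernel_le assms) auto
  also have "\<dots> = ennreal (1 / \<nu>) * wint (-1) f"
    unfolding wint_def by (subst nn_integral_multc) (auto simp: mult.commute)
  finally show ?thesis .
qed

text \<open>The right-hand side is free of T. This gives global solutions for small data, and
  finiteness on [0,1] as the starting point for local ones.\<close>

lemma energy_heat_le:
  fixes f :: "'a::euclidean_space \<Rightarrow> ennreal"
  assumes "\<nu> > 0" and [measurable]: "f \<in> borel_measurable borel"
  shows "energy T (heat \<nu> f) \<le> ennreal (1 / \<nu>) * (wint (-1) f)\<^sup>2"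
proof -
  have "energy T (heat \<nu> f) \<le> wint (-1) f * (\<integral>\<^sup>+t\<in>{0..T}. wint 1 (heat \<nu> f t) \<partial>lborel)"
    by (rule energy_le_mult) (auto intro!: wint_heat_le assms)
  also have "\<dots> \<le> wint (-1) f * (ennreal (1 / \<nu>) * wint (-1) f)"
    by (intro mult_left_mono nn_integral_wint_1_heat_le assms) auto
  finally show ?thesis by (simp add: power2_eq_square ac_simps)
qed

section \<open>Bounds for the Duhamel integral\<close>

lemma flux_swap:
  fixes m :: "real \<Rightarrow> 'a::euclidean_space \<Rightarrow> ennreal"
  assumes [measurable]: "case_prod m \<in> borel_measurable (borel \<Otimes>\<^sub>M borel)"
  shows "flux T m = (\<integral>\<^sup>+x. (\<integral>\<^sup>+s\<in>{0..T}. m s x \<partial>lborel) \<partial>lborel)"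
proof -
  have "flux T m = (\<integral>\<^sup>+s. \<integral>\<^sup>+x. m s x * indicator {0..T} s \<partial>lborel \<partial>lborel)"
    unfolding flux_def wint_0 by (subst nn_integral_multc) auto
  also have "\<dots> = (\<integral>\<^sup>+x. \<integral>\<^sup>+s. m s x * indicator {0..T} s \<partial>lborel \<partial>lborel)"
    by (rule lborel_pair.Fubini'[symmetric]) measurable
  finally show ?thesis .
qed

text \<open>The exponential is at most 1 and is dropped, so the bound no longer depends on t and
  dominates the Duhamel integral at all times up to T.\<close>

lemma duhamel_le:
  assumes "\<nu> > 0" "t \<le> T"
    and [measurable]: "(\<lambda>s. m s x) \<in> borel_measurable borel"
  shows "duhamel \<nu> m t x \<le> ennreal (norm x) * (\<integral>\<^sup>+s\<in>{0..T}. m s x \<partial>lborel)"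
proof -
  have "duhamel \<nu> m t x \<le> (\<integral>\<^sup>+s. ennreal (norm x) * (m s x * indicator {0..T} s) \<partial>lborel)"
    unfolding duhamel_def
  proof (rule nn_integral_mono)
    fix s
    have "ennreal (exp (- \<nu> * (t - s) * (norm x)\<^sup>2) * norm x) \<le> ennreal (norm x)" if "s \<le> t"
      using assms that by (intro ennreal_leI mult_left_le_one_le) auto
    from mult_right_mono[OF this, of "m s x"] assms(2)
    show "ennreal (exp (- \<nu> * (t - s) * (norm x)\<^sup>2) * norm x) * m s x * indicator {0..t} s
      \<le> ennreal (norm x) * (m s x * indicator {0..T} s)"
      by (auto simp: indicator_def)
  qed
  also have "\<dots> = ennreal (norm x) * (\<integral>\<^sup>+s\<in>{0..T}. m s x \<partial>lborel)"
    by (rule nn_integral_cmult) measurable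
  finally show ?thesis .
qed

lemma wint_m1_norm_mult_le:
  fixes g :: "'a::euclidean_space \<Rightarrow> ennreal"
  shows "wint (-1) (\<lambda>x. ennreal (norm x) * g x) \<le> wint 0 g"
  unfolding wint_def
proof (rule nn_integral_mono)
  fix x :: 'a
  have "ennreal (norm x powi (-1)) * ennreal (norm x) \<le> 1"
    by (cases "x = 0") (auto simp: power_int_minus ennreal_mult[symmetric])
  from mult_right_mono[OF this, of "g x"]
  show "ennreal (norm x powi - 1) * (ennreal (norm x) * g x) \<le> ennreal (norm x powi 0) * g x"
    by (simp add: mult.assoc)
qed

lemma wint_m1_duhamel_le:
  fixes m :: "real \<Rightarrow> 'a::euclidean_space \<Rightarrow> ennreal"
  assumes "\<nu> > 0" "t \<le> T"
    and [measurable]: "case_prod m \<in> borel_measurable (borel \<Otimes>\<^sub>M borel)"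
  shows "wint (-1) (duhamel \<nu> m t) \<le> flux T m"
proof -
  have "wint (-1) (duhamel \<nu> m t)
    \<le> wint (-1) (\<lambda>x. ennreal (norm x) * (\<integral>\<^sup>+s\<in>{0..T}. m s x \<partial>lborel))"
    by (intro wint_mono_AE AE_I2 duhamel_le assms) measurable
  also have "\<dots> \<le> wint 0 (\<lambda>x. \<integral>\<^sup>+s\<in>{0..T}. m s x \<partial>lborel)"
    by (rule wint_m1_norm_mult_le)
  also have "\<dots> = flux T m"
    by (simp add: wint_0 flux_swap)
  finally show ?thesis .
qed

text \<open>The weight |x| and the factor |x| of the kernel give |x|^2. On the triangle 0 \<le> s
  \<le> t \<le> T the t-integral is moved inside, where it is a heat kernel integral started at
  s.\<close>

lemma nn_integral_wint_1_duhamel_le: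
  fixes m :: "real \<Rightarrow> 'a::euclidean_space \<Rightarrow> ennreal"
  assumes "\<nu> > 0" and [measurable]: "case_prod m \<in> borel_measurable (borel \<Otimes>\<^sub>M borel)"
  shows "(\<integral>\<^sup>+t\<in>{0..T}. wint 1 (duhamel \<nu> m t) \<partial>lborel) \<le> ennreal (1 / \<nu>) * flux T m"
proof -
  let ?k = "\<lambda>t s x. ennreal ((norm x)\<^sup>2 * exp (- \<nu> * (t - s) * (norm x)\<^sup>2))"
  have "(\<integral>\<^sup>+t\<in>{0..T}. wint 1 (duhamel \<nu> m t) \<partial>lborel)
    = (\<integral>\<^sup>+t. \<integral>\<^sup>+x. \<integral>\<^sup>+s. (m s x * indicator {0..T} s) * (?k t s x * indicator {s..T} t) \<partial>lborel \<partial>lborel \<partial>lborel)"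
  proof (intro nn_integral_cong)
    fix t
    have "wint 1 (duhamel \<nu> m t) * indicator {0..T} t
      = (\<integral>\<^sup>+x. ennreal (norm x) * duhamel \<nu> m t x * indicator {0..T} t \<partial>lborel)"
      unfolding wint_1 by (subst nn_integral_multc) auto
    also have "\<dots> = (\<integral>\<^sup>+x. \<integral>\<^sup>+s. (m s x * indicator {0..T} s) * (?k t s x * indicator {s..T} t) \<partial>lborel \<partial>lborel)"
    proof (intro nn_integral_cong)
      fix x
      have "ennreal (norm x) * duhamel \<nu> m t x * indicator {0..T} t = (\<integral>\<^sup>+s. ennreal (norm x) *
          (ennreal (exp (- \<nu> * (t - s) * (norm x)\<^sup>2) * norm x) * m s x * indicator {0..t} s) * indicator {0..T} t \<partial>lborel)"
        unfolding duhamel_def by (simp add: nn_integral_multc nn_integral_cmult)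
      also have "\<dots> = (\<integral>\<^sup>+s. (m s x * indicator {0..T} s) * (?k t s x * indicator {s..T} t) \<partial>lborel)"
        by (intro nn_integral_cong)
          (auto simp: indicator_def ennreal_mult power2_eq_square ac_simps)
      finally show "ennreal (norm x) * duhamel \<nu> m t x * indicator {0..T} t
        = (\<integral>\<^sup>+s. (m s x * indicator {0..T} s) * (?k t s x * indicator {s..T} t) \<partial>lborel)" .
    qed
    finally show "wint 1 (duhamel \<nu> m t) * indicator {0..T} t
      = (\<integral>\<^sup>+x. \<integral>\<^sup>+s. (m s x * indicator {0..T} s) * (?k t s x * indicator {s..T} t) \<partial>lborel \<partial>lborel)" .
  qed
  also have "\<dots> = (\<integral>\<^sup>+x. \<integral>\<^sup>+t. \<integral>\<^sup>+s. (m s x * indicator {0..T} s) * (?k t s x * indicator {s..T} t) \<partial>lborel \<partial>lborel \<partial>lborel)"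
    by (rule lborel_pair.Fubini'[symmetric]) measurable
  also have "\<dots> = (\<integral>\<^sup>+x. \<integral>\<^sup>+s. \<integral>\<^sup>+t. (m s x * indicator {0..T} s) * (?k t s x * indicator {s..T} t) \<partial>lborel \<partial>lborel \<partial>lborel)"
    by (intro nn_integral_cong lborel_pair.Fubini'[symmetric]) measurable
  also have "\<dots> = (\<integral>\<^sup>+x. \<integral>\<^sup>+s. (m s x * indicator {0..T} s) * (\<integral>\<^sup>+t. ?k t s x * indicator {s..T} t \<partial>lborel) \<partial>lborel \<partial>lborel)"
    by (intro nn_integral_cong nn_integral_cmult) measurable
  also have "\<dots> \<le> (\<integral>\<^sup>+x. \<integral>\<^sup>+s. (m s x * indicator {0..T} s) * ennreal (1 / \<nu>) \<partial>lborel \<partial>lborel)"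
    by (intro nn_integral_mono mult_left_mono nn_integral_heat_kernel_le assms) auto
  also have "\<dots> = ennreal (1 / \<nu>) * flux T m"
    by (simp add: nn_integral_cmult flux_swap mult.commute)
  finally show ?thesis .
qed

lemma energy_duhamel_le:
  fixes m :: "real \<Rightarrow> 'a::euclidean_space \<Rightarrow> ennreal"
  assumes "\<nu> > 0" and [measurable]: "case_prod m \<in> borel_measurable (borel \<Otimes>\<^sub>M borel)"
  shows "energy T (duhamel \<nu> m) \<le> ennreal (1 / \<nu>) * (flux T m)\<^sup>2"
proof -
  have "energy T (duhamel \<nu> m) \<le> flux T m * (\<integral>\<^sup>+t\<in>{0..T}. wint 1 (duhamel \<nu> m t) \<partial>lborel)"
    by (rule energy_le_mult) (auto intro!: wint_m1_duhamel_le assms)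
  also have "\<dots> \<le> flux T m * (ennreal (1 / \<nu>) * flux T m)"
    by (intro mult_left_mono nn_integral_wint_1_duhamel_le assms) auto
  finally show ?thesis by (simp add: power2_eq_square ac_simps)
qed

text \<open>This identity turns the bounds on the Duhamel integral into quadratic bounds by the
  energy of the field itself.\<close>

lemma flux_conv_self:
  fixes m :: "real \<Rightarrow> 'a::euclidean_space \<Rightarrow> ennreal"
  assumes [measurable]: "case_prod m \<in> borel_measurable (borel \<Otimes>\<^sub>M borel)"
  shows "flux T (\<lambda>s. conv (m s) (m s)) = energy T m"
  unfolding flux_def energy_def
  by (intro nn_integral_cong) (simp add: wint_0_conv power2_eq_square)

section \<open>The majorant iteration\<close>

text \<open>Dominated convergence along the lengths (b - a) / (n + 1), with the integrand on [a,b]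
  as majorant.\<close>

lemma nn_integral_short_interval_le:
  fixes g :: "real \<Rightarrow> ennreal"
  assumes [measurable]: "g \<in> borel_measurable borel"
    and fin: "(\<integral>\<^sup>+t\<in>{a..b}. g t \<partial>lborel) < \<infinity>" and "a < b" and "\<epsilon> > 0"
  obtains \<delta> where "\<delta> > 0" "a + \<delta> \<le> b" "(\<integral>\<^sup>+t\<in>{a..a + \<delta>}. g t \<partial>lborel) < \<epsilon>"
proof -
  let ?d = "\<lambda>n. (b - a) / real (Suc n)"
  have "(\<lambda>n. \<integral>\<^sup>+t\<in>{a..a + ?d n}. g t \<partial>lborel) \<longlonglongrightarrow> (\<integral>\<^sup>+t. 0 \<partial>(lborel :: real measure))"
  proof (rule nn_integral_dominated_convergence[where w="\<lambda>t. g t * indicator {a..b} t"])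
    fix n
    have "(b - a) / real (Suc n) \<le> (b - a) / 1"
      using \<open>a < b\<close> by (intro divide_left_mono) auto
    then show "AE t in lborel. g t * indicator {a..a + ?d n} t \<le> g t * indicator {a..b} t"
      by (intro AE_I2 mult_left_mono) (auto simp: indicator_def)
  next
    have d: "?d \<longlonglongrightarrow> 0"
      by (rule LIMSEQ_Suc, rule lim_const_over_n)
    show "AE t in lborel. (\<lambda>n. g t * indicator {a..a + ?d n} t) \<longlonglongrightarrow> 0"
      \<comment> \<open>At t = a every indicator is 1, so that point has to be excluded.\<close>
      using AE_lborel_singleton[of a]
    proof eventually_elim
      fix t assume "t \<noteq> a"
      then have "eventually (\<lambda>n. g t * indicator {a..a + ?d n} t = 0) sequentially"
      proof (cases "t < a")
        case False
        with \<open>t \<noteq> a\<close> have "0 < t - a" by simp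
        from order_tendstoD(2)[OF d this] show ?thesis
          by eventually_elim auto
      qed auto
      then show "(\<lambda>n. g t * indicator {a..a + ?d n} t) \<longlonglongrightarrow> 0"
        by (rule tendsto_eventually)
    qed
  qed (use fin in auto)
  then have "eventually (\<lambda>n. (\<integral>\<^sup>+t\<in>{a..a + ?d n}. g t \<partial>lborel) < \<epsilon>) sequentially"
    using \<open>\<epsilon> > 0\<close> by (intro order_tendstoD(2)) auto
  then obtain n where n: "(\<integral>\<^sup>+t\<in>{a..a + ?d n}. g t \<partial>lborel) < \<epsilon>"
    by (auto simp: eventually_sequentially)
  show thesis
  proof (rule that[OF _ _ n])
    have "(b - a) / real (Suc n) \<le> (b - a) / 1"
      using \<open>a < b\<close> by (intro divide_left_mono) auto
    then show "a + ?d n \<le> b"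
      by simp
  qed (use \<open>a < b\<close> in auto)
qed

lemma ennreal_add_power2_le: "(a + b)\<^sup>2 \<le> 2 * a\<^sup>2 + 2 * (b::ennreal)\<^sup>2"
proof (cases "a = \<infinity> \<or> b = \<infinity>")
  case True
  then show ?thesis by (auto simp: power2_eq_square)
next
  case False
  then obtain x y where xy: "a = ennreal x" "0 \<le> x" "b = ennreal y" "0 \<le> y"
    by (metis ennreal_cases infinity_ennreal_def)
  have "(x + y)\<^sup>2 \<le> 2 * x\<^sup>2 + 2 * y\<^sup>2"
    using sum_squares_bound[of x y] by (simp add: power2_sum)
  then have "ennreal ((x + y)\<^sup>2) \<le> ennreal (2 * x\<^sup>2 + 2 * y\<^sup>2)"
    by (rule ennreal_leI)
  moreover have "(a + b)\<^sup>2 = ennreal ((x + y)\<^sup>2)"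
    using xy by (simp add: ennreal_power flip: ennreal_plus)
  moreover have "2 * a\<^sup>2 + 2 * b\<^sup>2 = ennreal (2 * x\<^sup>2 + 2 * y\<^sup>2)"
    using xy by (simp add: ennreal_mult ennreal_power)
  ultimately show ?thesis by simp
qed

text \<open>Replaces the triangle inequality in L^2 chi^0; the factors 2 come from (a + b)^2 \<le> 2
  a^2 + 2 b^2.\<close>

lemma energy_add_cmult_le:
  fixes m m' :: "real \<Rightarrow> 'a::euclidean_space \<Rightarrow> ennreal"
  assumes [measurable]: "case_prod m \<in> borel_measurable (borel \<Otimes>\<^sub>M borel)"
    "case_prod m' \<in> borel_measurable (borel \<Otimes>\<^sub>M borel)"
  shows "energy T (\<lambda>t x. m t x + c * m' t x) \<le> 2 * energy T m + 2 * c\<^sup>2 * energy T m'"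
proof -
  have "energy T (\<lambda>t x. m t x + c * m' t x)
    \<le> (\<integral>\<^sup>+t. 2 * ((wint 0 (m t))\<^sup>2 * indicator {0..T} t)
        + 2 * c\<^sup>2 * ((wint 0 (m' t))\<^sup>2 * indicator {0..T} t) \<partial>lborel)"
    unfolding energy_def
  proof (rule nn_integral_mono)
    fix t
    have "wint 0 (\<lambda>x. m t x + c * m' t x) = wint 0 (m t) + c * wint 0 (m' t)"
      by (simp add: wint_add wint_cmult)
    then have "(wint 0 (\<lambda>x. m t x + c * m' t x))\<^sup>2
        \<le> 2 * (wint 0 (m t))\<^sup>2 + 2 * c\<^sup>2 * (wint 0 (m' t))\<^sup>2"
      using ennreal_add_power2_le[of "wint 0 (m t)" "c * wint 0 (m' t)"]
      by (simp add: power_mult_distrib ac_simps)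
    then show "(wint 0 (\<lambda>x. m t x + c * m' t x))\<^sup>2 * indicator {0..T} t
      \<le> 2 * ((wint 0 (m t))\<^sup>2 * indicator {0..T} t) + 2 * c\<^sup>2 * ((wint 0 (m' t))\<^sup>2 * indicator {0..T} t)"
      by (auto simp: indicator_def)
  qed
  also have "\<dots> = 2 * energy T m + 2 * c\<^sup>2 * energy T m'"
    unfolding energy_def by (simp add: nn_integral_add nn_integral_cmult)
  finally show ?thesis .
qed

lemma energy_mono:
  assumes "\<And>t. t \<in> {0..T} \<Longrightarrow> AE x in lborel. m t x \<le> m' t x"
  shows "energy T m \<le> energy T m'"
  unfolding energy_def
proof (rule nn_integral_mono)
  fix t show "(wint 0 (m t))\<^sup>2 * indicator {0..T} t \<le> (wint 0 (m' t))\<^sup>2 * indicator {0..T} t"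
    using wint_mono_AE[OF assms, of t 0] by (auto simp: indicator_def intro: power_mono)
qed

text \<open>By \<open>flux_swap\<close> the integral over x of this time integral is the energy. The
  exceptional set of x does not depend on any time in [0,T].\<close>

lemma AE_finite_conv_time_integral:
  fixes m :: "real \<Rightarrow> 'a::euclidean_space \<Rightarrow> ennreal"
  assumes [measurable]: "case_prod m \<in> borel_measurable (borel \<Otimes>\<^sub>M borel)"
    and "energy T m < \<infinity>"
  shows "AE x in lborel. (\<integral>\<^sup>+s\<in>{0..T}. conv (m s) (m s) x \<partial>lborel) < \<infinity>"
proof -
  have "(\<integral>\<^sup>+x. (\<integral>\<^sup>+s\<in>{0..T}. conv (m s) (m s) x \<partial>lborel) \<partial>lborel) \<noteq> \<infinity>"
    using assms(2) by (simp add: flux_swap[symmetric] flux_conv_self)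
  then have "AE x in lborel. (\<integral>\<^sup>+s\<in>{0..T}. conv (m s) (m s) x \<partial>lborel) \<noteq> \<infinity>"
    by (rule nn_integral_PInf_AE[rotated]) measurable
  then show ?thesis
    by (simp add: less_top)
qed

lemma conv_mono:
  assumes "\<And>x. f x \<le> f' x" "\<And>x. g x \<le> g' x"
  shows "conv f g x \<le> conv f' g' x"
  unfolding conv_def by (intro nn_integral_mono mult_mono assms) auto

lemma duhamel_mono:
  assumes "\<And>s. s \<in> {0..t} \<Longrightarrow> m s x \<le> m' s x"
  shows "duhamel \<nu> m t x \<le> duhamel \<nu> m' t x"
  unfolding duhamel_def by (intro nn_integral_mono) (auto simp: indicator_def intro!: mult_left_mono assms)

lemma duhamel_add:
  assumes [measurable]: "(\<lambda>s. m s x) \<in> borel_measurable borel" "(\<lambda>s. m' s x) \<in> borel_measurable borel"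
  shows "duhamel \<nu> (\<lambda>s x. m s x + m' s x) t x = duhamel \<nu> m t x + duhamel \<nu> m' t x"
  unfolding duhamel_def by (subst nn_integral_add[symmetric]) (auto simp: algebra_simps)

primrec maj :: "real \<Rightarrow> real \<Rightarrow> ('a::euclidean_space \<Rightarrow> ennreal) \<Rightarrow> nat \<Rightarrow> real \<Rightarrow> 'a \<Rightarrow> ennreal" where
  "maj c \<nu> f 0 = (\<lambda>t x. 0)"
| "maj c \<nu> f (Suc n) = (\<lambda>t x. heat \<nu> f t x
     + ennreal c * duhamel \<nu> (\<lambda>s. conv (maj c \<nu> f n s) (maj c \<nu> f n s)) t x)"

definition majlim :: "real \<Rightarrow> real \<Rightarrow> ('a::euclidean_space \<Rightarrow> ennreal) \<Rightarrow> real \<Rightarrow> 'a \<Rightarrow> ennreal" where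
  "majlim c \<nu> f t x = (SUP n. maj c \<nu> f n t x)"

lemma measurable_maj:
  fixes f :: "'a::euclidean_space \<Rightarrow> ennreal"
  assumes [measurable]: "f \<in> borel_measurable borel"
  shows "case_prod (maj c \<nu> f n) \<in> borel_measurable (borel \<Otimes>\<^sub>M borel)"
proof (induction n)
  case (Suc n)
  note [measurable] = Suc
  show ?case by simp
qed simp

lemma measurable_majlim:
  fixes f :: "'a::euclidean_space \<Rightarrow> ennreal"
  assumes [measurable]: "f \<in> borel_measurable borel"
  shows "case_prod (majlim c \<nu> f) \<in> borel_measurable (borel \<Otimes>\<^sub>M borel)"
proof -
  note [measurable] = measurable_maj[OF assms]
  show ?thesis unfolding majlim_def by measurable
qed

lemma incseq_maj: "incseq (\<lambda>n. maj c \<nu> f n t x)"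
proof -
  have "maj c \<nu> f n t x \<le> maj c \<nu> f (Suc n) t x" for n t x
  proof (induction n arbitrary: t x)
    case (Suc n)
    show ?case
      unfolding maj.simps(2)[of c \<nu> f n] maj.simps(2)[of c \<nu> f "Suc n"]
      by (intro add_left_mono mult_left_mono duhamel_mono conv_mono Suc[unfolded maj.simps(2)[of c \<nu> f n]]) simp
  qed simp
  then show ?thesis by (rule incseq_SucI)
qed

lemma maj_le_majlim: "maj c \<nu> f n t x \<le> majlim c \<nu> f t x"
  unfolding majlim_def by (rule SUP_upper) simp

text \<open>With L the energy of the heat term, each step turns a bound X into 2 L + (2 c^2 / \<nu>)
  X^2. For X = 4 L the second term is 2 L times 16 c^2 L / \<nu>, hence at most 2 L: this is where
  16 comes from.\<close>

lemma energy_maj_le: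
  fixes f :: "'a::euclidean_space \<Rightarrow> ennreal"
  assumes [measurable]: "f \<in> borel_measurable borel" and "\<nu> > 0" "c \<ge> 0"
    and small: "ennreal (16 * c\<^sup>2 / \<nu>) * energy T (heat \<nu> f) \<le> 1"
  shows "energy T (maj c \<nu> f n) \<le> 4 * energy T (heat \<nu> f)"
proof (induction n)
  case 0
  then show ?case by (simp add: energy_def wint_0)
next
  case (Suc n)
  let ?l = "energy T (heat \<nu> f)" and ?m = "maj c \<nu> f n"
  note [measurable] = measurable_maj[of f c \<nu> n]
  have "energy T (maj c \<nu> f (Suc n))
      \<le> 2 * ?l + 2 * (ennreal c)\<^sup>2 * energy T (duhamel \<nu> (\<lambda>s. conv (?m s) (?m s)))"
    unfolding maj.simps by (rule energy_add_cmult_le) measurable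
  also have "\<dots> \<le> 2 * ?l + 2 * (ennreal c)\<^sup>2 * (ennreal (1 / \<nu>) * (flux T (\<lambda>s. conv (?m s) (?m s)))\<^sup>2)"
    by (intro add_left_mono mult_left_mono energy_duhamel_le \<open>\<nu> > 0\<close>) auto
  also have "\<dots> = 2 * ?l + 2 * (ennreal c)\<^sup>2 * (ennreal (1 / \<nu>) * (energy T ?m)\<^sup>2)"
    by (simp add: flux_conv_self)
  also have "\<dots> \<le> 2 * ?l + 2 * (ennreal c)\<^sup>2 * (ennreal (1 / \<nu>) * (4 * ?l)\<^sup>2)"
    by (intro add_left_mono mult_left_mono power_mono Suc) auto
  also have "\<dots> = 2 * ?l + 2 * ?l * (ennreal (16 * c\<^sup>2 / \<nu>) * ?l)"
  proof -
    have "ennreal (16 * c\<^sup>2 / \<nu>) = 16 * (ennreal c)\<^sup>2 * ennreal (1 / \<nu>)"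
      using assms by (simp add: ennreal_mult[symmetric] ennreal_power flip: ennreal_numeral)
    moreover have "2 * C * (N * (4 * L)\<^sup>2) = 2 * L * (16 * C * N * L)" for C N L :: ennreal
      by (simp add: power_mult_distrib power2_eq_square mult.assoc mult.left_commute)
    ultimately show ?thesis
      by simp
  qed
  also have "\<dots> \<le> 2 * ?l + 2 * ?l * 1"
    by (intro add_left_mono mult_left_mono small) auto
  also have "\<dots> = 4 * ?l"
    by (simp add: distrib_right[symmetric])
  finally show ?case .
qed

text \<open>Monotone convergence gives the limit of the chi^0 norms at each time, and Fatou carries
  the uniform energy bound over to the limit.\<close>

lemma energy_majlim_le:
  fixes f :: "'a::euclidean_space \<Rightarrow> ennreal"
  assumes [measurable]: "f \<in> borel_measurable borel" and "\<nu> > 0" "c \<ge> 0"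
    and small: "ennreal (16 * c\<^sup>2 / \<nu>) * energy T (heat \<nu> f) \<le> 1"
  shows "energy T (majlim c \<nu> f) \<le> 4 * energy T (heat \<nu> f)"
proof -
  note [measurable] = measurable_maj[of f c \<nu>] measurable_majlim[of f c \<nu>]
  have lim: "(\<lambda>n. (wint 0 (maj c \<nu> f n t))\<^sup>2 * indicator {0..T} t)
      \<longlonglongrightarrow> (wint 0 (majlim c \<nu> f t))\<^sup>2 * indicator {0..T} t" for t
  proof -
    have "wint 0 (majlim c \<nu> f t) = (SUP n. wint 0 (maj c \<nu> f n t))"
      unfolding majlim_def wint_0
      by (rule nn_integral_monotone_convergence_SUP) (auto simp: incseq_def le_fun_def incseq_maj[THEN incseqD])
    moreover have "incseq (\<lambda>n. wint 0 (maj c \<nu> f n t))"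
      by (intro incseq_SucI wint_mono_AE AE_I2 incseqD[OF incseq_maj]) simp
    ultimately have l: "(\<lambda>n. wint 0 (maj c \<nu> f n t)) \<longlonglongrightarrow> wint 0 (majlim c \<nu> f t)"
      using LIMSEQ_SUP by simp
    have "(\<lambda>n. (wint 0 (maj c \<nu> f n t))\<^sup>2) \<longlonglongrightarrow> (wint 0 (majlim c \<nu> f t))\<^sup>2"
      unfolding power2_eq_square by (rule tendsto_mult_ennreal[OF l l]) auto
    then show ?thesis
      by (auto simp: indicator_def)
  qed
  have "energy T (majlim c \<nu> f)
    = (\<integral>\<^sup>+t. liminf (\<lambda>n. (wint 0 (maj c \<nu> f n t))\<^sup>2 * indicator {0..T} t) \<partial>lborel)"
    unfolding energy_def by (intro nn_integral_cong lim_imp_Liminf[symmetric] lim) simp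
  also have "\<dots> \<le> liminf (\<lambda>n. energy T (maj c \<nu> f n))"
    unfolding energy_def by (rule nn_integral_liminf) measurable
  also have "\<dots> \<le> liminf (\<lambda>n. 4 * energy T (heat \<nu> f))"
    by (intro Liminf_mono always_eventually allI energy_maj_le assms)
  also have "\<dots> = 4 * energy T (heat \<nu> f)"
    by (simp add: Liminf_const)
  finally show ?thesis .
qed

text \<open>The two finiteness hypotheses on x do not mention t, so outside one null set of
  frequencies the majorant is finite at all times of [0,T].\<close>

lemma majlim_less_top:
  fixes f :: "'a::euclidean_space \<Rightarrow> ennreal"
  assumes [measurable]: "f \<in> borel_measurable borel" and "\<nu> > 0" "0 \<le> t" "t \<le> T"
    and "f x < \<infinity>" "(\<integral>\<^sup>+s\<in>{0..T}. conv (majlim c \<nu> f s) (majlim c \<nu> f s) x \<partial>lborel) < \<infinity>"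
  shows "majlim c \<nu> f t x < \<infinity>"
proof -
  note [measurable] = measurable_maj[of f c \<nu>] measurable_majlim[of f c \<nu>]
  let ?I = "\<integral>\<^sup>+s\<in>{0..T}. conv (majlim c \<nu> f s) (majlim c \<nu> f s) x \<partial>lborel"
  have "maj c \<nu> f n t x \<le> f x + ennreal c * (ennreal (norm x) * ?I)" for n
  proof (cases n)
    case (Suc k)
    have "duhamel \<nu> (\<lambda>s. conv (maj c \<nu> f k s) (maj c \<nu> f k s)) t x
      \<le> duhamel \<nu> (\<lambda>s. conv (majlim c \<nu> f s) (majlim c \<nu> f s)) t x"
      by (intro duhamel_mono conv_mono maj_le_majlim)
    also have "\<dots> \<le> ennreal (norm x) * ?I"
      by (rule duhamel_le) (use assms in auto)
    finally have "ennreal c * duhamel \<nu> (\<lambda>s. conv (maj c \<nu> f k s) (maj c \<nu> f k s)) t x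
      \<le> ennreal c * (ennreal (norm x) * ?I)"
      by (rule mult_left_mono) simp
    moreover have "heat \<nu> f t x \<le> f x"
    proof -
      have "ennreal (exp (- \<nu> * t * (norm x)\<^sup>2)) \<le> 1"
        using assms by simp
      from mult_right_mono[OF this, of "f x"] show ?thesis
        by (simp add: heat_def)
    qed
    ultimately show ?thesis
      unfolding Suc maj.simps by (rule add_mono[rotated])
  qed simp
  then have "majlim c \<nu> f t x \<le> f x + ennreal c * (ennreal (norm x) * ?I)"
    unfolding majlim_def by (rule SUP_least)
  also have "\<dots> < \<infinity>"
    using assms(5,6) by (simp add: ennreal_mult_less_top)
  finally show ?thesis .
qed

section \<open>The bilinear operator\<close>

lemma borel_measurable_vec_nth [measurable (raw)]:
  fixes f :: "'a \<Rightarrow> 'b::real_normed_vector ^ 'n"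
  assumes [measurable]: "f \<in> borel_measurable M"
  shows "(\<lambda>x. f x $ k) \<in> borel_measurable M"
  by (rule measurable_compose[OF assms borel_measurable_continuous_onI]) (intro continuous_intros)

lemma borel_measurable_vec_lambda [measurable (raw)]:
  fixes f :: "'n::finite \<Rightarrow> 'a \<Rightarrow> 'b::euclidean_space"
  assumes [measurable]: "\<And>j. f j \<in> borel_measurable M"
  shows "(\<lambda>x. \<chi> j. f j x) \<in> borel_measurable M"
  by (subst borel_measurable_euclidean_space) (auto simp: Basis_vec_def inner_axis)

lemma borel_measurable_cnj [measurable (raw)]:
  assumes [measurable]: "f \<in> borel_measurable M"
  shows "(\<lambda>x. cnj (f x)) \<in> borel_measurable M"
  by (rule measurable_compose[OF assms borel_measurable_continuous_onI]) (intro continuous_intros)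

section \<open>Bochner integrals controlled by extended nonnegative bounds\<close>

lemma ennreal_norm_integral_le:
  fixes f :: "'a \<Rightarrow> 'b::{banach, second_countable_topology}"
  shows "ennreal (norm (integral\<^sup>L M f)) \<le> (\<integral>\<^sup>+x. ennreal (norm (f x)) \<partial>M)"
  by (cases "integrable M f") (auto simp: integral_norm_bound_ennreal not_integrable_integral_eq)

lemma integrable_ennreal_bound:
  fixes f :: "'a \<Rightarrow> 'b::{banach, second_countable_topology}"
  assumes "f \<in> borel_measurable M" "AE x in M. ennreal (norm (f x)) \<le> w x" "(\<integral>\<^sup>+x. w x \<partial>M) < \<infinity>"
  shows "integrable M f"
  using assms nn_integral_mono_AE[OF assms(2)] by (auto simp: integrable_iff_bounded)

text \<open>The majorant \<open>w\<close> may be infinite on a null set; its real part is the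
  integrable majorant passed to the usual theorem.\<close>

lemma integral_ennreal_dominated_convergence:
  fixes f :: "'a \<Rightarrow> 'b::{banach, second_countable_topology}"
  assumes [measurable]: "f \<in> borel_measurable M" "\<And>n. s n \<in> borel_measurable M" "w \<in> borel_measurable M"
    and fin: "(\<integral>\<^sup>+x. w x \<partial>M) < \<infinity>"
    and lim: "AE x in M. (\<lambda>n. s n x) \<longlonglongrightarrow> f x"
    and bound: "\<And>n. AE x in M. ennreal (norm (s n x)) \<le> w x"
  shows "(\<lambda>n. integral\<^sup>L M (s n)) \<longlonglongrightarrow> integral\<^sup>L M f"
proof (rule integral_dominated_convergence[where w="\<lambda>x. enn2real (w x)"])
  have w: "AE x in M. w x \<noteq> \<infinity>"
    by (rule nn_integral_PInf_AE) (use fin in auto)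
  show "integrable M (\<lambda>x. enn2real (w x))"
  proof (rule integrable_ennreal_bound[OF _ _ fin])
    show "AE x in M. ennreal (norm (enn2real (w x))) \<le> w x"
      by (intro AE_I2) (simp add: enn2real_nonneg ennreal_enn2real_if)
  qed measurable
  show "AE x in M. norm (s n x) \<le> enn2real (w x)" for n
    using w bound[of n]
  proof eventually_elim
    case (elim x)
    then have "w x = ennreal (enn2real (w x))"
      by (simp add: less_top)
    with elim(2) show ?case
      by (metis enn2real_nonneg ennreal_le_iff)
  qed
qed (use lim in auto)

section \<open>Fourier transforms of products\<close>

abbreviation vabs :: "('a \<Rightarrow> 'b::real_normed_vector) \<Rightarrow> 'a \<Rightarrow> ennreal" where
  "vabs F \<equiv> \<lambda>\<xi>. ennreal (norm (F \<xi>))"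

lemma ennreal_mult_norm_le:
  fixes x y :: "complex^'n"
  shows "ennreal (norm (x $ k * y $ l)) \<le> ennreal (norm x) * ennreal (norm y)"
proof -
  have "norm (x $ k * y $ l) \<le> norm x * norm y"
    unfolding norm_mult by (intro mult_mono Finite_Cartesian_Product.norm_nth_le) auto
  then have "ennreal (norm (x $ k * y $ l)) \<le> ennreal (norm x * norm y)"
    by (rule ennreal_leI)
  then show ?thesis by (simp add: ennreal_mult)
qed

lemma measurable_prod_hat [measurable (raw)]:
  assumes [measurable]: "case_prod U \<in> borel_measurable (M \<Otimes>\<^sub>M borel)"
    "case_prod V \<in> borel_measurable (M \<Otimes>\<^sub>M borel)" "h \<in> borel_measurable M"
  shows "(\<lambda>z. prod_hat (U z) (V z) k l (h z)) \<in> borel_measurable M"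
  unfolding prod_hat_def by measurable

text \<open>The normalisation (2 pi)^(-3) is at most 1 and is simply dropped from all later
  constants.\<close>

lemma ennreal_norm_scaled_integral_le:
  fixes f :: "'a \<Rightarrow> complex"
  shows "ennreal (norm (complex_of_real ((2 * pi) powi (-3)) * integral\<^sup>L M f)) \<le> (\<integral>\<^sup>+x. ennreal (norm (f x)) \<partial>M)"
proof -
  have "norm (complex_of_real ((2 * pi) powi (-3)) * integral\<^sup>L M f) \<le> 1 * norm (integral\<^sup>L M f)"
    unfolding norm_mult
  proof (rule mult_right_mono)
    have "1 \<le> (2 * pi) ^ 3"
      using pi_gt3 by (intro one_le_power) simp
    from le_imp_inverse_le[OF this] have "inverse ((2 * pi) ^ 3) \<le> 1"
      by simp
    moreover have "(2 * pi) powi (-3) = inverse ((2 * pi) ^ 3)"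
      by (simp only: power_int_minus power_int_numeral)
    ultimately show "norm (complex_of_real ((2 * pi) powi (-3))) \<le> 1"
      unfolding norm_of_real by simp
  qed simp
  then have "ennreal (norm (complex_of_real ((2 * pi) powi (-3)) * integral\<^sup>L M f)) \<le> ennreal (norm (integral\<^sup>L M f))"
    by (intro ennreal_leI) simp
  also have "\<dots> \<le> (\<integral>\<^sup>+x. ennreal (norm (f x)) \<partial>M)"
    by (rule ennreal_norm_integral_le)
  finally show ?thesis .
qed

text \<open>No integrability is assumed: where the convolution integral does not exist,
  \<open>prod_hat\<close> is 0.\<close>

lemma prod_hat_le_conv:
  "ennreal (norm (prod_hat U V k l \<xi>)) \<le> conv (vabs U) (vabs V) \<xi>"
proof -
  have "ennreal (norm (prod_hat U V k l \<xi>)) \<le> (\<integral>\<^sup>+\<eta>. ennreal (norm (U (\<xi> - \<eta>) $ k * V \<eta> $ l)) \<partial>lborel)"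
    unfolding prod_hat_def by (rule ennreal_norm_scaled_integral_le)
  also have "\<dots> \<le> conv (vabs U) (vabs V) \<xi>"
    unfolding conv_def by (intro nn_integral_mono ennreal_mult_norm_le)
  finally show ?thesis .
qed

lemma integrable_prod_hat:
  fixes U V :: fvec
  assumes [measurable]: "U \<in> borel_measurable borel" "V \<in> borel_measurable borel"
    and "conv (vabs U) (vabs V) \<xi> < \<infinity>"
  shows "integrable lborel (\<lambda>\<eta>. U (\<xi> - \<eta>) $ k * V \<eta> $ l)"
proof (rule integrable_ennreal_bound[OF _ _ assms(3)[unfolded conv_def]])
  show "AE \<eta> in lborel. ennreal (norm (U (\<xi> - \<eta>) $ k * V \<eta> $ l)) \<le> vabs U (\<xi> - \<eta>) * vabs V \<eta>"
    by (intro AE_I2 ennreal_mult_norm_le)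
qed measurable

text \<open>Rests on u u - v v = (u - v) u + v (u - v). Here finiteness matters: the difference of
  two Bochner integrals is the integral of the difference only if both converge absolutely.\<close>

lemma prod_hat_diff_le:
  assumes [measurable]: "U \<in> borel_measurable borel" "V \<in> borel_measurable borel"
    and "conv (vabs U) (vabs U) \<xi> < \<infinity>" "conv (vabs V) (vabs V) \<xi> < \<infinity>"
  shows "ennreal (norm (prod_hat U U k l \<xi> - prod_hat V V k l \<xi>))
    \<le> conv (vabs (\<lambda>\<xi>. U \<xi> - V \<xi>)) (vabs U) \<xi> + conv (vabs V) (vabs (\<lambda>\<xi>. U \<xi> - V \<xi>)) \<xi>"
proof -
  let ?f = "\<lambda>\<eta>. U (\<xi> - \<eta>) $ k * U \<eta> $ l - V (\<xi> - \<eta>) $ k * V \<eta> $ l"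
  note [simp] = integrable_prod_hat[OF assms(1,1,3)] integrable_prod_hat[OF assms(2,2,4)]
  have eq: "prod_hat U U k l \<xi> - prod_hat V V k l \<xi> = complex_of_real ((2 * pi) powi (-3)) * integral\<^sup>L lborel ?f"
    unfolding prod_hat_def right_diff_distrib[symmetric]
    by (subst Bochner_Integration.integral_diff) simp_all
  have "ennreal (norm (prod_hat U U k l \<xi> - prod_hat V V k l \<xi>)) \<le> (\<integral>\<^sup>+\<eta>. ennreal (norm (?f \<eta>)) \<partial>lborel)"
    unfolding eq by (rule ennreal_norm_scaled_integral_le)
  also have "\<dots> \<le> (\<integral>\<^sup>+\<eta>. ennreal (norm (U (\<xi> - \<eta>) - V (\<xi> - \<eta>))) * ennreal (norm (U \<eta>))
     + ennreal (norm (V (\<xi> - \<eta>))) * ennreal (norm (U \<eta> - V \<eta>)) \<partial>lborel)"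
  proof (rule nn_integral_mono)
    fix \<eta>
    have "?f \<eta> = (U (\<xi> - \<eta>) - V (\<xi> - \<eta>)) $ k * U \<eta> $ l + V (\<xi> - \<eta>) $ k * (U \<eta> - V \<eta>) $ l"
      by (simp add: algebra_simps)
    then have "norm (?f \<eta>) \<le> norm ((U (\<xi> - \<eta>) - V (\<xi> - \<eta>)) $ k * U \<eta> $ l) + norm (V (\<xi> - \<eta>) $ k * (U \<eta> - V \<eta>) $ l)"
      by (metis norm_triangle_ineq)
    then have "ennreal (norm (?f \<eta>)) \<le> ennreal (norm ((U (\<xi> - \<eta>) - V (\<xi> - \<eta>)) $ k * U \<eta> $ l))
       + ennreal (norm (V (\<xi> - \<eta>) $ k * (U \<eta> - V \<eta>) $ l))"
      by (simp add: ennreal_leI flip: ennreal_plus)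
    also have "\<dots> \<le> ennreal (norm (U (\<xi> - \<eta>) - V (\<xi> - \<eta>))) * ennreal (norm (U \<eta>))
     + ennreal (norm (V (\<xi> - \<eta>))) * ennreal (norm (U \<eta> - V \<eta>))"
      by (intro add_mono ennreal_mult_norm_le)
    finally show "ennreal (norm (?f \<eta>)) \<le> ennreal (norm (U (\<xi> - \<eta>) - V (\<xi> - \<eta>))) * ennreal (norm (U \<eta>))
     + ennreal (norm (V (\<xi> - \<eta>))) * ennreal (norm (U \<eta> - V \<eta>))" .
  qed
  also have "\<dots> = conv (vabs (\<lambda>\<xi>. U \<xi> - V \<xi>)) (vabs U) \<xi> + conv (vabs V) (vabs (\<lambda>\<xi>. U \<xi> - V \<xi>)) \<xi>"
    unfolding conv_def by (rule nn_integral_add) measurable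
  finally show ?thesis .
qed

lemma prod_hat_tendsto:
  assumes [measurable]: "\<And>n. W n \<in> borel_measurable borel" "U \<in> borel_measurable borel" "m \<in> borel_measurable borel"
    and le: "\<And>n \<eta>. ennreal (norm (W n \<eta>)) \<le> m \<eta>"
    and lim: "AE \<eta> in lborel. (\<lambda>n. W n \<eta>) \<longlonglongrightarrow> U \<eta>"
    and fin: "conv m m \<xi> < \<infinity>"
  shows "(\<lambda>n. prod_hat (W n) (W n) k l \<xi>) \<longlonglongrightarrow> prod_hat U U k l \<xi>"
  unfolding prod_hat_def
proof (intro tendsto_mult tendsto_const integral_ennreal_dominated_convergence[OF _ _ _ fin[unfolded conv_def]])
  show "AE \<eta> in lborel. (\<lambda>n. W n (\<xi> - \<eta>) $ k * W n \<eta> $ l) \<longlonglongrightarrow> U (\<xi> - \<eta>) $ k * U \<eta> $ l"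
    using lim AE_lborel_reflect[OF lim, of \<xi>] by eventually_elim (intro tendsto_intros)
  show "AE \<eta> in lborel. ennreal (norm (W n (\<xi> - \<eta>) $ k * W n \<eta> $ l)) \<le> m (\<xi> - \<eta>) * m \<eta>" for n
    by (intro AE_I2 order.trans[OF ennreal_mult_norm_le] mult_mono le) auto
qed measurable

text \<open>The equality holds at every \<xi>, since the reflection of a null set about any point is
  null.\<close>

lemma prod_hat_cong_AE:
  assumes [measurable]: "U \<in> borel_measurable borel" "V \<in> borel_measurable borel"
    and ae: "AE \<xi> in lborel. U \<xi> = V \<xi>"
  shows "prod_hat U U k l \<xi> = prod_hat V V k l \<xi>"
proof -
  have "(\<integral>\<eta>. U (\<xi> - \<eta>) $ k * U \<eta> $ l \<partial>lborel) = (\<integral>\<eta>. V (\<xi> - \<eta>) $ k * V \<eta> $ l \<partial>lborel)"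
    by (rule integral_cong_AE, measurable, use ae AE_lborel_reflect[OF ae, of \<xi>] in eventually_elim) simp
  then show ?thesis by (simp add: prod_hat_def)
qed

text \<open>The substitution of -\<eta> for \<eta> reduces this to the Hermitian symmetry of both
  factors. Again it holds at every \<xi>.\<close>

lemma prod_hat_uminus:
  assumes [measurable]: "U \<in> borel_measurable borel" and re: "real_field U"
  shows "prod_hat U U k l (- \<xi>) = cnj (prod_hat U U k l \<xi>)"
proof -
  from re have ae: "AE \<xi> in lborel. U (- \<xi>) = (\<chi> j. cnj (U \<xi> $ j))"
    by (simp add: real_field_def)
  have "(\<integral>\<eta>. U (- \<xi> - \<eta>) $ k * U \<eta> $ l \<partial>lborel) = (\<integral>\<eta>. U (- \<xi> - (0 - \<eta>)) $ k * U (0 - \<eta>) $ l \<partial>lborel)"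
    by (rule integral_reflect[symmetric]) measurable
  also have "\<dots> = (\<integral>\<eta>. cnj (U (\<xi> - \<eta>) $ k * U \<eta> $ l) \<partial>lborel)"
  proof (rule integral_cong_AE)
    show "AE \<eta> in lborel. U (- \<xi> - (0 - \<eta>)) $ k * U (0 - \<eta>) $ l = cnj (U (\<xi> - \<eta>) $ k * U \<eta> $ l)"
      using ae AE_lborel_reflect[OF ae, of \<xi>] by eventually_elim simp
  qed measurable
  also have "\<dots> = cnj (\<integral>\<eta>. U (\<xi> - \<eta>) $ k * U \<eta> $ l \<partial>lborel)"
    by (rule Bochner_Integration.integral_cnj)
  finally show ?thesis
    by (simp add: prod_hat_def)
qed

section \<open>The Fourier symbol of Q\<close>

type_synonym qcoeff = "3 \<Rightarrow> 3 \<Rightarrow> 3 \<Rightarrow> 3 \<Rightarrow> 3 \<Rightarrow> 3 \<Rightarrow> real"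

text \<open>The multiplier of \<open>Q_hat\<close> applied to an arbitrary matrix X of products;
  linearity in X reduces differences of Q to differences of products.\<close>

definition qsymbol :: "qcoeff \<Rightarrow> real^3 \<Rightarrow> (3 \<Rightarrow> 3 \<Rightarrow> complex) \<Rightarrow> 3 \<Rightarrow> complex" where
  "qsymbol a \<xi> X j = (\<Sum>k\<in>UNIV. \<Sum>l\<in>UNIV. \<Sum>m\<in>UNIV. \<Sum>n\<in>UNIV. \<Sum>p\<in>UNIV.
       complex_of_real (a j m p n k l) * \<i> * complex_of_real (\<xi> $ m)
       * complex_of_real (\<xi> $ n * \<xi> $ p / (norm \<xi>)\<^sup>2) * X k l)"

text \<open>Summing over j as well makes the bound uniform in the component; the summand 1 keeps the
  constant positive when all coefficients vanish.\<close>

definition qconst :: "qcoeff \<Rightarrow> real" where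
  "qconst a = 1 + (\<Sum>j\<in>UNIV. \<Sum>k\<in>UNIV. \<Sum>l\<in>UNIV. \<Sum>m\<in>UNIV. \<Sum>n\<in>UNIV. \<Sum>p\<in>UNIV. \<bar>a j m p n k l\<bar>)"

lemma qconst_pos: "qconst a > 0"
  unfolding qconst_def by (intro add_pos_nonneg sum_nonneg) auto

lemma Q_hat_nth: "Q_hat a U V \<xi> $ j = qsymbol a \<xi> (\<lambda>k l. prod_hat U V k l \<xi>) j"
  by (simp add: Q_hat_def qsymbol_def)

lemma qsymbol_diff: "qsymbol a \<xi> X j - qsymbol a \<xi> Y j = qsymbol a \<xi> (\<lambda>k l. X k l - Y k l) j"
  by (simp only: qsymbol_def sum_subtractf right_diff_distrib)

lemma qsymbol_zero [simp]: "qsymbol a 0 X j = 0"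
  by (simp add: qsymbol_def)

lemma qsymbol_uminus: "qsymbol a (- \<xi>) (\<lambda>k l. cnj (X k l)) j = cnj (qsymbol a \<xi> X j)"
  by (simp add: qsymbol_def)

lemma norm_qsymbol_le:
  assumes X: "\<And>k l. norm (X k l) \<le> B"
  shows "norm (qsymbol a \<xi> X j) \<le> qconst a * norm \<xi> * B"
proof -
  have B: "B \<ge> 0" using X norm_ge_zero order.trans by blast
  have "norm (qsymbol a \<xi> X j) \<le> (\<Sum>k\<in>UNIV. \<Sum>l\<in>UNIV. \<Sum>m\<in>UNIV. \<Sum>n\<in>UNIV. \<Sum>p\<in>UNIV. \<bar>a j m p n k l\<bar> * (norm \<xi> * B))"
    unfolding qsymbol_def
  proof (intro sum_norm_le)
    fix k l m n p
    have m: "\<bar>\<xi> $ m\<bar> \<le> norm \<xi>" for m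
      by (rule component_le_norm_cart)
    have "\<bar>\<xi> $ n\<bar> * \<bar>\<xi> $ p\<bar> \<le> (norm \<xi>)\<^sup>2"
      unfolding power2_eq_square by (intro mult_mono m) auto
    then have "\<bar>\<xi> $ n\<bar> * \<bar>\<xi> $ p\<bar> / (norm \<xi>)\<^sup>2 \<le> 1"
      by (cases "\<xi> = 0") auto
    then have "\<bar>\<xi> $ m\<bar> * (\<bar>\<xi> $ n\<bar> * \<bar>\<xi> $ p\<bar> / (norm \<xi>)\<^sup>2) * norm (X k l) \<le> norm \<xi> * 1 * B"
      by (intro mult_mono m X) auto
    then have "\<bar>a j m p n k l\<bar> * (\<bar>\<xi> $ m\<bar> * (\<bar>\<xi> $ n\<bar> * \<bar>\<xi> $ p\<bar> / (norm \<xi>)\<^sup>2) * norm (X k l)) \<le> \<bar>a j m p n k l\<bar> * (norm \<xi> * B)"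
      by (intro mult_left_mono) auto
    then show "norm (complex_of_real (a j m p n k l) * \<i> * complex_of_real (\<xi> $ m)
       * complex_of_real (\<xi> $ n * \<xi> $ p / (norm \<xi>)\<^sup>2) * X k l) \<le> \<bar>a j m p n k l\<bar> * (norm \<xi> * B)"
      by (simp add: norm_mult norm_divide norm_power mult.assoc)
  qed
  also have "\<dots> = (\<Sum>k\<in>UNIV. \<Sum>l\<in>UNIV. \<Sum>m\<in>UNIV. \<Sum>n\<in>UNIV. \<Sum>p\<in>UNIV. \<bar>a j m p n k l\<bar>) * (norm \<xi> * B)"
    by (simp add: sum_distrib_right)
  also have "\<dots> \<le> qconst a * (norm \<xi> * B)"
  proof (rule mult_right_mono)
    have "(\<Sum>k\<in>UNIV. \<Sum>l\<in>UNIV. \<Sum>m\<in>UNIV. \<Sum>n\<in>UNIV. \<Sum>p\<in>UNIV. \<bar>a j m p n k l\<bar>)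
      \<le> (\<Sum>j\<in>UNIV. \<Sum>k\<in>UNIV. \<Sum>l\<in>UNIV. \<Sum>m\<in>UNIV. \<Sum>n\<in>UNIV. \<Sum>p\<in>UNIV. \<bar>a j m p n k l\<bar>)"
      by (rule member_le_sum) (auto intro!: sum_nonneg)
    then show "(\<Sum>k\<in>UNIV. \<Sum>l\<in>UNIV. \<Sum>m\<in>UNIV. \<Sum>n\<in>UNIV. \<Sum>p\<in>UNIV. \<bar>a j m p n k l\<bar>) \<le> qconst a"
      unfolding qconst_def by linarith
  qed (use B in auto)
  finally show ?thesis by (simp add: mult.assoc)
qed

lemma ennreal_norm_qsymbol_le:
  assumes X: "\<And>k l. ennreal (norm (X k l)) \<le> B"
  shows "ennreal (norm (qsymbol a \<xi> X j)) \<le> ennreal (qconst a * norm \<xi>) * B"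
proof (cases B)
  case (real b)
  then have "norm (qsymbol a \<xi> X j) \<le> qconst a * norm \<xi> * b"
    using X by (intro norm_qsymbol_le) (simp add: ennreal_le_iff)
  then have "ennreal (norm (qsymbol a \<xi> X j)) \<le> ennreal (qconst a * norm \<xi> * b)"
    by (rule ennreal_leI)
  with real show ?thesis
    by (simp add: ennreal_mult qconst_pos less_imp_le)
next
  case top
  \<comment> \<open>For infinite B the bound is infinite off the origin. At the origin it is 0 times
    infinity, which is 0, and the symbol vanishes there too.\<close>
  show ?thesis
  proof (cases "\<xi> = 0")
    case False
    then show ?thesis using top qconst_pos[of a] by (simp add: ennreal_mult_top)
  qed simp
qed

lemma norm_Q_hat_nth_le:
  "ennreal (norm (Q_hat a U V \<xi> $ j)) \<le> ennreal (qconst a * norm \<xi>) * conv (vabs U) (vabs V) \<xi>"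
  unfolding Q_hat_nth by (intro ennreal_norm_qsymbol_le prod_hat_le_conv)

text \<open>The alternative \<xi> = 0 matches \<open>AE_finite_of_duhamel\<close>, which yields
  finite convolutions only off the origin.\<close>

lemma norm_Q_hat_nth_diff_le:
  assumes "U \<in> borel_measurable borel" "V \<in> borel_measurable borel"
    and "\<xi> = 0 \<or> conv (vabs U) (vabs U) \<xi> < \<infinity> \<and> conv (vabs V) (vabs V) \<xi> < \<infinity>"
  shows "ennreal (norm (Q_hat a U U \<xi> $ j - Q_hat a V V \<xi> $ j)) \<le> ennreal (qconst a * norm \<xi>) *
    (conv (vabs (\<lambda>\<xi>. U \<xi> - V \<xi>)) (vabs U) \<xi> + conv (vabs V) (vabs (\<lambda>\<xi>. U \<xi> - V \<xi>)) \<xi>)"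
proof (cases "\<xi> = 0")
  case False
  then show ?thesis
    unfolding Q_hat_nth qsymbol_diff by (intro ennreal_norm_qsymbol_le prod_hat_diff_le assms(1,2)) (use assms(3) in auto)
qed (simp add: Q_hat_nth)

lemma measurable_Q_hat_nth [measurable (raw)]:
  assumes [measurable]: "case_prod U \<in> borel_measurable (M \<Otimes>\<^sub>M borel)"
    "case_prod V \<in> borel_measurable (M \<Otimes>\<^sub>M borel)" "h \<in> borel_measurable M"
  shows "(\<lambda>z. Q_hat a (U z) (V z) (h z) $ j) \<in> borel_measurable M"
  unfolding Q_hat_nth qsymbol_def by measurable

lemma Q_hat_nth_tendsto:
  assumes "\<And>n. W n \<in> borel_measurable borel" "U \<in> borel_measurable borel" "m \<in> borel_measurable borel"
    and "\<And>n \<eta>. ennreal (norm (W n \<eta>)) \<le> m \<eta>"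
    and "AE \<eta> in lborel. (\<lambda>n. W n \<eta>) \<longlonglongrightarrow> U \<eta>"
    and "conv m m \<xi> < \<infinity>"
  shows "(\<lambda>n. Q_hat a (W n) (W n) \<xi> $ j) \<longlonglongrightarrow> Q_hat a U U \<xi> $ j"
  unfolding Q_hat_nth qsymbol_def by (intro tendsto_intros prod_hat_tendsto[OF assms])

lemma Q_hat_cong_AE:
  assumes "U \<in> borel_measurable borel" "V \<in> borel_measurable borel" "AE \<xi> in lborel. U \<xi> = V \<xi>"
  shows "Q_hat a U U \<xi> = Q_hat a V V \<xi>"
  by (simp add: Q_hat_def prod_hat_cong_AE[OF assms])

lemma Q_hat_nth_uminus:
  assumes "U \<in> borel_measurable borel" "real_field U"
  shows "Q_hat a U U (- \<xi>) $ j = cnj (Q_hat a U U \<xi> $ j)"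
  by (simp add: Q_hat_nth prod_hat_uminus[OF assms] qsymbol_uminus)

section \<open>Picard iteration\<close>

lemma ennreal_norm_vec_le:
  fixes x :: "'b::real_normed_vector ^ 'n"
  shows "ennreal (norm x) \<le> (\<Sum>j\<in>UNIV. ennreal (norm (x $ j)))"
proof -
  have "norm x \<le> (\<Sum>j\<in>UNIV. norm (x $ j))"
    unfolding norm_vec_def by (rule L2_set_le_sum) simp
  then show ?thesis
    by (simp add: ennreal_leI)
qed

definition picard :: "qcoeff \<Rightarrow> real \<Rightarrow> fvec \<Rightarrow> (real \<Rightarrow> fvec) \<Rightarrow> real \<Rightarrow> fvec" where
  "picard a \<nu> U0 U t \<xi> = (\<chi> j. complex_of_real (exp (- \<nu> * t * (norm \<xi>)\<^sup>2)) * U0 \<xi> $ j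
     + (LINT s:{0..t}|lborel. complex_of_real (exp (- \<nu> * (t - s) * (norm \<xi>)\<^sup>2)) * Q_hat a (U s) (U s) \<xi> $ j))"

lemma mild_sol_iff:
  "mild_sol a \<nu> U0 T U \<longleftrightarrow> (\<forall>t\<in>{0..T}. AE \<xi> in lborel. U t \<xi> = picard a \<nu> U0 U t \<xi>)"
  by (simp add: mild_sol_def picard_def)

lemma measurable_picard:
  assumes [measurable]: "U0 \<in> borel_measurable borel" "case_prod U \<in> borel_measurable (borel \<Otimes>\<^sub>M borel)"
  shows "case_prod (picard a \<nu> U0 U) \<in> borel_measurable (borel \<Otimes>\<^sub>M borel)"
  unfolding picard_def set_lebesgue_integral_def by measurable

lemma norm_duhamel_integrand_le:
  fixes q :: complex
  assumes "ennreal (norm q) \<le> ennreal (K * r) * B" "K \<ge> 0" "r \<ge> 0"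
  shows "ennreal (norm (indicator A s *\<^sub>R (complex_of_real (exp e) * q)))
    \<le> ennreal K * (ennreal (exp e * r) * B * indicator A s)"
proof (cases "s \<in> A")
  case True
  have "ennreal (norm (complex_of_real (exp e) * q)) = ennreal (exp e) * ennreal (norm q)"
    by (simp add: norm_mult ennreal_mult)
  also have "\<dots> \<le> ennreal (exp e) * (ennreal (K * r) * B)"
    by (intro mult_left_mono assms) simp
  finally show ?thesis
    using True assms by (simp add: ennreal_mult ac_simps)
qed simp

text \<open>The pointwise bound is asked for almost every s only, because differences of Q can be
  estimated only at those s where the convolutions are finite.\<close>

lemma norm_duhamel_integral_le:
  fixes q :: "real \<Rightarrow> complex"
  assumes q: "AE s in lborel. s \<in> {0..t} \<longrightarrow> ennreal (norm (q s)) \<le> ennreal (K * norm \<xi>) * m s \<xi>"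
    and "K \<ge> 0" and [measurable]: "(\<lambda>s. m s \<xi>) \<in> borel_measurable borel"
  shows "ennreal (norm (LINT s:{0..t}|lborel. complex_of_real (exp (- \<nu> * (t - s) * (norm \<xi>)\<^sup>2)) * q s))
    \<le> ennreal K * duhamel \<nu> m t \<xi>"
proof -
  have "ennreal (norm (LINT s:{0..t}|lborel. complex_of_real (exp (- \<nu> * (t - s) * (norm \<xi>)\<^sup>2)) * q s))
    \<le> (\<integral>\<^sup>+s. ennreal (norm (indicator {0..t} s *\<^sub>R (complex_of_real (exp (- \<nu> * (t - s) * (norm \<xi>)\<^sup>2)) * q s))) \<partial>lborel)"
    unfolding set_lebesgue_integral_def by (rule ennreal_norm_integral_le)
  also have "\<dots> \<le> (\<integral>\<^sup>+s. ennreal K * (ennreal (exp (- \<nu> * (t - s) * (norm \<xi>)\<^sup>2) * norm \<xi>) * m s \<xi> * indicator {0..t} s) \<partial>lborel)"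
  proof (rule nn_integral_mono_AE, use q in eventually_elim)
    fix s assume "s \<in> {0..t} \<longrightarrow> ennreal (norm (q s)) \<le> ennreal (K * norm \<xi>) * m s \<xi>"
    then show "ennreal (norm (indicator {0..t} s *\<^sub>R (complex_of_real (exp (- \<nu> * (t - s) * (norm \<xi>)\<^sup>2)) * q s)))
      \<le> ennreal K * (ennreal (exp (- \<nu> * (t - s) * (norm \<xi>)\<^sup>2) * norm \<xi>) * m s \<xi> * indicator {0..t} s)"
      by (cases "s \<in> {0..t}") (simp_all only: norm_duhamel_integrand_le[OF _ \<open>K \<ge> 0\<close>] norm_ge_zero simp_thms, simp)
  qed
  also have "\<dots> = ennreal K * duhamel \<nu> m t \<xi>"
    unfolding duhamel_def by (rule nn_integral_cmult) measurable
  finally show ?thesis .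
qed

lemma duhamel_set_integrable:
  fixes q :: "real \<Rightarrow> complex"
  assumes q: "\<And>s. ennreal (norm (q s)) \<le> ennreal (K * norm \<xi>) * m s \<xi>"
    and "K \<ge> 0" and [measurable]: "(\<lambda>s. m s \<xi>) \<in> borel_measurable borel" "q \<in> borel_measurable borel"
    and fin: "duhamel \<nu> m t \<xi> < \<infinity>"
  shows "set_integrable lborel {0..t} (\<lambda>s. complex_of_real (exp (- \<nu> * (t - s) * (norm \<xi>)\<^sup>2)) * q s)"
  unfolding set_integrable_def
proof (rule integrable_ennreal_bound)
  show "AE s in lborel. ennreal (norm (indicator {0..t} s *\<^sub>R (complex_of_real (exp (- \<nu> * (t - s) * (norm \<xi>)\<^sup>2)) * q s)))
      \<le> ennreal K * (ennreal (exp (- \<nu> * (t - s) * (norm \<xi>)\<^sup>2) * norm \<xi>) * m s \<xi> * indicator {0..t} s)"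
    by (intro AE_I2 norm_duhamel_integrand_le q \<open>K \<ge> 0\<close> norm_ge_zero)
  have "(\<integral>\<^sup>+s. ennreal K * (ennreal (exp (- \<nu> * (t - s) * (norm \<xi>)\<^sup>2) * norm \<xi>) * m s \<xi> * indicator {0..t} s) \<partial>lborel)
    = ennreal K * duhamel \<nu> m t \<xi>"
    unfolding duhamel_def by (rule nn_integral_cmult) measurable
  then show "(\<integral>\<^sup>+s. ennreal K * (ennreal (exp (- \<nu> * (t - s) * (norm \<xi>)\<^sup>2) * norm \<xi>) * m s \<xi> * indicator {0..t} s) \<partial>lborel) < \<infinity>"
    using fin by (simp add: ennreal_mult_less_top)
qed measurable

text \<open>Off the origin the kernel is positive, so a finite integral forces \<open>m\<close> to
  be finite almost everywhere in time. At the origin the kernel is 0 and nothing follows.\<close>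

lemma AE_finite_of_duhamel:
  assumes [measurable]: "(\<lambda>s. m s x) \<in> borel_measurable borel"
    and fin: "duhamel \<nu> m t x < \<infinity>"
  shows "AE s in lborel. s \<in> {0..t} \<longrightarrow> x = 0 \<or> m s x < \<infinity>"
proof -
  have "AE s in lborel. ennreal (exp (- \<nu> * (t - s) * (norm x)\<^sup>2) * norm x) * m s x * indicator {0..t} s \<noteq> \<infinity>"
    by (rule nn_integral_PInf_AE) (use fin in \<open>auto simp: duhamel_def\<close>)
  then show ?thesis
    by eventually_elim (auto simp: less_top ennreal_mult_eq_top_iff)
qed

text \<open>The factor 3 arises from bounding the norm of a vector by the sum of its three
  components.\<close>

definition qbound :: "qcoeff \<Rightarrow> real" where
  "qbound a = 3 * qconst a"

lemma qbound_pos: "qbound a > 0"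
  by (simp add: qbound_def qconst_pos)

lemma sum_UNIV_3_const: "(\<Sum>j\<in>(UNIV::3 set). ennreal (qconst a) * x) = ennreal (qbound a) * x"
  by (simp add: qbound_def ennreal_mult mult.assoc qconst_pos less_imp_le flip: ennreal_numeral)

lemma norm_picard_le:
  assumes [measurable]: "case_prod U \<in> borel_measurable (borel \<Otimes>\<^sub>M borel)"
  shows "ennreal (norm (picard a \<nu> U0 U t \<xi>))
    \<le> heat \<nu> (vabs U0) t \<xi> + ennreal (qbound a) * duhamel \<nu> (\<lambda>s. conv (vabs (U s)) (vabs (U s))) t \<xi>"
proof -
  let ?I = "\<lambda>j. LINT s:{0..t}|lborel. complex_of_real (exp (- \<nu> * (t - s) * (norm \<xi>)\<^sup>2)) * Q_hat a (U s) (U s) \<xi> $ j"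
  let ?D = "duhamel \<nu> (\<lambda>s. conv (vabs (U s)) (vabs (U s))) t \<xi>"
  have "picard a \<nu> U0 U t \<xi> = exp (- \<nu> * t * (norm \<xi>)\<^sup>2) *\<^sub>R U0 \<xi> + (\<chi> j. ?I j)"
    by (simp add: picard_def vec_eq_iff scaleR_conv_of_real[where 'a=complex])
  then have "norm (picard a \<nu> U0 U t \<xi>) \<le> norm (exp (- \<nu> * t * (norm \<xi>)\<^sup>2) *\<^sub>R U0 \<xi>) + norm (\<chi> j. ?I j)"
    by (simp only: norm_triangle_ineq)
  then have "ennreal (norm (picard a \<nu> U0 U t \<xi>)) \<le> heat \<nu> (vabs U0) t \<xi> + ennreal (norm (\<chi> j. ?I j))"
    by (simp add: heat_def ennreal_leI flip: ennreal_plus ennreal_mult)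
  also have "ennreal (norm (\<chi> j. ?I j)) \<le> (\<Sum>j\<in>UNIV. ennreal (norm (?I j)))"
    using ennreal_norm_vec_le[of "\<chi> j. ?I j"] by simp
  also have "\<dots> \<le> (\<Sum>j\<in>(UNIV::3 set). ennreal (qconst a) * ?D)"
  proof (intro sum_mono norm_duhamel_integral_le AE_I2 impI)
    fix j s show "ennreal (norm (Q_hat a (U s) (U s) \<xi> $ j)) \<le> ennreal (qconst a * norm \<xi>) * conv (vabs (U s)) (vabs (U s)) \<xi>"
      by (rule norm_Q_hat_nth_le)
  qed (use qconst_pos[of a] in auto)
  also have "\<dots> = ennreal (qbound a) * ?D"
    by (rule sum_UNIV_3_const)
  finally show ?thesis by (simp add: add_left_mono)
qed

lemma picard_integrable:
  assumes [measurable]: "case_prod U \<in> borel_measurable (borel \<Otimes>\<^sub>M borel)"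
    and "duhamel \<nu> (\<lambda>s. conv (vabs (U s)) (vabs (U s))) t \<xi> < \<infinity>"
  shows "set_integrable lborel {0..t} (\<lambda>s. complex_of_real (exp (- \<nu> * (t - s) * (norm \<xi>)\<^sup>2)) * Q_hat a (U s) (U s) \<xi> $ j)"
  by (rule duhamel_set_integrable[OF norm_Q_hat_nth_le _ _ _ assms(2)]) (use qconst_pos[of a] in auto)

text \<open>The finite Duhamel integrals serve twice: they let the two time integrals be subtracted
  under one integral sign, and they make the convolutions finite for almost every s, as the
  difference estimate for Q requires.\<close>

lemma norm_picard_diff_le:
  assumes [measurable]: "case_prod U \<in> borel_measurable (borel \<Otimes>\<^sub>M borel)"
      "case_prod V \<in> borel_measurable (borel \<Otimes>\<^sub>M borel)"
    and fin: "duhamel \<nu> (\<lambda>s. conv (vabs (U s)) (vabs (U s))) t \<xi> < \<infinity>"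
      "duhamel \<nu> (\<lambda>s. conv (vabs (V s)) (vabs (V s))) t \<xi> < \<infinity>"
  shows "ennreal (norm (picard a \<nu> U0 U t \<xi> - picard a \<nu> U0 V t \<xi>))
    \<le> ennreal (qbound a) * duhamel \<nu> (\<lambda>s \<xi>. conv (vabs (\<lambda>\<xi>. U s \<xi> - V s \<xi>)) (vabs (U s)) \<xi>
        + conv (vabs (V s)) (vabs (\<lambda>\<xi>. U s \<xi> - V s \<xi>)) \<xi>) t \<xi>"
proof -
  let ?e = "\<lambda>s. complex_of_real (exp (- \<nu> * (t - s) * (norm \<xi>)\<^sup>2))"
  let ?I = "\<lambda>j. LINT s:{0..t}|lborel. ?e s * (Q_hat a (U s) (U s) \<xi> $ j - Q_hat a (V s) (V s) \<xi> $ j)"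
  let ?m = "\<lambda>s \<xi>. conv (vabs (\<lambda>\<xi>. U s \<xi> - V s \<xi>)) (vabs (U s)) \<xi>
        + conv (vabs (V s)) (vabs (\<lambda>\<xi>. U s \<xi> - V s \<xi>)) \<xi>"
  have eq: "picard a \<nu> U0 U t \<xi> - picard a \<nu> U0 V t \<xi> = (\<chi> j. ?I j)"
  proof -
    have "?I j = (LINT s:{0..t}|lborel. ?e s * Q_hat a (U s) (U s) \<xi> $ j)
        - (LINT s:{0..t}|lborel. ?e s * Q_hat a (V s) (V s) \<xi> $ j)" for j
      unfolding right_diff_distrib[of "complex_of_real _"]
      by (rule set_integral_diff(2)[OF picard_integrable[OF assms(1,3)] picard_integrable[OF assms(2,4)]])
    then show ?thesis
      unfolding vec_eq_iff picard_def vector_minus_component vec_lambda_beta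
      by (simp only: add_diff_cancel_left simp_thms)
  qed
  have "ennreal (norm (\<chi> j. ?I j)) \<le> (\<Sum>j\<in>UNIV. ennreal (norm (?I j)))"
    using ennreal_norm_vec_le[of "\<chi> j. ?I j"] by simp
  also have "\<dots> \<le> (\<Sum>j\<in>(UNIV::3 set). ennreal (qconst a) * duhamel \<nu> ?m t \<xi>)"
  proof (intro sum_mono norm_duhamel_integral_le)
    have 1: "AE s in lborel. s \<in> {0..t} \<longrightarrow> \<xi> = 0 \<or> conv (vabs (U s)) (vabs (U s)) \<xi> < \<infinity>"
      by (rule AE_finite_of_duhamel[OF _ fin(1)]) measurable
    have 2: "AE s in lborel. s \<in> {0..t} \<longrightarrow> \<xi> = 0 \<or> conv (vabs (V s)) (vabs (V s)) \<xi> < \<infinity>"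
      by (rule AE_finite_of_duhamel[OF _ fin(2)]) measurable
    fix j
    from 1 2 show "AE s in lborel. s \<in> {0..t} \<longrightarrow>
      ennreal (norm (Q_hat a (U s) (U s) \<xi> $ j - Q_hat a (V s) (V s) \<xi> $ j)) \<le> ennreal (qconst a * norm \<xi>) * ?m s \<xi>"
    proof eventually_elim
      case (elim s)
      then show ?case
        by (intro impI norm_Q_hat_nth_diff_le) auto
    qed
  qed (use qconst_pos[of a] in auto)
  also have "\<dots> = ennreal (qbound a) * duhamel \<nu> ?m t \<xi>"
    by (rule sum_UNIV_3_const)
  finally show ?thesis unfolding eq .
qed

section \<open>Membership in L^2 chi^0 for jointly measurable fields\<close>

lemma AE_restrict_lborel_iff:
  "(AE t in restrict_space lborel {0..T::real}. P t) \<longleftrightarrow> (AE t in lborel. t \<in> {0..T} \<longrightarrow> P t)"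
  by (rule AE_restrict_space_iff) simp

lemma tmeas_of_measurable:
  assumes "case_prod U \<in> borel_measurable (borel \<Otimes>\<^sub>M borel)"
  shows "tmeas T U"
proof -
  have "(\<lambda>t::real. t) \<in> restrict_space lborel {0..T} \<rightarrow>\<^sub>M borel"
    by (intro measurable_restrict_space1) simp
  from measurable_compose[OF measurable_fst this]
  have "(\<lambda>z. U (fst z) (snd z)) \<in> borel_measurable (restrict_space lborel {0..T} \<Otimes>\<^sub>M lborel)"
    by (rule measurable_Pair_compose_split[OF assms]) simp
  then show ?thesis
    by (simp add: tmeas_def split_beta')
qed

text \<open>Finite energy already forces a finite chi^0 norm at almost every time, so only reality
  and the energy remain to be checked.\<close>

lemma L2_chi0_iff:
  assumes [measurable]: "case_prod U \<in> borel_measurable (borel \<Otimes>\<^sub>M borel)"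
  shows "L2_chi0 T U \<longleftrightarrow> (AE t in lborel. t \<in> {0..T} \<longrightarrow> real_field (U t)) \<and> energy T (\<lambda>t. vabs (U t)) < \<infinity>"
proof -
  have "AE t in lborel. t \<in> {0..T} \<longrightarrow> wint 0 (vabs (U t)) < \<infinity>" if "energy T (\<lambda>t. vabs (U t)) < \<infinity>"
  proof -
    have "AE t in lborel. (wint 0 (vabs (U t)))\<^sup>2 * indicator {0..T} t \<noteq> \<infinity>"
      by (rule nn_integral_PInf_AE) (use that in \<open>auto simp: energy_def\<close>)
    then show ?thesis
      by eventually_elim (auto simp: less_top power2_eq_square ennreal_mult_less_top)
  qed
  then have "energy T (\<lambda>t. vabs (U t)) < \<infinity> \<Longrightarrow> (AE t in lborel. t \<in> {0..T} \<longrightarrow> real_field (U t)) \<longleftrightarrow>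
      (AE t in lborel. t \<in> {0..T} \<longrightarrow> real_field (U t) \<and> wint 0 (vabs (U t)) < \<infinity>)"
    unfolding imp_conjR AE_conj_iff by blast
  moreover have "L2_chi0 T U \<longleftrightarrow> (AE t in lborel. t \<in> {0..T} \<longrightarrow> real_field (U t) \<and> wint 0 (vabs (U t)) < \<infinity>)
      \<and> energy T (\<lambda>t. vabs (U t)) < \<infinity>"
    unfolding L2_chi0_def AE_restrict_lborel_iff in_chi_def chi_norm_eq_wint energy_def
    by (simp add: tmeas_of_measurable[OF assms])
  ultimately show ?thesis by blast
qed

section \<open>Picard iterates, their convergence and the equation for the limit\<close>

primrec picard_seq :: "qcoeff \<Rightarrow> real \<Rightarrow> fvec \<Rightarrow> nat \<Rightarrow> real \<Rightarrow> fvec" where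
  "picard_seq a \<nu> U0 0 = (\<lambda>t \<xi>. 0)"
| "picard_seq a \<nu> U0 (Suc n) = picard a \<nu> U0 (picard_seq a \<nu> U0 n)"

text \<open>\<open>lim\<close> is total: where the iterates diverge the value is unspecified, but
  the function stays jointly measurable.\<close>

definition picard_lim :: "qcoeff \<Rightarrow> real \<Rightarrow> fvec \<Rightarrow> real \<Rightarrow> fvec" where
  "picard_lim a \<nu> U0 t \<xi> = lim (\<lambda>n. picard_seq a \<nu> U0 n t \<xi>)"

lemma measurable_picard_seq:
  assumes "U0 \<in> borel_measurable borel"
  shows "case_prod (picard_seq a \<nu> U0 n) \<in> borel_measurable (borel \<Otimes>\<^sub>M borel)"
  by (induction n) (simp_all add: measurable_picard[OF assms])

lemma measurable_picard_lim:
  assumes "U0 \<in> borel_measurable borel"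
  shows "case_prod (picard_lim a \<nu> U0) \<in> borel_measurable (borel \<Otimes>\<^sub>M borel)"
proof -
  note [measurable] = measurable_picard_seq[OF assms]
  show ?thesis unfolding picard_lim_def by measurable
qed

lemma picard_seq_le_maj:
  assumes "U0 \<in> borel_measurable borel"
  shows "ennreal (norm (picard_seq a \<nu> U0 n t \<xi>)) \<le> maj (qbound a) \<nu> (vabs U0) n t \<xi>"
proof (induction n arbitrary: t \<xi>)
  case (Suc n)
  have "ennreal (norm (picard_seq a \<nu> U0 (Suc n) t \<xi>)) \<le> heat \<nu> (vabs U0) t \<xi>
     + ennreal (qbound a) * duhamel \<nu> (\<lambda>s. conv (vabs (picard_seq a \<nu> U0 n s)) (vabs (picard_seq a \<nu> U0 n s))) t \<xi>"
    unfolding picard_seq.simps by (rule norm_picard_le[OF measurable_picard_seq[OF assms]])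
  also have "\<dots> \<le> maj (qbound a) \<nu> (vabs U0) (Suc n) t \<xi>"
    unfolding maj.simps by (intro add_left_mono mult_left_mono duhamel_mono conv_mono Suc) simp
  finally show ?case .
qed simp

text \<open>The discrete product rule u u - v v = (u - v) u + v (u - v), in a form that survives infinite values.\<close>

lemma conv_increment_le:
  fixes u v d p m :: "'a::euclidean_space \<Rightarrow> ennreal"
  assumes [measurable]: "u \<in> borel_measurable borel" "v \<in> borel_measurable borel" "d \<in> borel_measurable borel"
      "p \<in> borel_measurable borel"
    and u: "\<And>x. u x \<le> m x" and v: "\<And>x. v x \<le> p x" and d: "\<And>x. d x + p x \<le> m x"
  shows "(conv d u x + conv v d x) + conv p p x \<le> conv m m x"
proof -
  have "(conv d u x + conv v d x) + conv p p x
    = (\<integral>\<^sup>+y. (d (x - y) * u y + v (x - y) * d y) + p (x - y) * p y \<partial>lborel)"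
    unfolding conv_def by (simp add: nn_integral_add)
  also have "\<dots> \<le> conv m m x"
    unfolding conv_def
  proof (rule nn_integral_mono)
    fix y
    have "(d (x - y) * u y + v (x - y) * d y) + p (x - y) * p y
      \<le> (d (x - y) * m y + p (x - y) * d y) + p (x - y) * p y"
      by (intro add_mono mult_mono u v order.refl) auto
    also have "\<dots> = d (x - y) * m y + p (x - y) * (d y + p y)"
      by (simp add: distrib_left add.assoc)
    also have "\<dots> \<le> d (x - y) * m y + p (x - y) * m y"
      by (intro add_left_mono mult_left_mono d) auto
    also have "\<dots> = (d (x - y) + p (x - y)) * m y"
      by (simp add: distrib_right)
    also have "\<dots> \<le> m (x - y) * m y"
      by (intro mult_right_mono d) auto
    finally show "(d (x - y) * u y + v (x - y) * d y) + p (x - y) * p y \<le> m (x - y) * m y" .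
  qed
  finally show ?thesis .
qed

text \<open>Stated with a sum because the difference of consecutive majorants is meaningless where
  both are infinite. In the induction step \<open>duhamel_add\<close> merges the two Duhamel terms
  and \<open>conv_increment_le\<close> compares the integrands.\<close>

lemma picard_seq_increment_le:
  assumes [measurable]: "U0 \<in> borel_measurable borel"
  shows "ennreal (norm (picard_seq a \<nu> U0 (Suc n) t \<xi> - picard_seq a \<nu> U0 n t \<xi>)) + maj (qbound a) \<nu> (vabs U0) n t \<xi>
    \<le> maj (qbound a) \<nu> (vabs U0) (Suc n) t \<xi>"
proof (induction n arbitrary: t \<xi>)
  case 0
  show ?case
    using picard_seq_le_maj[OF assms, of a \<nu> "Suc 0" t \<xi>] by simp
next
  case (Suc n)
  let ?c = "ennreal (qbound a)"
  define U where "U = picard_seq a \<nu> U0 (Suc n)"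
  define V where "V = picard_seq a \<nu> U0 n"
  define M where "M = maj (qbound a) \<nu> (vabs U0) (Suc n)"
  define P where "P = maj (qbound a) \<nu> (vabs U0) n"
  have [measurable]: "case_prod U \<in> borel_measurable (borel \<Otimes>\<^sub>M borel)"
    "case_prod V \<in> borel_measurable (borel \<Otimes>\<^sub>M borel)"
    unfolding U_def V_def by (rule measurable_picard_seq[OF assms])+
  have [measurable]: "case_prod M \<in> borel_measurable (borel \<Otimes>\<^sub>M borel)"
    "case_prod P \<in> borel_measurable (borel \<Otimes>\<^sub>M borel)"
    unfolding M_def P_def by (rule measurable_maj; measurable)+
  have U: "vabs (U s) x \<le> M s x" and V: "vabs (V s) x \<le> P s x" for s x
    unfolding U_def V_def M_def P_def by (rule picard_seq_le_maj[OF assms])+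
  have PM: "P s x \<le> M s x" for s x
    unfolding M_def P_def by (rule incseqD[OF incseq_maj]) simp
  let ?X = "\<lambda>s x. conv (vabs (\<lambda>\<xi>. U s \<xi> - V s \<xi>)) (vabs (U s)) x + conv (vabs (V s)) (vabs (\<lambda>\<xi>. U s \<xi> - V s \<xi>)) x"
  have maj: "maj (qbound a) \<nu> (vabs U0) (Suc (Suc n)) t \<xi> = heat \<nu> (vabs U0) t \<xi> + ?c * duhamel \<nu> (\<lambda>s. conv (M s) (M s)) t \<xi>"
    "maj (qbound a) \<nu> (vabs U0) (Suc n) t \<xi> = heat \<nu> (vabs U0) t \<xi> + ?c * duhamel \<nu> (\<lambda>s. conv (P s) (P s)) t \<xi>"
    by (simp_all add: M_def P_def)
  have "ennreal (norm (picard a \<nu> U0 U t \<xi> - picard a \<nu> U0 V t \<xi>)) + maj (qbound a) \<nu> (vabs U0) (Suc n) t \<xi>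
    \<le> maj (qbound a) \<nu> (vabs U0) (Suc (Suc n)) t \<xi>"
  \<comment> \<open>If this integral is infinite, so is the next majorant, as
    \<open>qbound a\<close> is positive. Otherwise it dominates both integrals needed to subtract
    the two Picard images.\<close>
  proof (cases "duhamel \<nu> (\<lambda>s. conv (M s) (M s)) t \<xi> < \<infinity>")
    case False
    then show ?thesis
      unfolding maj using qbound_pos[of a] by (simp add: less_top[symmetric] ennreal_mult_top)
  next
    case True
    have "ennreal (norm (picard a \<nu> U0 U t \<xi> - picard a \<nu> U0 V t \<xi>)) \<le> ?c * duhamel \<nu> ?X t \<xi>"
    proof (rule norm_picard_diff_le)
      show "duhamel \<nu> (\<lambda>s. conv (vabs (U s)) (vabs (U s))) t \<xi> < \<infinity>"
        using True by (rule le_less_trans[rotated]) (intro duhamel_mono conv_mono U)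
      show "duhamel \<nu> (\<lambda>s. conv (vabs (V s)) (vabs (V s))) t \<xi> < \<infinity>"
        using True by (rule le_less_trans[rotated]) (intro duhamel_mono conv_mono order.trans[OF V PM])
    qed measurable
    then have "ennreal (norm (picard a \<nu> U0 U t \<xi> - picard a \<nu> U0 V t \<xi>)) + maj (qbound a) \<nu> (vabs U0) (Suc n) t \<xi>
      \<le> ?c * duhamel \<nu> ?X t \<xi> + (heat \<nu> (vabs U0) t \<xi> + ?c * duhamel \<nu> (\<lambda>s. conv (P s) (P s)) t \<xi>)"
      unfolding maj by (rule add_right_mono)
    also have "\<dots> = heat \<nu> (vabs U0) t \<xi> + ?c * duhamel \<nu> (\<lambda>s x. ?X s x + conv (P s) (P s) x) t \<xi>"
    proof -
      have "duhamel \<nu> (\<lambda>s x. ?X s x + conv (P s) (P s) x) t \<xi> = duhamel \<nu> ?X t \<xi> + duhamel \<nu> (\<lambda>s. conv (P s) (P s)) t \<xi>"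
        by (rule duhamel_add) measurable
      then show ?thesis
        by (simp only: distrib_left add.left_commute)
    qed
    also have "\<dots> \<le> heat \<nu> (vabs U0) t \<xi> + ?c * duhamel \<nu> (\<lambda>s. conv (M s) (M s)) t \<xi>"
    proof (intro add_left_mono mult_left_mono duhamel_mono conv_increment_le U V)
      show "ennreal (norm (U s x - V s x)) + P s x \<le> M s x" for s x
        unfolding U_def V_def M_def P_def by (rule Suc)
    qed simp_all
    finally show ?thesis unfolding maj .
  qed
  then show ?case
    by (simp only: U_def V_def picard_seq.simps)
qed

text \<open>Adding up the increment bounds telescopes: the norms of the first n increments sum to at
  most the n-th majorant, so the series of increments converges absolutely wherever the limit
  majorant is finite.\<close>

lemma picard_seq_tendsto:
  assumes [measurable]: "U0 \<in> borel_measurable borel"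
    and fin: "majlim (qbound a) \<nu> (vabs U0) t \<xi> < \<infinity>"
  shows "(\<lambda>n. picard_seq a \<nu> U0 n t \<xi>) \<longlonglongrightarrow> picard_lim a \<nu> U0 t \<xi>"
proof -
  let ?u = "\<lambda>n. picard_seq a \<nu> U0 n t \<xi>" and ?M = "majlim (qbound a) \<nu> (vabs U0) t \<xi>"
  have le: "(\<Sum>i<n. ennreal (norm (?u (Suc i) - ?u i))) \<le> maj (qbound a) \<nu> (vabs U0) n t \<xi>" for n
  proof (induction n)
    case (Suc n)
    show ?case
      using order.trans[OF add_left_mono[OF Suc] picard_seq_increment_le[OF assms(1)]]
      by (simp only: sum.lessThan_Suc add.commute)
  qed simp
  have "summable (\<lambda>i. norm (?u (Suc i) - ?u i))"
  proof (rule bounded_imp_summable)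
    fix n
    have "ennreal (\<Sum>i\<le>n. norm (?u (Suc i) - ?u i)) = (\<Sum>i<Suc n. ennreal (norm (?u (Suc i) - ?u i)))"
      by (simp add: lessThan_Suc_atMost)
    also have "\<dots> \<le> ?M"
      by (rule order.trans[OF le maj_le_majlim])
    also have "?M = ennreal (enn2real ?M)"
      using fin by simp
    finally show "(\<Sum>i\<le>n. norm (?u (Suc i) - ?u i)) \<le> enn2real ?M"
      by (simp add: ennreal_le_iff)
  qed simp
  then have "summable (\<lambda>i. ?u (Suc i) - ?u i)"
    by (rule summable_norm_cancel)
  then have "convergent (\<lambda>n. \<Sum>i<n. ?u (Suc i) - ?u i)"
    by (simp add: summable_iff_convergent)
  moreover have "(\<Sum>i<n. ?u (Suc i) - ?u i) = ?u n" for n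
    by (subst sum_lessThan_telescope) simp
  ultimately have "convergent ?u"
    by (simp only:)
  then show ?thesis
    unfolding picard_lim_def by (simp add: convergent_LIMSEQ_iff)
qed

lemma picard_lim_le_majlim:
  assumes [measurable]: "U0 \<in> borel_measurable borel"
  shows "ennreal (norm (picard_lim a \<nu> U0 t \<xi>)) \<le> majlim (qbound a) \<nu> (vabs U0) t \<xi>"
proof (cases "majlim (qbound a) \<nu> (vabs U0) t \<xi> < \<infinity>")
  case True
  have "(\<lambda>n. ennreal (norm (picard_seq a \<nu> U0 n t \<xi>))) \<longlonglongrightarrow> ennreal (norm (picard_lim a \<nu> U0 t \<xi>))"
    by (intro tendsto_ennrealI tendsto_norm picard_seq_tendsto assms True)
  then show ?thesis
    by (rule LIMSEQ_le_const2) (intro exI allI impI order.trans[OF picard_seq_le_maj[OF assms] maj_le_majlim])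
qed (simp add: less_top[symmetric])

text \<open>Both sides of the recursion are passed to the limit at a fixed \<xi> by two nested
  dominated convergences: over \<eta> in the product with majorant M(\<xi> - \<eta>) M(\<eta>), and
  over s in the Duhamel integral with the kernel times M * M.\<close>

lemma picard_lim_mild_sol:
  assumes [measurable]: "U0 \<in> borel_measurable borel" and "\<nu> > 0"
    and fin: "energy T (majlim (qbound a) \<nu> (vabs U0)) < \<infinity>"
  shows "mild_sol a \<nu> U0 T (picard_lim a \<nu> U0)"
  unfolding mild_sol_iff
proof
  let ?M = "majlim (qbound a) \<nu> (vabs U0)" and ?U = "picard_lim a \<nu> U0" and ?S = "picard_seq a \<nu> U0"
  have [measurable]: "case_prod ?M \<in> borel_measurable (borel \<Otimes>\<^sub>M borel)"
    by (rule measurable_majlim) measurable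
  note [measurable] = measurable_picard_seq[OF assms(1)] measurable_picard_lim[OF assms(1)]
  fix t assume t: "t \<in> {0..T}"
  have good: "AE x in lborel. (\<integral>\<^sup>+s\<in>{0..T}. conv (?M s) (?M s) x \<partial>lborel) < \<infinity>"
    by (rule AE_finite_conv_time_integral) (use fin in auto)
  have finM: "?M s \<eta> < \<infinity>" if "s \<in> {0..T}" "(\<integral>\<^sup>+s\<in>{0..T}. conv (?M s) (?M s) \<eta> \<partial>lborel) < \<infinity>" for s \<eta>
    by (rule majlim_less_top[OF _ \<open>\<nu> > 0\<close>, where T=T]) (use that in auto)
  show "AE \<xi> in lborel. ?U t \<xi> = picard a \<nu> U0 ?U t \<xi>"
    using good
  proof eventually_elim
    fix \<xi> assume \<xi>: "(\<integral>\<^sup>+s\<in>{0..T}. conv (?M s) (?M s) \<xi> \<partial>lborel) < \<infinity>"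
    have duh: "duhamel \<nu> (\<lambda>s. conv (?M s) (?M s)) t \<xi> < \<infinity>"
    proof -
      have "duhamel \<nu> (\<lambda>s. conv (?M s) (?M s)) t \<xi> \<le> ennreal (norm \<xi>) * (\<integral>\<^sup>+s\<in>{0..T}. conv (?M s) (?M s) \<xi> \<partial>lborel)"
        by (rule duhamel_le[OF \<open>\<nu> > 0\<close>]) (use t in auto)
      also have "\<dots> < \<infinity>"
        using \<xi> by (simp add: ennreal_mult_less_top)
      finally show ?thesis .
    qed
    have ae: "AE s in lborel. s \<in> {0..T} \<longrightarrow> conv (?M s) (?M s) \<xi> < \<infinity>"
    proof -
      have "AE s in lborel. conv (?M s) (?M s) \<xi> * indicator {0..T} s \<noteq> \<infinity>"
        by (rule nn_integral_PInf_AE) (use \<xi> in auto)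
      then show ?thesis
        by eventually_elim (auto simp: less_top)
    qed
    have "(\<lambda>n. picard a \<nu> U0 (?S n) t \<xi>) \<longlonglongrightarrow> picard a \<nu> U0 ?U t \<xi>"
      unfolding picard_def set_lebesgue_integral_def
    proof (intro vec_tendstoI, unfold vec_lambda_beta, intro tendsto_add tendsto_const)
      fix j
      let ?e = "\<lambda>s. exp (- \<nu> * (t - s) * (norm \<xi>)\<^sup>2)"
      let ?w = "\<lambda>s. ennreal (qconst a) * (ennreal (?e s * norm \<xi>) * conv (?M s) (?M s) \<xi> * indicator {0..t} s)"
      show "(\<lambda>n. LINT s|lborel. indicator {0..t} s *\<^sub>R (complex_of_real (?e s) * Q_hat a (?S n s) (?S n s) \<xi> $ j))
        \<longlonglongrightarrow> (LINT s|lborel. indicator {0..t} s *\<^sub>R (complex_of_real (?e s) * Q_hat a (?U s) (?U s) \<xi> $ j))"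
      proof (rule integral_ennreal_dominated_convergence[where w="?w"])
        have "(\<integral>\<^sup>+s. ?w s \<partial>lborel) = ennreal (qconst a) * duhamel \<nu> (\<lambda>s. conv (?M s) (?M s)) t \<xi>"
          unfolding duhamel_def by (rule nn_integral_cmult) measurable
        then show "(\<integral>\<^sup>+s. ?w s \<partial>lborel) < \<infinity>"
          using duh by (simp add: ennreal_mult_less_top)
        show "AE s in lborel. ennreal (norm (indicator {0..t} s *\<^sub>R (complex_of_real (?e s) * Q_hat a (?S n s) (?S n s) \<xi> $ j))) \<le> ?w s" for n
        proof (intro AE_I2 norm_duhamel_integrand_le norm_ge_zero)
          fix s
          have "ennreal (norm (Q_hat a (?S n s) (?S n s) \<xi> $ j)) \<le> ennreal (qconst a * norm \<xi>) * conv (vabs (?S n s)) (vabs (?S n s)) \<xi>"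
            by (rule norm_Q_hat_nth_le)
          also have "\<dots> \<le> ennreal (qconst a * norm \<xi>) * conv (?M s) (?M s) \<xi>"
            by (intro mult_left_mono conv_mono order.trans[OF picard_seq_le_maj[OF assms(1)] maj_le_majlim]) simp
          finally show "ennreal (norm (Q_hat a (?S n s) (?S n s) \<xi> $ j)) \<le> ennreal (qconst a * norm \<xi>) * conv (?M s) (?M s) \<xi>" .
        qed (use qconst_pos[of a] in simp)
        show "AE s in lborel. (\<lambda>n. indicator {0..t} s *\<^sub>R (complex_of_real (?e s) * Q_hat a (?S n s) (?S n s) \<xi> $ j))
          \<longlonglongrightarrow> indicator {0..t} s *\<^sub>R (complex_of_real (?e s) * Q_hat a (?U s) (?U s) \<xi> $ j)"
          using ae
        proof eventually_elim
          fix s assume s: "s \<in> {0..T} \<longrightarrow> conv (?M s) (?M s) \<xi> < \<infinity>"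
          show "(\<lambda>n. indicator {0..t} s *\<^sub>R (complex_of_real (?e s) * Q_hat a (?S n s) (?S n s) \<xi> $ j))
            \<longlonglongrightarrow> indicator {0..t} s *\<^sub>R (complex_of_real (?e s) * Q_hat a (?U s) (?U s) \<xi> $ j)"
          proof (cases "s \<in> {0..t}")
            case True
            with t have sT: "s \<in> {0..T}" by auto
            \<comment> \<open>The exceptional set of \<open>good\<close> is independent of s, so it
              serves the convolution variable \<eta> at each time s.\<close>
            have "AE \<eta> in lborel. (\<lambda>n. ?S n s \<eta>) \<longlonglongrightarrow> ?U s \<eta>"
              using good by eventually_elim (intro picard_seq_tendsto assms finM sT)
            then show ?thesis
              by (intro tendsto_intros Q_hat_nth_tendsto[where m="?M s"]
                  order.trans[OF picard_seq_le_maj[OF assms(1)] maj_le_majlim])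
                (use s sT in auto)
          qed simp
        qed
      qed measurable
    qed
    moreover have "(\<lambda>n. picard a \<nu> U0 (?S n) t \<xi>) \<longlonglongrightarrow> ?U t \<xi>"
      using LIMSEQ_Suc[OF picard_seq_tendsto[OF assms(1) finM[OF t \<xi>]]] by simp
    ultimately show "?U t \<xi> = picard a \<nu> U0 ?U t \<xi>"
      using LIMSEQ_unique by blast
  qed
qed

text \<open>The heat factor is even in \<xi>, and Q of a real field is Hermitian at every \<xi>;
  only the symmetry of \<open>U0\<close> excludes a null set of frequencies.\<close>

lemma real_field_picard:
  assumes [measurable]: "case_prod U \<in> borel_measurable (borel \<Otimes>\<^sub>M borel)"
    and U: "AE s in lborel. s \<in> {0..t} \<longrightarrow> real_field (U s)" and U0: "real_field U0"
  shows "real_field (picard a \<nu> U0 U t)"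
proof -
  from U0 have "AE \<xi> in lborel. U0 (- \<xi>) = (\<chi> j. cnj (U0 \<xi> $ j))"
    by (simp add: real_field_def)
  then show ?thesis
    unfolding real_field_def
  proof eventually_elim
    fix \<xi> assume \<xi>: "U0 (- \<xi>) = (\<chi> j. cnj (U0 \<xi> $ j))"
    let ?e = "\<lambda>s. complex_of_real (exp (- \<nu> * (t - s) * (norm \<xi>)\<^sup>2))"
    have "(LINT s|lborel. indicator {0..t} s *\<^sub>R (?e s * Q_hat a (U s) (U s) (- \<xi>) $ j))
      = (LINT s|lborel. cnj (indicator {0..t} s *\<^sub>R (?e s * Q_hat a (U s) (U s) \<xi> $ j)))" for j
    proof (rule integral_cong_AE)
      show "AE s in lborel. indicator {0..t} s *\<^sub>R (?e s * Q_hat a (U s) (U s) (- \<xi>) $ j)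
        = cnj (indicator {0..t} s *\<^sub>R (?e s * Q_hat a (U s) (U s) \<xi> $ j))"
        using U
      proof eventually_elim
        case (elim s)
        show ?case
        proof (cases "s \<in> {0..t}")
          case True
          with elim have "Q_hat a (U s) (U s) (- \<xi>) $ j = cnj (Q_hat a (U s) (U s) \<xi> $ j)"
            by (intro Q_hat_nth_uminus) auto
          with True show ?thesis by simp
        qed simp
      qed
    qed measurable
    then show "picard a \<nu> U0 U t (- \<xi>) = (\<chi> j. cnj (picard a \<nu> U0 U t \<xi> $ j))"
      unfolding picard_def set_lebesgue_integral_def Bochner_Integration.integral_cnj
      by (simp add: \<xi>)
  qed
qed

lemma real_field_picard_seq:
  assumes "U0 \<in> borel_measurable borel" "real_field U0"
  shows "real_field (picard_seq a \<nu> U0 n t)"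
proof (induction n arbitrary: t)
  case 0
  show ?case by (simp add: real_field_def vec_eq_iff)
next
  case (Suc n)
  then show ?case
    by (simp add: real_field_picard measurable_picard_seq assms)
qed

lemma real_field_picard_lim:
  assumes [measurable]: "U0 \<in> borel_measurable borel" and "real_field U0"
    and fin: "AE \<xi> in lborel. majlim (qbound a) \<nu> (vabs U0) t \<xi> < \<infinity>"
  shows "real_field (picard_lim a \<nu> U0 t)"
proof -
  have "AE \<xi> in lborel. \<forall>n. picard_seq a \<nu> U0 n t (- \<xi>) = (\<chi> j. cnj (picard_seq a \<nu> U0 n t \<xi> $ j))"
    unfolding AE_all_countable using real_field_picard_seq[OF assms(1,2)] by (simp add: real_field_def)
  with fin show ?thesis
    unfolding real_field_def
  proof eventually_elim
    case (elim \<xi>)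
    have "(\<lambda>n. \<chi> j. cnj (picard_seq a \<nu> U0 n t \<xi> $ j)) \<longlonglongrightarrow> (\<chi> j. cnj (picard_lim a \<nu> U0 t \<xi> $ j))"
      by (intro tendsto_intros picard_seq_tendsto assms elim(1))
    then show ?case
      unfolding picard_lim_def[of a \<nu> U0 t "- \<xi>"] elim(2)[rule_format] by (rule limI)
  qed
qed

lemma picard_lim_solution:
  assumes "\<nu> > 0" and U0: "in_chi (-1) U0"
    and small: "ennreal (16 * (qbound a)\<^sup>2 / \<nu>) * energy T (heat \<nu> (vabs U0)) \<le> 1"
  shows "mild_sol a \<nu> U0 T (picard_lim a \<nu> U0)" "L2_chi0 T (picard_lim a \<nu> U0)"
proof -
  let ?M = "majlim (qbound a) \<nu> (vabs U0)"
  have m[measurable]: "U0 \<in> borel_measurable borel" and re: "real_field U0"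
    and chi: "wint (-1) (vabs U0) < \<infinity>"
    using U0 by (auto simp: in_chi_def chi_norm_eq_wint)
  have [measurable]: "case_prod ?M \<in> borel_measurable (borel \<Otimes>\<^sub>M borel)"
    by (rule measurable_majlim) measurable
  have "energy T ?M \<le> 4 * energy T (heat \<nu> (vabs U0))"
    by (rule energy_majlim_le) (use assms qbound_pos[of a] in \<open>auto intro: less_imp_le\<close>)
  also have "\<dots> \<le> 4 * (ennreal (1 / \<nu>) * (wint (-1) (vabs U0))\<^sup>2)"
    by (intro mult_left_mono energy_heat_le \<open>\<nu> > 0\<close>) auto
  also have "\<dots> < \<infinity>"
    using chi by (simp add: ennreal_mult_less_top power2_eq_square)
  finally have fin: "energy T ?M < \<infinity>" .
  then show "mild_sol a \<nu> U0 T (picard_lim a \<nu> U0)"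
    by (intro picard_lim_mild_sol m \<open>\<nu> > 0\<close>)
  have "AE x in lborel. (\<integral>\<^sup>+s\<in>{0..T}. conv (?M s) (?M s) x \<partial>lborel) < \<infinity>"
    by (rule AE_finite_conv_time_integral) (use fin in auto)
  then have "AE x in lborel. ?M t x < \<infinity>" if "t \<in> {0..T}" for t
    by eventually_elim (rule majlim_less_top[OF _ \<open>\<nu> > 0\<close>, where T=T], use that in auto)
  then have "t \<in> {0..T} \<Longrightarrow> real_field (picard_lim a \<nu> U0 t)" for t
    by (intro real_field_picard_lim m re)
  moreover have "energy T (\<lambda>t. vabs (picard_lim a \<nu> U0 t)) \<le> energy T ?M"
    by (intro energy_mono AE_I2 picard_lim_le_majlim m)
  ultimately show "L2_chi0 T (picard_lim a \<nu> U0)"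
    unfolding L2_chi0_iff[OF measurable_picard_lim[OF m]] using fin by (auto intro: le_less_trans)
qed

section \<open>Regularity\<close>

lemma real_field_cong_AE:
  assumes ae: "AE \<xi> in lborel. U \<xi> = V \<xi>" and "real_field V"
  shows "real_field U"
  using assms(2) unfolding real_field_def
  by (elim AE_mp, use ae AE_lborel_reflect[OF ae, of 0] in eventually_elim) simp

text \<open>Where this is finite, the Duhamel integrals of the solution are finite and uniformly
  dominated for all times in [0,T].\<close>

definition time_conv :: "real \<Rightarrow> (real \<Rightarrow> fvec) \<Rightarrow> real^3 \<Rightarrow> ennreal" where
  "time_conv T U \<xi> = (\<integral>\<^sup>+s\<in>{0..T}. conv (vabs (U s)) (vabs (U s)) \<xi> \<partial>lborel)"

lemma measurable_time_conv:
  assumes [measurable]: "case_prod U \<in> borel_measurable (borel \<Otimes>\<^sub>M borel)"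
  shows "time_conv T U \<in> borel_measurable borel"
  unfolding time_conv_def by measurable

lemma AE_time_conv_finite:
  assumes [measurable]: "case_prod U \<in> borel_measurable (borel \<Otimes>\<^sub>M borel)"
    and "energy T (\<lambda>t. vabs (U t)) < \<infinity>"
  shows "AE \<xi> in lborel. time_conv T U \<xi> < \<infinity>"
  unfolding time_conv_def by (rule AE_finite_conv_time_integral) (use assms in auto)

lemma wint_0_time_conv:
  assumes [measurable]: "case_prod U \<in> borel_measurable (borel \<Otimes>\<^sub>M borel)"
  shows "wint 0 (time_conv T U) = energy T (\<lambda>t. vabs (U t))"
  unfolding wint_0 time_conv_def by (subst flux_swap[symmetric]) (simp_all add: flux_conv_self)

lemma duhamel_le_time_conv:
  assumes [measurable]: "case_prod U \<in> borel_measurable (borel \<Otimes>\<^sub>M borel)" and "\<nu> > 0" "t \<le> T"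
  shows "duhamel \<nu> (\<lambda>s. conv (vabs (U s)) (vabs (U s))) t \<xi> \<le> ennreal (norm \<xi>) * time_conv T U \<xi>"
  unfolding time_conv_def by (rule duhamel_le) (use assms in auto)

lemma duhamel_finite:
  assumes "case_prod U \<in> borel_measurable (borel \<Otimes>\<^sub>M borel)" "\<nu> > 0" "t \<le> T"
    and "time_conv T U \<xi> < \<infinity>"
  shows "duhamel \<nu> (\<lambda>s. conv (vabs (U s)) (vabs (U s))) t \<xi> < \<infinity>"
  by (rule le_less_trans[OF duhamel_le_time_conv[OF assms(1-3)]])
    (use assms(4) in \<open>simp add: ennreal_mult_less_top\<close>)

text \<open>Time continuity at a fixed frequency, by dominated convergence with the integrand of
  \<open>time_conv\<close> as majorant.\<close>

lemma picard_tendsto_time: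
  assumes [measurable]: "case_prod U \<in> borel_measurable (borel \<Otimes>\<^sub>M borel)" and "\<nu> > 0"
    and \<xi>: "time_conv T U \<xi> < \<infinity>"
    and X: "\<And>n. X n \<in> {0..T}" "X \<longlonglongrightarrow> t"
  shows "(\<lambda>n. picard a \<nu> U0 U (X n) \<xi>) \<longlonglongrightarrow> picard a \<nu> U0 U t \<xi>"
  unfolding picard_def set_lebesgue_integral_def
proof (intro vec_tendstoI, unfold vec_lambda_beta, intro tendsto_add)
  fix j
  let ?q = "\<lambda>s. Q_hat a (U s) (U s) \<xi> $ j"
  let ?e = "\<lambda>t s. complex_of_real (exp (- \<nu> * (t - s) * (norm \<xi>)\<^sup>2))"
  show "(\<lambda>n. complex_of_real (exp (- \<nu> * X n * (norm \<xi>)\<^sup>2)) * U0 \<xi> $ j)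
      \<longlonglongrightarrow> complex_of_real (exp (- \<nu> * t * (norm \<xi>)\<^sup>2)) * U0 \<xi> $ j"
    by (intro tendsto_intros X)
  show "(\<lambda>n. LINT s|lborel. indicator {0..X n} s *\<^sub>R (?e (X n) s * ?q s))
      \<longlonglongrightarrow> (LINT s|lborel. indicator {0..t} s *\<^sub>R (?e t s * ?q s))"
  proof (rule integral_ennreal_dominated_convergence)
    let ?w = "\<lambda>s. ennreal (qconst a * norm \<xi>) * (conv (vabs (U s)) (vabs (U s)) \<xi> * indicator {0..T} s)"
    show "(\<integral>\<^sup>+s. ?w s \<partial>lborel) < \<infinity>"
      using \<xi> by (subst nn_integral_cmult) (auto simp: time_conv_def ennreal_mult_less_top)
    show "AE s in lborel. ennreal (norm (indicator {0..X n} s *\<^sub>R (?e (X n) s * ?q s))) \<le> ?w s" for n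
    proof (rule AE_I2)
      fix s
      show "ennreal (norm (indicator {0..X n} s *\<^sub>R (?e (X n) s * ?q s))) \<le> ?w s"
      proof (cases "s \<in> {0..X n}")
        case True
        with X(1)[of n] have s: "s \<in> {0..T}" by auto
        have "norm (?e (X n) s * ?q s) \<le> norm (?q s)"
          unfolding norm_mult using True \<open>\<nu> > 0\<close> by (intro mult_left_le_one_le) auto
        then have "ennreal (norm (?e (X n) s * ?q s)) \<le> ennreal (norm (?q s))"
          by (rule ennreal_leI)
        also have "\<dots> \<le> ennreal (qconst a * norm \<xi>) * conv (vabs (U s)) (vabs (U s)) \<xi>"
          by (rule norm_Q_hat_nth_le)
        finally show ?thesis
          using True s by simp
      qed simp
    qed
    show "AE s in lborel. (\<lambda>n. indicator {0..X n} s *\<^sub>R (?e (X n) s * ?q s)) \<longlonglongrightarrow> indicator {0..t} s *\<^sub>R (?e t s * ?q s)"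
      \<comment> \<open>The indicators of [0, X n] may oscillate at s = t when the times approach t
        from both sides.\<close>
      using AE_lborel_singleton[of t]
    proof eventually_elim
      fix s assume "s \<noteq> t"
      then consider "s < t" | "t < s" by linarith
      then have "eventually (\<lambda>n. indicator {0..t} s = (indicator {0..X n} s :: real)) sequentially"
      proof cases
        case 1
        from order_tendstoD(1)[OF X(2) 1] show ?thesis
          by eventually_elim (use 1 in \<open>auto simp: indicator_def\<close>)
      next
        case 2
        from order_tendstoD(2)[OF X(2) 2] show ?thesis
          by eventually_elim (use 2 in \<open>auto simp: indicator_def\<close>)
      qed
      then have "(\<lambda>n. indicator {0..X n} s :: real) \<longlonglongrightarrow> indicator {0..t} s"
        by (intro tendsto_eventually) (auto elim: eventually_mono)
      then show "(\<lambda>n. indicator {0..X n} s *\<^sub>R (?e (X n) s * ?q s)) \<longlonglongrightarrow> indicator {0..t} s *\<^sub>R (?e t s * ?q s)"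
        by (intro tendsto_intros X)
    qed
  qed measurable
qed

text \<open>Measurability is required on all of time and frequency, more than \<open>tmeas\<close>
  gives; \<open>sol_clamp\<close> produces such a representative from any solution.\<close>

locale energy_solution =
  fixes a :: qcoeff and \<nu> :: real and U0 :: fvec and T :: real and U :: "real \<Rightarrow> fvec"
  assumes nu: "\<nu> > 0" and U0: "in_chi (-1) U0"
    and measurable_U [measurable]: "case_prod U \<in> borel_measurable (borel \<Otimes>\<^sub>M borel)"
    and mild: "mild_sol a \<nu> U0 T U" and L2: "L2_chi0 T U"
begin

lemma U0_borel [measurable]: "U0 \<in> borel_measurable borel"
  using U0 by (simp add: in_chi_def)

lemma wint_U0: "wint (-1) (vabs U0) < \<infinity>"
  using U0 by (simp add: in_chi_def chi_norm_eq_wint)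

lemma energy_finite: "energy T (\<lambda>t. vabs (U t)) < \<infinity>"
  using L2 by (simp add: L2_chi0_iff)

lemma mild_AE: "t \<in> {0..T} \<Longrightarrow> AE \<xi> in lborel. U t \<xi> = picard a \<nu> U0 U t \<xi>"
  using mild by (simp add: mild_sol_iff)

text \<open>L^2 chi^0 gives reality at almost every time only. The equation upgrades it to every
  time, since its right-hand side sees U through a time integral.\<close>

lemma real_field_solution:
  assumes "t \<in> {0..T}"
  shows "real_field (U t)"
proof (rule real_field_cong_AE[OF mild_AE[OF assms]], rule real_field_picard)
  have "AE t in lborel. t \<in> {0..T} \<longrightarrow> real_field (U t)"
    using L2 by (simp add: L2_chi0_iff)
  then show "AE s in lborel. s \<in> {0..t} \<longrightarrow> real_field (U s)"
    by eventually_elim (use assms in auto)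
  show "real_field U0"
    using U0 by (simp add: in_chi_def)
qed measurable

lemma solution_le:
  assumes "t \<in> {0..T}"
  shows "AE \<xi> in lborel. vabs (U t) \<xi> \<le> heat \<nu> (vabs U0) t \<xi>
     + ennreal (qbound a) * duhamel \<nu> (\<lambda>s. conv (vabs (U s)) (vabs (U s))) t \<xi>"
  using mild_AE[OF assms] by eventually_elim (simp only: norm_picard_le[OF measurable_U])

lemma wint_m1_solution_le:
  assumes "t \<in> {0..T}"
  shows "wint (-1) (vabs (U t)) \<le> wint (-1) (vabs U0) + ennreal (qbound a) * energy T (\<lambda>t. vabs (U t))"
proof -
  have "wint (-1) (vabs (U t)) \<le> wint (-1) (\<lambda>\<xi>. heat \<nu> (vabs U0) t \<xi>
     + ennreal (qbound a) * duhamel \<nu> (\<lambda>s. conv (vabs (U s)) (vabs (U s))) t \<xi>)"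
    by (rule wint_mono_AE[OF solution_le[OF assms]])
  also have "\<dots> = wint (-1) (heat \<nu> (vabs U0) t)
     + ennreal (qbound a) * wint (-1) (duhamel \<nu> (\<lambda>s. conv (vabs (U s)) (vabs (U s))) t)"
    by (simp add: wint_add wint_cmult)
  also have "\<dots> \<le> wint (-1) (vabs U0) + ennreal (qbound a) * flux T (\<lambda>s. conv (vabs (U s)) (vabs (U s)))"
    using assms by (intro add_mono mult_left_mono wint_heat_le wint_m1_duhamel_le nu) auto
  finally show ?thesis
    by (simp add: flux_conv_self)
qed

lemma wint_m1_solution_finite: "t \<in> {0..T} \<Longrightarrow> wint (-1) (vabs (U t)) < \<infinity>"
  by (rule le_less_trans[OF wint_m1_solution_le])
    (use wint_U0 energy_finite in \<open>simp_all add: ennreal_mult_less_top\<close>)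

lemma nn_integral_wint_1_solution_finite: "(\<integral>\<^sup>+t\<in>{0..T}. wint 1 (vabs (U t)) \<partial>lborel) < \<infinity>"
proof -
  let ?m = "\<lambda>s. conv (vabs (U s)) (vabs (U s))"
  have "(\<integral>\<^sup>+t\<in>{0..T}. wint 1 (vabs (U t)) \<partial>lborel)
    \<le> (\<integral>\<^sup>+t. wint 1 (heat \<nu> (vabs U0) t) * indicator {0..T} t
        + ennreal (qbound a) * (wint 1 (duhamel \<nu> ?m t) * indicator {0..T} t) \<partial>lborel)"
  proof (rule nn_integral_mono)
    fix t
    have "wint 1 (vabs (U t)) \<le> wint 1 (heat \<nu> (vabs U0) t) + ennreal (qbound a) * wint 1 (duhamel \<nu> ?m t)"
      if "t \<in> {0..T}"
      using wint_mono_AE[OF solution_le[OF that], of 1] by (simp add: wint_add wint_cmult)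
    then show "wint 1 (vabs (U t)) * indicator {0..T} t \<le> wint 1 (heat \<nu> (vabs U0) t) * indicator {0..T} t
        + ennreal (qbound a) * (wint 1 (duhamel \<nu> ?m t) * indicator {0..T} t)"
      by (auto simp: indicator_def)
  qed
  also have "\<dots> = (\<integral>\<^sup>+t\<in>{0..T}. wint 1 (heat \<nu> (vabs U0) t) \<partial>lborel)
      + ennreal (qbound a) * (\<integral>\<^sup>+t\<in>{0..T}. wint 1 (duhamel \<nu> ?m t) \<partial>lborel)"
    by (simp add: nn_integral_add nn_integral_cmult)
  also have "\<dots> \<le> ennreal (1 / \<nu>) * wint (-1) (vabs U0) + ennreal (qbound a) * (ennreal (1 / \<nu>) * flux T ?m)"
    by (intro add_mono mult_left_mono nn_integral_wint_1_heat_le nn_integral_wint_1_duhamel_le nu) auto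
  also have "\<dots> < \<infinity>"
    using wint_U0 energy_finite by (simp add: flux_conv_self ennreal_mult_less_top)
  finally show ?thesis .
qed

lemma in_chi_m1_solution: "t \<in> {0..T} \<Longrightarrow> in_chi (-1) (U t)"
  unfolding in_chi_def chi_norm_eq_wint
  by (simp add: real_field_solution wint_m1_solution_finite[unfolded infinity_ennreal_def])

lemma Linf_chim1_solution: "Linf_chim1 T U"
  unfolding Linf_chim1_def AE_restrict_lborel_iff
proof (intro conjI exI)
  let ?B = "wint (-1) (vabs U0) + ennreal (qbound a) * energy T (\<lambda>t. vabs (U t))"
  have "?B < \<infinity>"
    using wint_U0 energy_finite by (simp add: ennreal_mult_less_top)
  then have "ennreal (enn2real ?B) = ?B"
    by simp
  then show "AE t in lborel. t \<in> {0..T} \<longrightarrow> chi_norm (-1) (U t) \<le> ennreal (enn2real ?B)"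
    using wint_m1_solution_le by (simp add: chi_norm_eq_wint)
qed (use in_chi_m1_solution tmeas_of_measurable[OF measurable_U] in auto)

lemma L1_chi1_solution: "L1_chi1 T U"
  unfolding L1_chi1_def AE_restrict_lborel_iff chi_norm_eq_wint
proof (intro conjI)
  have "AE t in lborel. wint 1 (vabs (U t)) * indicator {0..T} t \<noteq> \<infinity>"
    by (rule nn_integral_PInf_AE) (use nn_integral_wint_1_solution_finite in auto)
  then show "AE t in lborel. t \<in> {0..T} \<longrightarrow> in_chi 1 (U t)"
    by eventually_elim (auto simp: in_chi_def chi_norm_eq_wint real_field_solution less_top)
qed (use nn_integral_wint_1_solution_finite tmeas_of_measurable[OF measurable_U] in auto)

text \<open>Continuity is proved for the right-hand side of the equation, which equals U at each
  time up to a null set of frequencies. It converges pointwise where \<open>time_conv\<close> is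
  finite, and its bound ?b is independent of time and has finite chi^(-1) norm.\<close>

lemma C_chim1_solution: "C_chim1 T U"
  unfolding C_chim1_def tendsto_at_iff_sequentially o_def
proof (intro conjI ballI allI impI in_chi_m1_solution; (assumption)?)
  fix t X
  assume t: "t \<in> {0..T}" and X: "\<forall>i::nat. X i \<in> {0..T} - {t}" "X \<longlonglongrightarrow> t"
  let ?P = "picard a \<nu> U0 U"
  have [measurable]: "case_prod ?P \<in> borel_measurable (borel \<Otimes>\<^sub>M borel)"
    by (rule measurable_picard) measurable
  note [measurable] = measurable_time_conv[OF measurable_U, of T]
  have XT: "X n \<in> {0..T}" for n using X(1) by auto
  let ?b = "\<lambda>\<xi>. vabs U0 \<xi> + ennreal (qbound a) * (ennreal (norm \<xi>) * time_conv T U \<xi>)"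
  have P_le: "vabs (?P s) \<xi> \<le> ?b \<xi>" if "s \<in> {0..T}" for s \<xi>
  proof -
    have "vabs (?P s) \<xi> \<le> heat \<nu> (vabs U0) s \<xi> + ennreal (qbound a) * duhamel \<nu> (\<lambda>s. conv (vabs (U s)) (vabs (U s))) s \<xi>"
      by (rule norm_picard_le) measurable
    also have "\<dots> \<le> ?b \<xi>"
    proof (intro add_mono mult_left_mono duhamel_le_time_conv nu measurable_U)
      have "ennreal (exp (- \<nu> * s * (norm \<xi>)\<^sup>2)) \<le> 1"
        using nu that by simp
      from mult_right_mono[OF this, of "vabs U0 \<xi>"] show "heat \<nu> (vabs U0) s \<xi> \<le> vabs U0 \<xi>"
        by (simp add: heat_def)
    qed (use that in auto)
    finally show ?thesis .
  qed
  have "(\<lambda>n. \<integral>\<^sup>+\<xi>. ennreal (norm \<xi> powi (-1) * norm (?P (X n) \<xi> - ?P t \<xi>)) \<partial>lborel)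
    \<longlonglongrightarrow> (\<integral>\<^sup>+\<xi>. 0 \<partial>(lborel :: (real^3) measure))"
  proof (rule nn_integral_dominated_convergence[where w="\<lambda>\<xi>. ennreal (norm \<xi> powi (-1)) * (?b \<xi> + ?b \<xi>)"])
    have "wint (-1) ?b = wint (-1) (vabs U0) + ennreal (qbound a) * wint (-1) (\<lambda>\<xi>. ennreal (norm \<xi>) * time_conv T U \<xi>)"
      by (simp add: wint_add wint_cmult)
    also have "\<dots> \<le> wint (-1) (vabs U0) + ennreal (qbound a) * wint 0 (time_conv T U)"
      by (intro add_left_mono mult_left_mono wint_m1_norm_mult_le) simp
    also have "\<dots> < \<infinity>"
      using wint_U0 energy_finite by (simp add: wint_0_time_conv ennreal_mult_less_top)
    finally have "wint (-1) (\<lambda>\<xi>. ?b \<xi> + ?b \<xi>) < \<infinity>"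
      by (subst wint_add) (simp_all only: ennreal_add_less_top infinity_ennreal_def, measurable)
    then show "(\<integral>\<^sup>+\<xi>. ennreal (norm \<xi> powi (-1)) * (?b \<xi> + ?b \<xi>) \<partial>lborel) < \<infinity>"
      by (simp only: wint_def)
    show "AE \<xi> in lborel. ennreal (norm \<xi> powi (-1) * norm (?P (X n) \<xi> - ?P t \<xi>))
        \<le> ennreal (norm \<xi> powi (-1)) * (?b \<xi> + ?b \<xi>)" for n
    proof (rule AE_I2)
      fix \<xi>
      have "ennreal (norm (?P (X n) \<xi> - ?P t \<xi>)) \<le> vabs (?P (X n)) \<xi> + vabs (?P t) \<xi>"
        by (simp add: ennreal_leI norm_triangle_ineq4 flip: ennreal_plus)
      also have "\<dots> \<le> ?b \<xi> + ?b \<xi>"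
        by (intro add_mono P_le XT t)
      finally have "ennreal (norm \<xi> powi (-1)) * ennreal (norm (?P (X n) \<xi> - ?P t \<xi>))
        \<le> ennreal (norm \<xi> powi (-1)) * (?b \<xi> + ?b \<xi>)"
        by (rule mult_left_mono) simp
      then show "ennreal (norm \<xi> powi (-1) * norm (?P (X n) \<xi> - ?P t \<xi>))
        \<le> ennreal (norm \<xi> powi (-1)) * (?b \<xi> + ?b \<xi>)"
        by (simp only: ennreal_mult zero_le_power_int norm_ge_zero)
    qed
    show "AE \<xi> in lborel. (\<lambda>n. ennreal (norm \<xi> powi (-1) * norm (?P (X n) \<xi> - ?P t \<xi>))) \<longlonglongrightarrow> 0"
      using AE_time_conv_finite[OF measurable_U energy_finite]
    proof eventually_elim
      fix \<xi> assume "time_conv T U \<xi> < \<infinity>"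
      then have "(\<lambda>n. ?P (X n) \<xi>) \<longlonglongrightarrow> ?P t \<xi>"
        by (intro picard_tendsto_time[where T=T] nu XT X(2)) measurable
      then have "(\<lambda>n. ennreal (norm \<xi> powi (-1) * norm (?P (X n) \<xi> - ?P t \<xi>)))
          \<longlonglongrightarrow> ennreal (norm \<xi> powi (-1) * norm (?P t \<xi> - ?P t \<xi>))"
        by (intro tendsto_intros)
      then show "(\<lambda>n. ennreal (norm \<xi> powi (-1) * norm (?P (X n) \<xi> - ?P t \<xi>))) \<longlonglongrightarrow> 0"
        by simp
    qed
  qed measurable
  moreover have "chi_norm (-1) (\<lambda>\<xi>. U (X n) \<xi> - U t \<xi>)
      = (\<integral>\<^sup>+\<xi>. ennreal (norm \<xi> powi (-1) * norm (?P (X n) \<xi> - ?P t \<xi>)) \<partial>lborel)" for n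
    unfolding chi_norm_def
    by (rule nn_integral_cong_AE, use mild_AE[OF XT[of n]] mild_AE[OF t] in eventually_elim) (simp only:)
  ultimately show "(\<lambda>n. chi_norm (-1) (\<lambda>\<xi>. U (X n) \<xi> - U t \<xi>)) \<longlonglongrightarrow> 0"
    by simp
qed

end

section \<open>Uniqueness\<close>

lemma energy_cmult:
  fixes m :: "real \<Rightarrow> 'a::euclidean_space \<Rightarrow> ennreal"
  assumes [measurable]: "case_prod m \<in> borel_measurable (borel \<Otimes>\<^sub>M borel)"
  shows "energy T (\<lambda>t x. c * m t x) = c\<^sup>2 * energy T m"
proof -
  have "energy T (\<lambda>t x. c * m t x) = (\<integral>\<^sup>+t. c\<^sup>2 * ((wint 0 (m t))\<^sup>2 * indicator {0..T} t) \<partial>lborel)"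
    unfolding energy_def by (simp add: wint_cmult power_mult_distrib mult.assoc)
  also have "\<dots> = c\<^sup>2 * energy T m"
    unfolding energy_def by (rule nn_integral_cmult) measurable
  finally show ?thesis .
qed

lemma ennreal_less_half_imp_0:
  assumes "x \<le> k * (x * e)" "k * e \<le> ennreal (1/2)" "x < \<infinity>"
  shows "x = (0 :: ennreal)"
proof -
  obtain r where r: "x = ennreal r" "r \<ge> 0"
    using assms(3) by (cases x) auto
  have "x \<le> (k * e) * x"
    using assms(1) by (simp add: ac_simps)
  also have "\<dots> \<le> ennreal (1/2) * x"
    by (rule mult_right_mono[OF assms(2)]) simp
  also have "\<dots> = ennreal (1/2 * r)"
    unfolding r(1) by (rule ennreal_mult[symmetric]) (use r in auto)
  finally have "r \<le> 1/2 * r"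
    using r by (simp add: ennreal_le_iff)
  with r show ?thesis by simp
qed

text \<open>A Gronwall argument: the set of times up to which \<open>\<phi>\<close> vanishes is closed, and
  absolute continuity of the integral of \<open>g\<^sup>2\<close> makes it open to the right.\<close>

lemma quadratic_gronwall_zero:
  fixes \<phi> g :: "real \<Rightarrow> ennreal"
  assumes [measurable]: "\<phi> \<in> borel_measurable borel" "g \<in> borel_measurable borel"
    and k: "k > 0"
    and g: "(\<integral>\<^sup>+t\<in>{0..T}. (g t)\<^sup>2 \<partial>lborel) < \<infinity>"
    and fin: "(\<integral>\<^sup>+t\<in>{0..T}. (\<phi> t)\<^sup>2 \<partial>lborel) < \<infinity>"
    and le: "\<And>\<tau>. \<tau> \<in> {0..T} \<Longrightarrow>
      (\<integral>\<^sup>+t\<in>{0..\<tau>}. (\<phi> t)\<^sup>2 \<partial>lborel) \<le> ennreal k * (\<integral>\<^sup>+t\<in>{0..\<tau>}. \<phi> t * g t \<partial>lborel)\<^sup>2"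
  shows "AE t in lborel. t \<in> {0..T} \<longrightarrow> \<phi> t = 0"
proof (cases "0 \<le> T")
  case True
  define Z where "Z = {\<tau> \<in> {0..T}. AE t in lborel. t \<in> {0..\<tau>} \<longrightarrow> \<phi> t = 0}"
  have "0 \<in> Z"
    using True AE_lborel_singleton[of "0::real"] by (auto simp: Z_def elim: eventually_mono)
  have bdd: "bdd_above Z"
    by (rule bdd_aboveI[of _ T]) (auto simp: Z_def)
  define \<sigma> where "\<sigma> = Sup Z"
  have \<sigma>: "0 \<le> \<sigma>" "\<sigma> \<le> T"
    unfolding \<sigma>_def using \<open>0 \<in> Z\<close> bdd by (auto intro!: cSup_upper cSup_least simp: Z_def)
  have "\<sigma> \<in> closure Z"
    unfolding \<sigma>_def using \<open>0 \<in> Z\<close> bdd by (intro closure_contains_Sup) auto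
  then obtain X where X: "\<And>n. X n \<in> Z" "X \<longlonglongrightarrow> \<sigma>"
    by (auto simp: closure_sequential)
  have zero: "AE t in lborel. t \<in> {0..\<sigma>} \<longrightarrow> \<phi> t = 0"
  proof -
    have "AE t in lborel. \<forall>n. t \<in> {0..X n} \<longrightarrow> \<phi> t = 0"
      unfolding AE_all_countable using X(1) by (auto simp: Z_def)
    then show ?thesis
      using AE_lborel_singleton[of \<sigma>]
    proof (eventually_elim, intro impI)
      fix t assume t: "\<forall>n. t \<in> {0..X n} \<longrightarrow> \<phi> t = 0" "t \<noteq> \<sigma>" "t \<in> {0..\<sigma>}"
      then have "t < \<sigma>" by simp
      from order_tendstoD(1)[OF X(2) this] obtain n where "t < X n"
        by (auto simp: eventually_sequentially)
      with t(1)[rule_format, of n] t(3) show "\<phi> t = 0" by auto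
    qed
  qed
  have "\<not> \<sigma> < T"
  proof
    assume "\<sigma> < T"
    have "(\<integral>\<^sup>+t\<in>{\<sigma>..T}. (g t)\<^sup>2 \<partial>lborel) < \<infinity>"
      by (rule le_less_trans[OF nn_integral_mono g]) (use \<sigma> in \<open>auto simp: indicator_def\<close>)
    \<comment> \<open>With this threshold k times the integral of g^2 is at most one half, so the
      inequality becomes E \<le> E/2, which forces E = 0 because E is finite.\<close>
    moreover have "ennreal (1 / (2 * k)) > 0"
      using k by simp
    ultimately obtain d where d: "d > 0" "\<sigma> + d \<le> T" "(\<integral>\<^sup>+t\<in>{\<sigma>..\<sigma> + d}. (g t)\<^sup>2 \<partial>lborel) < ennreal (1 / (2 * k))"
      by (rule nn_integral_short_interval_le[rotated 1, OF _ \<open>\<sigma> < T\<close>]) measurable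
    let ?\<tau> = "\<sigma> + d" let ?E = "\<integral>\<^sup>+t\<in>{0..\<sigma> + d}. (\<phi> t)\<^sup>2 \<partial>lborel"
    have \<tau>: "?\<tau> \<in> {0..T}" using d \<sigma> by auto
    \<comment> \<open>As \<phi> vanishes up to \<sigma>, the factor g may be cut down to
      [\<sigma>, \<sigma> + d], where it is small.\<close>
    have "(\<integral>\<^sup>+t\<in>{0..?\<tau>}. \<phi> t * g t \<partial>lborel)
      = (\<integral>\<^sup>+t. (\<phi> t * indicator {0..?\<tau>} t) * (g t * indicator {\<sigma>..?\<tau>} t) \<partial>lborel)"
      by (rule nn_integral_cong_AE, use zero in eventually_elim) (auto simp: indicator_def)
    then have "(\<integral>\<^sup>+t\<in>{0..?\<tau>}. \<phi> t * g t \<partial>lborel)\<^sup>2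
      \<le> (\<integral>\<^sup>+t. (\<phi> t * indicator {0..?\<tau>} t)\<^sup>2 \<partial>lborel) * (\<integral>\<^sup>+t. (g t * indicator {\<sigma>..?\<tau>} t)\<^sup>2 \<partial>lborel)"
      by (simp add: Cauchy_Schwarz_nn_integral)
    also have "\<dots> = ?E * (\<integral>\<^sup>+t\<in>{\<sigma>..?\<tau>}. (g t)\<^sup>2 \<partial>lborel)"
      by (intro arg_cong2[where f="(*)"] nn_integral_cong) (auto simp: indicator_def)
    also have "\<dots> \<le> ?E * ennreal (1 / (2 * k))"
      by (rule mult_left_mono) (use d(3) in auto)
    finally have "?E \<le> ennreal k * (?E * ennreal (1 / (2 * k)))"
      by (rule order.trans[OF le[OF \<tau>] mult_left_mono]) simp
    moreover have "ennreal k * ennreal (1 / (2 * k)) \<le> ennreal (1/2)"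
      using k by (simp add: ennreal_mult[symmetric])
    moreover have "?E < \<infinity>"
      by (rule le_less_trans[OF nn_integral_mono fin]) (use \<tau> in \<open>auto simp: indicator_def\<close>)
    ultimately have "?E = 0"
      by (rule ennreal_less_half_imp_0)
    then have "AE t in lborel. (\<phi> t)\<^sup>2 * indicator {0..?\<tau>} t = 0"
      by (subst (asm) nn_integral_0_iff_AE) measurable
    then have "AE t in lborel. t \<in> {0..?\<tau>} \<longrightarrow> \<phi> t = 0"
      by eventually_elim (auto simp: indicator_def)
    then have "?\<tau> \<in> Z"
      using \<tau> by (simp add: Z_def)
    then have "?\<tau> \<le> \<sigma>"
      unfolding \<sigma>_def by (rule cSup_upper[OF _ bdd])
    with d show False by simp
  qed
  with \<sigma> have "\<sigma> = T" by simp
  with zero show ?thesis by simp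
qed simp

text \<open>For \<phi> the chi^0 norm of the difference and g the sum of the chi^0 norms, the
  Duhamel bound is exactly the quadratic Gronwall inequality with k = c^2 / \<nu>. No smallness of
  the solutions is required.\<close>

lemma energy_solution_unique:
  assumes "energy_solution a \<nu> U0 T U" "energy_solution a \<nu> U0 T V" and t: "t \<in> {0..T}"
  shows "AE \<xi> in lborel. V t \<xi> = U t \<xi>"
proof -
  interpret U: energy_solution a \<nu> U0 T U by fact
  interpret V: energy_solution a \<nu> U0 T V by fact
  note [measurable] = U.measurable_U V.measurable_U
  let ?c = "ennreal (qbound a)"
  let ?d = "\<lambda>s \<xi>. ennreal (norm (U s \<xi> - V s \<xi>))"
  let ?X = "\<lambda>s \<xi>. conv (?d s) (vabs (U s)) \<xi> + conv (vabs (V s)) (?d s) \<xi>"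
  let ?g = "\<lambda>s. wint 0 (vabs (U s)) + wint 0 (vabs (V s))"
  have d_le: "AE \<xi> in lborel. ?d t \<xi> \<le> ?c * duhamel \<nu> ?X t \<xi>" if "t \<in> {0..T}" for t
    using U.mild_AE[OF that] V.mild_AE[OF that]
      AE_time_conv_finite[OF U.measurable_U U.energy_finite] AE_time_conv_finite[OF V.measurable_U V.energy_finite]
  proof eventually_elim
    fix \<xi> assume eq: "U t \<xi> = picard a \<nu> U0 U t \<xi>" "V t \<xi> = picard a \<nu> U0 V t \<xi>"
      and fin: "time_conv T U \<xi> < \<infinity>" "time_conv T V \<xi> < \<infinity>"
    show "?d t \<xi> \<le> ?c * duhamel \<nu> ?X t \<xi>"
      unfolding eq
      by (rule norm_picard_diff_le; (intro duhamel_finite[where T=T] U.nu fin)?) (use that in auto)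
  qed
  have X: "wint 0 (?X s) = wint 0 (?d s) * ?g s" for s
    by (subst wint_add) (measurable, simp add: wint_0_conv distrib_left mult.commute)
  have flux: "flux \<tau> ?X = (\<integral>\<^sup>+s\<in>{0..\<tau>}. wint 0 (?d s) * ?g s \<partial>lborel)" for \<tau>
    by (simp add: flux_def X)
  have sum_finite: "(\<integral>\<^sup>+s\<in>{0..T}. (?g s)\<^sup>2 \<partial>lborel) < \<infinity>"
  proof -
    have "(\<integral>\<^sup>+s\<in>{0..T}. (?g s)\<^sup>2 \<partial>lborel) = energy T (\<lambda>s \<xi>. vabs (U s) \<xi> + 1 * vabs (V s) \<xi>)"
      unfolding energy_def by (simp add: wint_add)
    also have "\<dots> \<le> 2 * energy T (\<lambda>s. vabs (U s)) + 2 * 1\<^sup>2 * energy T (\<lambda>s. vabs (V s))"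
      by (rule energy_add_cmult_le) measurable
    also have "\<dots> < \<infinity>"
      using U.energy_finite V.energy_finite by (simp add: ennreal_mult_less_top)
    finally show ?thesis .
  qed
  have "AE s in lborel. s \<in> {0..T} \<longrightarrow> wint 0 (?d s) = 0"
  proof (rule quadratic_gronwall_zero[OF _ _ _ sum_finite])
    show "(qbound a)\<^sup>2 / \<nu> > 0"
      using U.nu qbound_pos[of a] by simp
    show "(\<integral>\<^sup>+t\<in>{0..T}. (wint 0 (?d t))\<^sup>2 \<partial>lborel) < \<infinity>"
    proof (rule le_less_trans[OF nn_integral_mono sum_finite])
      fix s
      have "wint 0 (?d s) \<le> wint 0 (\<lambda>\<xi>. vabs (U s) \<xi> + vabs (V s) \<xi>)"
        by (intro wint_mono_AE AE_I2) (simp add: ennreal_leI norm_triangle_ineq4 flip: ennreal_plus)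
      also have "\<dots> = ?g s"
        by (rule wint_add) measurable
      finally show "(wint 0 (?d s))\<^sup>2 * indicator {0..T} s \<le> (?g s)\<^sup>2 * indicator {0..T} s"
        by (intro mult_right_mono power_mono) auto
    qed
    fix \<tau> assume \<tau>: "\<tau> \<in> {0..T}"
    have "energy \<tau> ?d \<le> energy \<tau> (\<lambda>t \<xi>. ?c * duhamel \<nu> ?X t \<xi>)"
      by (rule energy_mono, rule d_le) (use \<tau> in auto)
    also have "\<dots> = ?c\<^sup>2 * energy \<tau> (duhamel \<nu> ?X)"
      by (rule energy_cmult) measurable
    also have "\<dots> \<le> ?c\<^sup>2 * (ennreal (1 / \<nu>) * (flux \<tau> ?X)\<^sup>2)"
      by (intro mult_left_mono energy_duhamel_le U.nu) auto
    also have "\<dots> = ennreal ((qbound a)\<^sup>2 / \<nu>) * (flux \<tau> ?X)\<^sup>2"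
      using qbound_pos[of a] U.nu by (simp add: ennreal_power ennreal_mult[symmetric] mult.assoc[symmetric])
    finally show "(\<integral>\<^sup>+t\<in>{0..\<tau>}. (wint 0 (?d t))\<^sup>2 \<partial>lborel)
        \<le> ennreal ((qbound a)\<^sup>2 / \<nu>) * (\<integral>\<^sup>+t\<in>{0..\<tau>}. wint 0 (?d t) * ?g t \<partial>lborel)\<^sup>2"
      unfolding flux energy_def .
  qed measurable
  \<comment> \<open>Gronwall yields equality at almost every time. A vanishing flux then bounds the
    chi^(-1) norm of the difference by 0 at every time.\<close>
  then have "flux T ?X = (\<integral>\<^sup>+s. 0 \<partial>(lborel :: real measure))"
    unfolding flux by (intro nn_integral_cong_AE, elim eventually_mono) (auto simp: indicator_def)
  then have "flux T ?X = 0" by simp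
  moreover have "wint (-1) (?d t) \<le> wint (-1) (\<lambda>\<xi>. ?c * duhamel \<nu> ?X t \<xi>)"
    by (rule wint_mono_AE[OF d_le[OF t]])
  moreover have "wint (-1) (\<lambda>\<xi>. ?c * duhamel \<nu> ?X t \<xi>) = ?c * wint (-1) (duhamel \<nu> ?X t)"
    by (rule wint_cmult) measurable
  moreover have "wint (-1) (duhamel \<nu> ?X t) \<le> flux T ?X"
    using t by (intro wint_m1_duhamel_le U.nu) auto
  ultimately have "wint (-1) (?d t) = 0"
    by simp
  then have "AE \<xi> in lborel. ennreal (norm \<xi> powi (-1)) * ?d t \<xi> = 0"
    unfolding wint_def by (subst (asm) nn_integral_0_iff_AE) measurable
  with AE_lborel_nonzero show ?thesis
    by eventually_elim (auto simp: ennreal_mult[symmetric] power_int_minus)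
qed

section \<open>Restriction and gluing of solutions\<close>

lemma picard_cong:
  assumes "\<And>s. s \<in> {0..t} \<Longrightarrow> U s = V s"
  shows "picard a \<nu> U0 U t \<xi> = picard a \<nu> U0 V t \<xi>"
proof -
  have "(LINT s:{0..t}|lborel. complex_of_real (exp (- \<nu> * (t - s) * (norm \<xi>)\<^sup>2)) * Q_hat a (U s) (U s) \<xi> $ j)
      = (LINT s:{0..t}|lborel. complex_of_real (exp (- \<nu> * (t - s) * (norm \<xi>)\<^sup>2)) * Q_hat a (V s) (V s) \<xi> $ j)" for j
    by (rule set_lebesgue_integral_cong) (auto simp: assms)
  then show ?thesis by (simp add: picard_def)
qed

lemma picard_cong_AE:
  assumes [measurable]: "case_prod U \<in> borel_measurable (borel \<Otimes>\<^sub>M borel)"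
      "case_prod V \<in> borel_measurable (borel \<Otimes>\<^sub>M borel)"
    and eq: "AE s in lborel. s \<in> {0..t} \<longrightarrow> (AE \<eta> in lborel. U s \<eta> = V s \<eta>)"
  shows "picard a \<nu> U0 U t \<xi> = picard a \<nu> U0 V t \<xi>"
proof -
  have "(LINT s|lborel. indicator {0..t} s *\<^sub>R (complex_of_real (exp (- \<nu> * (t - s) * (norm \<xi>)\<^sup>2)) * Q_hat a (U s) (U s) \<xi> $ j))
      = (LINT s|lborel. indicator {0..t} s *\<^sub>R (complex_of_real (exp (- \<nu> * (t - s) * (norm \<xi>)\<^sup>2)) * Q_hat a (V s) (V s) \<xi> $ j))" for j
  proof (rule integral_cong_AE)
    show "AE s in lborel. indicator {0..t} s *\<^sub>R (complex_of_real (exp (- \<nu> * (t - s) * (norm \<xi>)\<^sup>2)) * Q_hat a (U s) (U s) \<xi> $ j)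
      = indicator {0..t} s *\<^sub>R (complex_of_real (exp (- \<nu> * (t - s) * (norm \<xi>)\<^sup>2)) * Q_hat a (V s) (V s) \<xi> $ j)"
      using eq
    proof eventually_elim
      case (elim s)
      show ?case
      proof (cases "s \<in> {0..t}")
        case True
        with elim have "Q_hat a (U s) (U s) \<xi> = Q_hat a (V s) (V s) \<xi>"
          by (intro Q_hat_cong_AE) auto
        then show ?thesis by simp
      qed simp
    qed
  qed measurable
  then show ?thesis
    by (simp add: picard_def set_lebesgue_integral_def)
qed

lemma mild_sol_cong:
  assumes "\<And>t. t \<in> {0..T} \<Longrightarrow> U t = V t"
  shows "mild_sol a \<nu> U0 T U \<longleftrightarrow> mild_sol a \<nu> U0 T V"
  unfolding mild_sol_iff
proof (intro ball_cong refl)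
  fix t assume t: "t \<in> {0..T}"
  have "picard a \<nu> U0 U t \<xi> = picard a \<nu> U0 V t \<xi>" for \<xi>
    by (rule picard_cong) (use t assms in auto)
  then show "(AE \<xi> in lborel. U t \<xi> = picard a \<nu> U0 U t \<xi>) \<longleftrightarrow> (AE \<xi> in lborel. V t \<xi> = picard a \<nu> U0 V t \<xi>)"
    by (simp only: assms[OF t])
qed

lemma tmeas_cong:
  assumes "\<And>t. t \<in> {0..T} \<Longrightarrow> U t = V t"
  shows "tmeas T U \<longleftrightarrow> tmeas T V"
  unfolding tmeas_def by (rule measurable_cong) (auto simp: space_pair_measure space_restrict_space assms)

lemma L2_chi0_cong:
  assumes eq: "\<And>t. t \<in> {0..T} \<Longrightarrow> U t = V t"
  shows "L2_chi0 T U \<longleftrightarrow> L2_chi0 T V"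
proof -
  have "(\<integral>\<^sup>+t\<in>{0..T}. (chi_norm 0 (U t))\<^sup>2 \<partial>lborel) = (\<integral>\<^sup>+t\<in>{0..T}. (chi_norm 0 (V t))\<^sup>2 \<partial>lborel)"
    by (intro nn_integral_cong) (auto simp: indicator_def eq)
  moreover have "(AE t in lborel. t \<in> {0..T} \<longrightarrow> in_chi 0 (U t)) \<longleftrightarrow> (AE t in lborel. t \<in> {0..T} \<longrightarrow> in_chi 0 (V t))"
    by (intro AE_cong) (auto simp: eq)
  ultimately show ?thesis
    unfolding L2_chi0_def AE_restrict_lborel_iff by (simp only: tmeas_cong[OF eq])
qed

lemma L1_chi1_cong:
  assumes eq: "\<And>t. t \<in> {0..T} \<Longrightarrow> U t = V t"
  shows "L1_chi1 T U \<longleftrightarrow> L1_chi1 T V"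
proof -
  have "(\<integral>\<^sup>+t\<in>{0..T}. chi_norm 1 (U t) \<partial>lborel) = (\<integral>\<^sup>+t\<in>{0..T}. chi_norm 1 (V t) \<partial>lborel)"
    by (intro nn_integral_cong) (auto simp: indicator_def eq)
  moreover have "(AE t in lborel. t \<in> {0..T} \<longrightarrow> in_chi 1 (U t)) \<longleftrightarrow> (AE t in lborel. t \<in> {0..T} \<longrightarrow> in_chi 1 (V t))"
    by (intro AE_cong) (auto simp: eq)
  ultimately show ?thesis
    unfolding L1_chi1_def AE_restrict_lborel_iff by (simp only: tmeas_cong[OF eq])
qed

text \<open>Extending U by its endpoint values makes it Borel in all times without changing it on
  [0,T].\<close>

lemma measurable_time_clamp:
  assumes "tmeas T U" "0 \<le> T"
  shows "(\<lambda>(t, \<xi>). U (max 0 (min T t)) \<xi>) \<in> borel_measurable (borel \<Otimes>\<^sub>M borel)"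
proof -
  have "(\<lambda>z. max 0 (min T (fst z))) \<in> borel \<Otimes>\<^sub>M (borel :: (real^3) measure) \<rightarrow>\<^sub>M restrict_space lborel {0..T}"
    by (rule measurable_restrict_space2) (use \<open>0 \<le> T\<close> in auto)
  then have "(\<lambda>z. U (max 0 (min T (fst z))) (snd z)) \<in> borel_measurable (borel \<Otimes>\<^sub>M borel)"
    by (rule measurable_Pair_compose_split[OF assms(1)[unfolded tmeas_def]]) simp
  then show ?thesis
    by (simp add: split_beta')
qed

definition sol :: "qcoeff \<Rightarrow> real \<Rightarrow> fvec \<Rightarrow> real \<Rightarrow> (real \<Rightarrow> fvec) \<Rightarrow> bool" where
  "sol a \<nu> U0 T U \<longleftrightarrow> mild_sol a \<nu> U0 T U \<and> L2_chi0 T U"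

lemma sol_cong:
  assumes "\<And>t. t \<in> {0..T} \<Longrightarrow> U t = V t"
  shows "sol a \<nu> U0 T U \<longleftrightarrow> sol a \<nu> U0 T V"
  using mild_sol_cong[OF assms] L2_chi0_cong[OF assms] by (simp add: sol_def)

lemma sol_clamp:
  assumes "sol a \<nu> U0 T U" "0 \<le> T" "\<nu> > 0" "in_chi (-1) U0"
  shows "energy_solution a \<nu> U0 T (\<lambda>t. U (max 0 (min T t)))"
proof
  have "tmeas T U"
    using assms(1) by (simp add: sol_def L2_chi0_def)
  from measurable_time_clamp[OF this assms(2)]
  show "case_prod (\<lambda>t. U (max 0 (min T t))) \<in> borel_measurable (borel \<Otimes>\<^sub>M borel)" .
  have "sol a \<nu> U0 T (\<lambda>t. U (max 0 (min T t)))"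
    using assms(1) by (rule iffD1[OF sol_cong, rotated]) auto
  then show "mild_sol a \<nu> U0 T (\<lambda>t. U (max 0 (min T t)))" "L2_chi0 T (\<lambda>t. U (max 0 (min T t)))"
    by (simp_all add: sol_def)
qed (use assms in auto)

lemma energy_solution_imp_sol: "energy_solution a \<nu> U0 T U \<Longrightarrow> sol a \<nu> U0 T U"
  by (simp add: energy_solution_def sol_def)

lemma sol_unique:
  assumes "sol a \<nu> U0 T U" "sol a \<nu> U0 T V" "\<nu> > 0" "in_chi (-1) U0" "t \<in> {0..T}"
  shows "AE \<xi> in lborel. V t \<xi> = U t \<xi>"
proof -
  have T: "0 \<le> T" using assms(5) by auto
  have "AE \<xi> in lborel. V (max 0 (min T t)) \<xi> = U (max 0 (min T t)) \<xi>"
    by (rule energy_solution_unique[OF sol_clamp[OF assms(1) T assms(3,4)] sol_clamp[OF assms(2) T assms(3,4)] assms(5)])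
  then show ?thesis using assms(5) by simp
qed

lemma sol_regular:
  assumes "sol a \<nu> U0 T U" "0 \<le> T" "\<nu> > 0" "in_chi (-1) U0"
  shows "C_chim1 T U" "L1_chi1 T U" "Linf_chim1 T U"
proof -
  let ?V = "\<lambda>t. U (max 0 (min T t))"
  interpret energy_solution a \<nu> U0 T ?V
    by (rule sol_clamp[OF assms])
  have eq: "t \<in> {0..T} \<Longrightarrow> ?V t = U t" for t by simp
  show "L1_chi1 T U"
    using L1_chi1_solution by (rule iffD1[OF L1_chi1_cong, rotated]) simp
  show "C_chim1 T U"
    unfolding C_chim1_def
  proof (intro conjI ballI)
    fix t assume t: "t \<in> {0..T}"
    show "in_chi (-1) (U t)"
      using in_chi_m1_solution[OF t] eq[OF t] by simp
    have "((\<lambda>s. chi_norm (-1) (\<lambda>\<xi>. ?V s \<xi> - ?V t \<xi>)) \<longlongrightarrow> 0) (at t within {0..T})"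
      using C_chim1_solution t unfolding C_chim1_def by blast
    then show "((\<lambda>s. chi_norm (-1) (\<lambda>\<xi>. U s \<xi> - U t \<xi>)) \<longlongrightarrow> 0) (at t within {0..T})"
      by (rule Lim_transform_eventually) (use t in \<open>auto simp: eventually_at_filter\<close>)
  qed
  show "Linf_chim1 T U"
    using Linf_chim1_solution \<open>L1_chi1 T U\<close> unfolding Linf_chim1_def L1_chi1_def AE_restrict_lborel_iff
    by (auto elim!: AE_mp)
qed

lemma sol_mono:
  assumes "sol a \<nu> U0 T U" "\<nu> > 0" "in_chi (-1) U0" "0 \<le> T'" "T' \<le> T"
  shows "sol a \<nu> U0 T' U"
proof -
  let ?V = "\<lambda>t. U (max 0 (min T t))"
  interpret energy_solution a \<nu> U0 T ?V
    by (rule sol_clamp) (use assms in auto)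
  have "energy T' (\<lambda>t. vabs (?V t)) \<le> energy T (\<lambda>t. vabs (?V t))"
    unfolding energy_def by (intro nn_integral_mono) (use assms in \<open>auto simp: indicator_def\<close>)
  also have "\<dots> < \<infinity>" by (rule energy_finite)
  finally have "L2_chi0 T' ?V"
    unfolding L2_chi0_iff[OF measurable_U] using real_field_solution assms(5) by (intro conjI AE_I2) auto
  moreover have "mild_sol a \<nu> U0 T' ?V"
    using mild assms(5) by (auto simp: mild_sol_def)
  ultimately have "sol a \<nu> U0 T' ?V"
    by (simp add: sol_def)
  then show ?thesis
    by (rule iffD1[OF sol_cong, rotated]) (use assms in auto)
qed

text \<open>The exceptional set may depend on t, which is what uniqueness provides and what passing
  to a common representative needs.\<close>

lemma sol_cong_AE:
  assumes [measurable]: "case_prod U \<in> borel_measurable (borel \<Otimes>\<^sub>M borel)"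
      "case_prod V \<in> borel_measurable (borel \<Otimes>\<^sub>M borel)"
    and eq: "\<And>t. t \<in> {0..T} \<Longrightarrow> AE \<xi> in lborel. U t \<xi> = V t \<xi>"
    and V: "sol a \<nu> U0 T V"
  shows "sol a \<nu> U0 T U"
  unfolding sol_def
proof
  show "mild_sol a \<nu> U0 T U"
    unfolding mild_sol_iff
  proof
    fix t assume t: "t \<in> {0..T}"
    have p: "picard a \<nu> U0 U t \<xi> = picard a \<nu> U0 V t \<xi>" for \<xi>
      by (rule picard_cong_AE) (use t eq in auto)
    have "AE \<xi> in lborel. V t \<xi> = picard a \<nu> U0 V t \<xi>"
      using V t by (simp add: sol_def mild_sol_iff)
    with eq[OF t] show "AE \<xi> in lborel. U t \<xi> = picard a \<nu> U0 U t \<xi>"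
      unfolding p by eventually_elim simp
  qed
  have L2: "(AE t in lborel. t \<in> {0..T} \<longrightarrow> real_field (V t))" "energy T (\<lambda>t. vabs (V t)) < \<infinity>"
    using V by (simp_all add: sol_def L2_chi0_iff)
  have "energy T (\<lambda>t. vabs (U t)) \<le> energy T (\<lambda>t. vabs (V t))"
    by (rule energy_mono, rule eventually_mono[OF eq], assumption) (simp only: order.refl)
  then show "L2_chi0 T U"
    unfolding L2_chi0_iff[OF assms(1)] using L2 real_field_cong_AE[OF eq] by (auto elim!: eventually_mono)
qed

text \<open>The semigroup law: for t = T1 + r the Duhamel integral is split at T1. Its first part is
  the heat evolution over time r of the Duhamel term at T1, and joins the evolved \<open>U0\<close>
  to give the evolved \<open>U T1\<close>; the second part, shifted by T1, is the Duhamel term of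
  V.\<close>

lemma sol_glue:
  assumes U: "energy_solution a \<nu> U0 T1 U" and V: "energy_solution a \<nu> (U T1) T2 V"
    and T: "0 \<le> T1" "0 < T2"
  shows "sol a \<nu> U0 (T1 + T2) (\<lambda>t. if t \<le> T1 then U t else V (t - T1))" (is "sol _ _ _ _ ?W")
  unfolding sol_def
proof
  interpret U: energy_solution a \<nu> U0 T1 U by fact
  interpret V: energy_solution a \<nu> "U T1" T2 V by fact
  note [measurable] = U.measurable_U V.measurable_U
  have [measurable]: "case_prod ?W \<in> borel_measurable (borel \<Otimes>\<^sub>M borel)"
    unfolding split_beta' if_distrib[of "\<lambda>f. f _"] by measurable
  have W_field: "real_field (?W t)" if "t \<in> {0..T1 + T2}" for t
    using that T by (auto intro!: U.real_field_solution V.real_field_solution)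
  have W_energy: "energy (T1 + T2) (\<lambda>t. vabs (?W t)) < \<infinity>"
  proof -
    have "energy (T1 + T2) (\<lambda>t. vabs (?W t))
      \<le> (\<integral>\<^sup>+t. (wint 0 (vabs (U t)))\<^sup>2 * indicator {0..T1} t
          + (wint 0 (vabs (V (- T1 + 1 * t))))\<^sup>2 * indicator {0..T2} (- T1 + 1 * t) \<partial>lborel)"
      unfolding energy_def by (intro nn_integral_mono) (auto simp: indicator_def)
    also have "\<dots> = energy T1 (\<lambda>t. vabs (U t))
        + (\<integral>\<^sup>+t. (wint 0 (vabs (V (- T1 + 1 * t))))\<^sup>2 * indicator {0..T2} (- T1 + 1 * t) \<partial>lborel)"
      unfolding energy_def by (rule nn_integral_add) measurable
    also have "(\<integral>\<^sup>+t. (wint 0 (vabs (V (- T1 + 1 * t))))\<^sup>2 * indicator {0..T2} (- T1 + 1 * t) \<partial>lborel)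
      = energy T2 (\<lambda>t. vabs (V t))"
      unfolding energy_def by (subst nn_integral_real_affine[where c=1 and t="-T1"]) simp_all
    also have "energy T1 (\<lambda>t. vabs (U t)) + energy T2 (\<lambda>t. vabs (V t)) < \<infinity>"
      using U.energy_finite V.energy_finite by simp
    finally show ?thesis .
  qed
  show "L2_chi0 (T1 + T2) ?W"
    by (subst L2_chi0_iff) (use W_field W_energy in auto)
  show "mild_sol a \<nu> U0 (T1 + T2) ?W"
    unfolding mild_sol_iff
  proof
    fix t assume t: "t \<in> {0..T1 + T2}"
    show "AE \<xi> in lborel. ?W t \<xi> = picard a \<nu> U0 ?W t \<xi>"
    proof (cases "t \<le> T1")
      case True
      have "picard a \<nu> U0 ?W t \<xi> = picard a \<nu> U0 U t \<xi>" for \<xi>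
        by (rule picard_cong) (use True in auto)
      with True show ?thesis
        using U.mild_AE[of t] t by simp
    next
      case False
      define r where "r = t - T1"
      have r: "r \<in> {0..T2}" "t = T1 + r" "r > 0"
        using False t by (auto simp: r_def)
      have "AE \<xi> in lborel. V r \<xi> = picard a \<nu> U0 ?W t \<xi>"
        using V.mild_AE[OF r(1)] U.mild_AE[of T1, simplified, OF T(1)]
          AE_time_conv_finite[OF _ W_energy, simplified]
      proof eventually_elim
        fix \<xi> assume \<xi>: "V r \<xi> = picard a \<nu> (U T1) V r \<xi>" "U T1 \<xi> = picard a \<nu> U0 U T1 \<xi>"
          and fin: "time_conv (T1 + T2) ?W \<xi> < top"
        let ?e = "\<lambda>t. complex_of_real (exp (- \<nu> * t * (norm \<xi>)\<^sup>2))"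
        have e_add: "?e (x + y) = ?e x * ?e y" for x y
          by (simp add: of_real_mult[symmetric] exp_add[symmetric] algebra_simps del: of_real_mult)
        show "V r \<xi> = picard a \<nu> U0 ?W t \<xi>"
          unfolding vec_eq_iff
        proof
          fix j
          let ?q = "\<lambda>U s. Q_hat a (U s) (U s) \<xi> $ j"
          \<comment> \<open>Splitting the integral at T1 needs absolute convergence, which holds
            where the time integral for the glued field is finite.\<close>
          have int: "set_integrable lborel {0..t} (\<lambda>s. ?e (t - s) * ?q ?W s)"
            by (rule picard_integrable, measurable, rule duhamel_finite[where T="T1 + T2"])
              (use U.nu t fin in auto)
          have "{0..t} = {0..T1} \<union> {T1<..t}"
            using T False by auto
          then have "(LINT s:{0..t}|lborel. ?e (t - s) * ?q ?W s)
            = (LINT s:{0..T1} \<union> {T1<..t}|lborel. ?e (t - s) * ?q ?W s)"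
            by (simp only:)
          also have "\<dots> = (LINT s:{0..T1}|lborel. ?e (t - s) * ?q ?W s) + (LINT s:{T1<..t}|lborel. ?e (t - s) * ?q ?W s)"
            by (rule set_integral_Un; (rule set_integrable_subset[OF int])?) (use T False in auto)
          also have "(LINT s:{0..T1}|lborel. ?e (t - s) * ?q ?W s) = (LINT s:{0..T1}|lborel. ?e r * (?e (T1 - s) * ?q U s))"
          proof (rule set_lebesgue_integral_cong)
            have "?e (t - s) = ?e r * ?e (T1 - s)" for s
              unfolding e_add[symmetric] by (simp add: r(2))
            then show "\<forall>s. s \<in> {0..T1} \<longrightarrow> ?e (t - s) * ?q ?W s = ?e r * (?e (T1 - s) * ?q U s)"
              by simp
          qed simp
          also have "\<dots> = ?e r * (LINT s:{0..T1}|lborel. ?e (T1 - s) * ?q U s)"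
            by (rule set_integral_mult_right)
          also have "(LINT s:{T1<..t}|lborel. ?e (t - s) * ?q ?W s)
            = (LINT s|lborel. indicator {T1<..t} (T1 + 1 * s) *\<^sub>R (?e (t - (T1 + 1 * s)) * ?q ?W (T1 + 1 * s)))"
            unfolding set_lebesgue_integral_def by (subst lborel_integral_real_affine[where c=1 and t=T1]) simp_all
          also have "\<dots> = (LINT s:{0..r}|lborel. ?e (r - s) * ?q V s)"
            unfolding set_lebesgue_integral_def
          proof (rule integral_cong_AE)
            show "AE s in lborel. indicator {T1<..t} (T1 + 1 * s) *\<^sub>R (?e (t - (T1 + 1 * s)) * ?q ?W (T1 + 1 * s))
              = indicator {0..r} s *\<^sub>R (?e (r - s) * ?q V s)"
              \<comment> \<open>After the shift the domain is half open at 0, and the glued field at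
                T1 is \<open>U T1\<close> rather than \<open>V 0\<close>.\<close>
              using AE_lborel_singleton[of "0::real"]
              by eventually_elim (auto simp: indicator_def r(2))
          qed measurable
          finally have "picard a \<nu> U0 ?W t \<xi> $ j = ?e t * U0 \<xi> $ j
              + (?e r * (LINT s:{0..T1}|lborel. ?e (T1 - s) * ?q U s) + (LINT s:{0..r}|lborel. ?e (r - s) * ?q V s))"
            by (simp only: picard_def vec_lambda_beta)
          moreover have "V r \<xi> $ j = ?e r * (?e T1 * U0 \<xi> $ j + (LINT s:{0..T1}|lborel. ?e (T1 - s) * ?q U s))
              + (LINT s:{0..r}|lborel. ?e (r - s) * ?q V s)"
            unfolding \<xi>(1) picard_def[of a \<nu> "U T1"] vec_lambda_beta \<xi>(2) picard_def[of a \<nu> U0] ..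
          moreover have "?e t = ?e r * ?e T1"
            unfolding e_add[symmetric] by (simp add: r(2) add.commute)
          ultimately show "V r \<xi> $ j = picard a \<nu> U0 ?W t \<xi> $ j"
            by (simp only: distrib_left mult.assoc add.assoc)
        qed
      qed
      with False show ?thesis
        by (simp add: r_def)
    qed
  qed
qed

section \<open>Local existence, small data and blow-up\<close>

lemma picard_lim_sol:
  assumes "\<nu> > 0" "in_chi (-1) U0"
    and "ennreal (16 * (qbound a)\<^sup>2 / \<nu>) * energy T (heat \<nu> (vabs U0)) \<le> 1"
  shows "sol a \<nu> U0 T (picard_lim a \<nu> U0)"
  using picard_lim_solution[OF assms] by (simp add: sol_def)

text \<open>The heat energy on [0,1] is finite, so on a short enough interval it meets the smallness
  condition. The length depends on how this energy is distributed in time near 0.\<close>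

lemma local_existence:
  assumes "\<nu> > 0" and U0: "in_chi (-1) U0"
  obtains T U where "T > 0" "sol a \<nu> U0 T U"
proof -
  have [measurable]: "U0 \<in> borel_measurable borel" and fin: "wint (-1) (vabs U0) < \<infinity>"
    using U0 by (auto simp: in_chi_def chi_norm_eq_wint)
  let ?g = "\<lambda>t. (wint 0 (heat \<nu> (vabs U0) t))\<^sup>2"
  define k where "k = 16 * (qbound a)\<^sup>2 / \<nu>"
  have k: "k > 0" using assms qbound_pos[of a] by (simp add: k_def)
  have "energy 1 (heat \<nu> (vabs U0)) \<le> ennreal (1 / \<nu>) * (wint (-1) (vabs U0))\<^sup>2"
    by (rule energy_heat_le[OF \<open>\<nu> > 0\<close>]) measurable
  also have "\<dots> < \<infinity>"
    using fin by (simp add: ennreal_mult_less_top power2_eq_square)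
  finally have "(\<integral>\<^sup>+t\<in>{0..1}. ?g t \<partial>lborel) < \<infinity>"
    by (simp add: energy_def)
  moreover have "ennreal (1 / k) > 0" using k by simp
  ultimately obtain d where d: "d > 0" "(\<integral>\<^sup>+t\<in>{0..0 + d}. ?g t \<partial>lborel) < ennreal (1 / k)"
    by (rule nn_integral_short_interval_le[rotated 1, OF _ zero_less_one]) measurable
  have "ennreal k * energy d (heat \<nu> (vabs U0)) \<le> ennreal k * ennreal (1 / k)"
    using d(2) by (intro mult_left_mono) (auto simp: energy_def)
  also have "\<dots> = ennreal (k * (1 / k))"
    using k by (intro ennreal_mult[symmetric]) auto
  also have "\<dots> = 1"
    using k by simp
  finally have "sol a \<nu> U0 d (picard_lim a \<nu> U0)"
    unfolding k_def by (intro picard_lim_sol assms)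
  with d(1) show thesis by (rule that)
qed

text \<open>The threshold e = \<nu> / (4 c) solves 16 c^2 / \<nu> * (e^2 / \<nu>) = 1, which
  combines the smallness condition with \<open>energy_heat_le\<close>. Since T is arbitrary, the
  solution is global.\<close>

lemma small_data_existence:
  assumes "\<nu> > 0" and U0: "in_chi (-1) U0"
    and small: "chi_norm (-1) U0 \<le> ennreal (1 / (4 * qbound a) * \<nu>)"
  shows "sol a \<nu> U0 T (picard_lim a \<nu> U0)"
proof (rule picard_lim_sol[OF assms(1,2)])
  let ?c = "qbound a"
  have c: "?c > 0" by (rule qbound_pos)
  define e where "e = 1 / (4 * ?c) * \<nu>"
  have e: "e > 0" using c \<open>\<nu> > 0\<close> by (simp add: e_def)
  have [measurable]: "U0 \<in> borel_measurable borel"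
    using U0 by (auto simp: in_chi_def)
  have "ennreal (16 * ?c\<^sup>2 / \<nu>) * energy T (heat \<nu> (vabs U0))
    \<le> ennreal (16 * ?c\<^sup>2 / \<nu>) * (ennreal (1 / \<nu>) * (wint (-1) (vabs U0))\<^sup>2)"
    by (intro mult_left_mono energy_heat_le \<open>\<nu> > 0\<close>) auto
  also have "\<dots> \<le> ennreal (16 * ?c\<^sup>2 / \<nu>) * (ennreal (1 / \<nu>) * (ennreal e)\<^sup>2)"
    using small unfolding e_def[symmetric] by (intro mult_left_mono power_mono) (auto simp: chi_norm_eq_wint)
  also have "\<dots> = ennreal (16 * ?c\<^sup>2 / \<nu> * (1 / \<nu> * e\<^sup>2))"
  proof -
    have "(ennreal e)\<^sup>2 = ennreal (e\<^sup>2)"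
      using e by (simp add: ennreal_power)
    moreover have "ennreal (1 / \<nu>) * ennreal (e\<^sup>2) = ennreal (1 / \<nu> * e\<^sup>2)"
      using \<open>\<nu> > 0\<close> by (intro ennreal_mult[symmetric]) auto
    ultimately show ?thesis
      using \<open>\<nu> > 0\<close> by (simp only:, intro ennreal_mult[symmetric]) auto
  qed
  also have "16 * ?c\<^sup>2 / \<nu> * (1 / \<nu> * e\<^sup>2) = 1"
    using c \<open>\<nu> > 0\<close> by (simp add: e_def power2_eq_square)
  finally show "ennreal (16 * ?c\<^sup>2 / \<nu>) * energy T (heat \<nu> (vabs U0)) \<le> 1"
    by simp
qed

section \<open>The maximal time of existence\<close>

lemma Tmax_eq: "Tmax a \<nu> U0 = Sup (ereal ` {T. 0 < T \<and> (\<exists>U. sol a \<nu> U0 T U)})"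
  by (simp add: Tmax_def sol_def)

lemma sol_imp_le_Tmax: "0 < T \<Longrightarrow> sol a \<nu> U0 T U \<Longrightarrow> ereal T \<le> Tmax a \<nu> U0"
  unfolding Tmax_eq by (rule Sup_upper) auto

lemma less_Tmax_imp_sol:
  assumes "\<nu> > 0" "in_chi (-1) U0" "0 \<le> T" "ereal T < Tmax a \<nu> U0"
  obtains U where "sol a \<nu> U0 T U"
proof -
  from assms(4) obtain T' U where T': "T < T'" "sol a \<nu> U0 T' U"
    unfolding Tmax_eq less_Sup_iff by auto
  show thesis
    by (rule that, rule sol_mono[OF T'(2) assms(1-3)]) (use T'(1) in simp)
qed

lemma times_below:
  assumes "(S::real) > 0"
  obtains X :: "nat \<Rightarrow> real" where "\<And>n. 0 < X n" "\<And>n. X n < S" "X \<longlonglongrightarrow> S"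
proof
  \<comment> \<open>Starting the denominators at 2 keeps the first time positive.\<close>
  let ?X = "\<lambda>n. S - S / real (Suc (Suc n))"
  have "(\<lambda>n. S / real (Suc (Suc n))) \<longlonglongrightarrow> 0"
    by (intro LIMSEQ_Suc lim_const_over_n)
  from tendsto_diff[OF tendsto_const this, of S] show "?X \<longlonglongrightarrow> S" by simp
  fix n
  have "S / real (Suc (Suc n)) < S / 1"
    using assms by (intro divide_strict_left_mono) auto
  then show "0 < ?X n"
    by simp
  show "?X n < S"
    using assms by simp
qed

text \<open>Solutions on an exhausting sequence of intervals agree only almost everywhere in \<open>\<xi>\<close>;
  their pointwise limit is jointly measurable and a representative of all of them.\<close>

lemma maximal_solution:
  assumes nu: "\<nu> > 0" and U0: "in_chi (-1) U0" and S: "0 < S" "Tmax a \<nu> U0 = ereal S"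
  obtains U where "\<And>T. 0 < T \<Longrightarrow> T < S \<Longrightarrow> sol a \<nu> U0 T U"
proof -
  obtain X where X: "\<And>n. 0 < X n" "\<And>n. X n < S" "X \<longlonglongrightarrow> S"
    using times_below[OF S(1)] by blast
  have "\<exists>V. energy_solution a \<nu> U0 (X n) V" for n
  proof -
    obtain V where "sol a \<nu> U0 (X n) V"
      using less_Tmax_imp_sol[OF nu U0, of "X n" a] X S(2) by (auto simp: less_imp_le)
    from sol_clamp[OF this _ nu U0] X(1)[of n] show ?thesis by auto
  qed
  then obtain V where V: "\<And>n. energy_solution a \<nu> U0 (X n) (V n)" by metis
  have [measurable]: "case_prod (V n) \<in> borel_measurable (borel \<Otimes>\<^sub>M borel)" for n
    using V by (simp add: energy_solution_def)
  define U where "U = (\<lambda>t \<xi>. lim (\<lambda>n. V n t \<xi>))"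
  have U[measurable]: "case_prod U \<in> borel_measurable (borel \<Otimes>\<^sub>M borel)"
    unfolding U_def by measurable
  show thesis
  proof (rule that)
    fix T assume T: "0 < T" "T < S"
    from order_tendstoD(1)[OF X(3) T(2)] obtain m where m: "\<And>n. n \<ge> m \<Longrightarrow> T < X n"
      by (auto simp: eventually_sequentially)
    have sol: "sol a \<nu> U0 T (V n)" if "n \<ge> m" for n
      by (rule sol_mono[OF energy_solution_imp_sol[OF V[of n]] nu U0]) (use T m[OF that] in auto)
    show "sol a \<nu> U0 T U"
    proof (rule sol_cong_AE[OF U _ _ sol])
      fix t assume t: "t \<in> {0..T}"
      have "AE \<xi> in lborel. \<forall>n. n \<ge> m \<longrightarrow> V n t \<xi> = V m t \<xi>"
        unfolding AE_all_countable
      proof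
        fix n
        show "AE \<xi> in lborel. n \<ge> m \<longrightarrow> V n t \<xi> = V m t \<xi>"
        proof (cases "n \<ge> m")
          case True
          then show ?thesis
            using sol_unique[OF sol[OF order.refl] sol nu U0 t] by simp
        qed simp
      qed
      then show "AE \<xi> in lborel. U t \<xi> = V m t \<xi>"
      proof eventually_elim
        case (elim \<xi>)
        then have "eventually (\<lambda>n. V n t \<xi> = V m t \<xi>) sequentially"
          unfolding eventually_sequentially by blast
        then have "(\<lambda>n. V n t \<xi>) \<longlonglongrightarrow> V m t \<xi>"
          by (rule tendsto_eventually)
        then show ?case
          unfolding U_def by (rule limI)
      qed
    qed auto
  qed
qed

text \<open>U is constrained only before S, so its value at S must be supplied: it is defined by the
  equation itself. This makes a solution on the closed interval, and restarting from its value at S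
  contradicts the choice of S as supremum.\<close>

lemma maximal_solution_blowup:
  assumes nu: "\<nu> > 0" and U0: "in_chi (-1) U0" and S: "0 < S" "Tmax a \<nu> U0 = ereal S"
    and U: "\<And>T. 0 < T \<Longrightarrow> T < S \<Longrightarrow> sol a \<nu> U0 T U"
  shows "(\<integral>\<^sup>+t\<in>{0..<S}. (chi_norm 0 (U t))\<^sup>2 \<partial>lborel) = \<infinity>"
proof (rule ccontr)
  assume "\<not> ?thesis"
  then have fin: "(\<integral>\<^sup>+t\<in>{0..<S}. (wint 0 (vabs (U t)))\<^sup>2 \<partial>lborel) < \<infinity>"
    by (simp add: chi_norm_eq_wint less_top)
  obtain X where X: "\<And>n. 0 < X n" "\<And>n. X n < S" "X \<longlonglongrightarrow> S"
    using times_below[OF S(1)] by blast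
  let ?F = "\<lambda>n t. U (max 0 (min (X n) t))"
  have [measurable]: "case_prod (?F n) \<in> borel_measurable (borel \<Otimes>\<^sub>M borel)" for n
    using sol_clamp[OF U[OF X(1,2)[of n]] _ nu U0] X(1)[of n] by (simp add: energy_solution_def)
  \<comment> \<open>U is jointly measurable only on each [0, X n]; its cut-off to [0, S) is
    measurable as a pointwise limit of the clamped versions.\<close>
  define W0 where "W0 = (\<lambda>t \<xi>. if t \<in> {0..<S} then U t \<xi> else 0)"
  have [measurable]: "case_prod W0 \<in> borel_measurable (borel \<Otimes>\<^sub>M borel)"
  proof (rule borel_measurable_LIMSEQ_metric)
    show "(\<lambda>z. indicator {0..<S} (fst z) *\<^sub>R ?F n (fst z) (snd z)) \<in> borel_measurable (borel \<Otimes>\<^sub>M borel)" for n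
      by measurable
    fix z :: "real \<times> (real^3)"
    show "(\<lambda>n. indicator {0..<S} (fst z) *\<^sub>R ?F n (fst z) (snd z)) \<longlonglongrightarrow> case_prod W0 z"
    proof (cases "fst z \<in> {0..<S}")
      case True
      then have "fst z < S" by simp
      from order_tendstoD(1)[OF X(3) this]
      have "eventually (\<lambda>n. indicator {0..<S} (fst z) *\<^sub>R ?F n (fst z) (snd z) = case_prod W0 z) sequentially"
        by eventually_elim (use True in \<open>auto simp: W0_def split_beta' min_def max_def\<close>)
      then show ?thesis by (rule tendsto_eventually)
    next
      case False
      then show ?thesis by (simp add: W0_def split_beta' del: atLeastLessThan_iff)
    qed
  qed
  define W where "W = (\<lambda>t \<xi>. if t < S then W0 t \<xi> else picard a \<nu> U0 W0 t \<xi>)"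
  have [measurable]: "U0 \<in> borel_measurable borel"
    using U0 by (simp add: in_chi_def)
  have [measurable]: "case_prod (picard a \<nu> U0 W0) \<in> borel_measurable (borel \<Otimes>\<^sub>M borel)"
    by (rule measurable_picard) measurable
  have W_meas[measurable]: "case_prod W \<in> borel_measurable (borel \<Otimes>\<^sub>M borel)"
    unfolding W_def by measurable
  have W_eq: "W t = U t" if "0 \<le> t" "t < S" for t
    using that by (simp add: W_def W0_def fun_eq_iff)
  \<comment> \<open>The midpoint of t and S is still below S and gives an interval on which U is
    known to be a solution.\<close>
  have U_sol: "sol a \<nu> U0 ((t + S) / 2) U" "t \<in> {0..(t + S) / 2}" if "0 \<le> t" "t < S" for t
    using that by (auto intro!: U)
  have "sol a \<nu> U0 S W"
    unfolding sol_def
  proof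
    show "mild_sol a \<nu> U0 S W"
      unfolding mild_sol_iff
    proof
      fix t assume t: "t \<in> {0..S}"
      show "AE \<xi> in lborel. W t \<xi> = picard a \<nu> U0 W t \<xi>"
      proof (cases "t < S")
        case True
        have "picard a \<nu> U0 W t \<xi> = picard a \<nu> U0 U t \<xi>" for \<xi>
          by (rule picard_cong) (use True in \<open>auto intro: W_eq\<close>)
        moreover have "AE \<xi> in lborel. U t \<xi> = picard a \<nu> U0 U t \<xi>"
          using U_sol[of t] t True by (simp add: sol_def mild_sol_iff)
        ultimately show ?thesis
          using W_eq[of t] t True by simp
      next
        case False
        with t have "t = S" by simp
        \<comment> \<open>On [0,S] the two fields can differ only at time S, so the Duhamel integral
          does not change and W satisfies the equation at S.\<close>
        have "picard a \<nu> U0 W0 S \<xi> = picard a \<nu> U0 W S \<xi>" for \<xi>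
          by (rule picard_cong_AE, measurable, use AE_lborel_singleton[of S] in eventually_elim)
            (auto simp: W_def)
        then show ?thesis
          by (simp add: \<open>t = S\<close> W_def[of])
      qed
    qed
    have W_real: "real_field (W t)" if "0 \<le> t" "t < S" for t
    proof -
      have "C_chim1 ((t + S) / 2) U"
        by (rule sol_regular[OF U_sol(1)[OF that] _ nu U0]) (use that in simp)
      then have "real_field (U t)"
        using U_sol(2)[OF that] unfolding C_chim1_def in_chi_def by blast
      then show ?thesis by (simp add: W_eq that)
    qed
    have "AE t in lborel. t \<in> {0..S} \<longrightarrow> real_field (W t)"
      using AE_lborel_singleton[of S] by eventually_elim (simp add: W_real)
    moreover have "energy S (\<lambda>t. vabs (W t)) = (\<integral>\<^sup>+t\<in>{0..<S}. (wint 0 (vabs (U t)))\<^sup>2 \<partial>lborel)"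
      unfolding energy_def
      by (rule nn_integral_cong_AE, use AE_lborel_singleton[of S] in eventually_elim)
        (auto simp: indicator_def W_eq)
    ultimately show "L2_chi0 S W"
      unfolding L2_chi0_iff[OF W_meas] using fin by simp
  qed
  then have W: "energy_solution a \<nu> U0 S W"
    using nu U0 W_meas by (simp add: energy_solution_def sol_def)
  then have WS: "in_chi (-1) (W S)"
    by (rule energy_solution.in_chi_m1_solution) (use S in auto)
  obtain T2 V where "T2 > 0" "sol a \<nu> (W S) T2 V"
    by (rule local_existence[OF nu WS])
  then have "sol a \<nu> U0 (S + T2) (\<lambda>t. if t \<le> S then W t else V (max 0 (min T2 (t - S))))"
    using S by (intro sol_glue W sol_clamp nu WS) auto
  then have "ereal (S + T2) \<le> Tmax a \<nu> U0"
    by (rule sol_imp_le_Tmax[rotated]) (use S \<open>T2 > 0\<close> in auto)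
  with S(2) \<open>T2 > 0\<close> show False by simp
qed

theorem theorem1p2:
  fixes a :: "3 \<Rightarrow> 3 \<Rightarrow> 3 \<Rightarrow> 3 \<Rightarrow> 3 \<Rightarrow> 3 \<Rightarrow> real"
  shows
   "(\<forall>\<nu> U0. 0 < \<nu> \<and> in_chi (-1) U0 \<and> div_free U0 \<longrightarrow>
       (\<exists>T>0. \<exists>U. mild_sol a \<nu> U0 T U \<and> L2_chi0 T U
          \<and> (\<forall>V. mild_sol a \<nu> U0 T V \<and> L2_chi0 T V \<longrightarrow>
                 (\<forall>t\<in>{0..T}. AE \<xi> in lborel. V t \<xi> = U t \<xi>))
          \<and> C_chim1 T U \<and> L1_chi1 T U \<and> Linf_chim1 T U))
  \<and> (\<exists>C>0. \<forall>\<nu> U0. 0 < \<nu> \<and> in_chi (-1) U0 \<and> div_free U0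
        \<and> chi_norm (-1) U0 \<le> ennreal (C * \<nu>) \<longrightarrow> Tmax a \<nu> U0 = \<infinity>)
  \<and> (\<forall>\<nu> U0. 0 < \<nu> \<and> in_chi (-1) U0 \<and> div_free U0 \<and> Tmax a \<nu> U0 < \<infinity> \<longrightarrow>
       (\<exists>U. \<forall>T. 0 < T \<and> ereal T < Tmax a \<nu> U0 \<longrightarrow> mild_sol a \<nu> U0 T U \<and> L2_chi0 T U)
     \<and> (\<forall>U. (\<forall>T. 0 < T \<and> ereal T < Tmax a \<nu> U0 \<longrightarrow> mild_sol a \<nu> U0 T U \<and> L2_chi0 T U) \<longrightarrow>
          (\<integral>\<^sup>+t\<in>{0..<real_of_ereal (Tmax a \<nu> U0)}. (chi_norm 0 (U t))\<^sup>2 \<partial>lborel) = \<infinity>))"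
proof (intro conjI allI impI; (elim conjE)?)
  fix \<nu> :: real and U0 assume nu: "0 < \<nu>" and U0: "in_chi (-1) U0"
  obtain T U where T: "T > 0" and sol: "sol a \<nu> U0 T U"
    by (rule local_existence[OF nu U0])
  have "\<forall>t\<in>{0..T}. AE \<xi> in lborel. V t \<xi> = U t \<xi>" if "sol a \<nu> U0 T V" for V
    using sol_unique[OF sol that nu U0] by blast
  with sol sol_regular[OF sol _ nu U0] T
  show "\<exists>T>0. \<exists>U. mild_sol a \<nu> U0 T U \<and> L2_chi0 T U
          \<and> (\<forall>V. mild_sol a \<nu> U0 T V \<and> L2_chi0 T V \<longrightarrow>
                 (\<forall>t\<in>{0..T}. AE \<xi> in lborel. V t \<xi> = U t \<xi>))
          \<and> C_chim1 T U \<and> L1_chi1 T U \<and> Linf_chim1 T U"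
    unfolding sol_def by (intro exI[of _ T] conjI exI[of _ U]) auto
next
  show "\<exists>C>0. \<forall>\<nu> U0. 0 < \<nu> \<and> in_chi (-1) U0 \<and> div_free U0
        \<and> chi_norm (-1) U0 \<le> ennreal (C * \<nu>) \<longrightarrow> Tmax a \<nu> U0 = \<infinity>"
  \<comment> \<open>The constant depends on the coefficients of Q alone, not on \<nu> or the
    data.\<close>
  proof (intro exI[of _ "1 / (4 * qbound a)"] conjI allI impI; (elim conjE)?)
    show "0 < 1 / (4 * qbound a)" using qbound_pos[of a] by simp
    fix \<nu> :: real and U0 assume *: "0 < \<nu>" "in_chi (-1) U0" "chi_norm (-1) U0 \<le> ennreal (1 / (4 * qbound a) * \<nu>)"
    have "ereal T \<le> Tmax a \<nu> U0" if "0 < T" for T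
      using sol_imp_le_Tmax[OF that small_data_existence[OF *]] .
    \<comment> \<open>Existence is recorded for positive times only, so an arbitrary bound B is
      first raised to at least 1.\<close>
    from this[of "max 1 B" for B] have "ereal B \<le> Tmax a \<nu> U0" for B
      by (rule order.trans[rotated, of "ereal (max 1 B)"]) simp_all
    then show "Tmax a \<nu> U0 = \<infinity>"
      by (rule ereal_top)
  qed
next
  fix \<nu> :: real and U0 assume nu: "0 < \<nu>" and U0: "in_chi (-1) U0" and fin: "Tmax a \<nu> U0 < \<infinity>"
  \<comment> \<open>Local existence puts a positive number below the supremum, so a maximal time
    less than infinity is a positive real.\<close>
  obtain S where S: "S > 0" "Tmax a \<nu> U0 = ereal S"
  proof -
    obtain T U where T: "T > 0" "sol a \<nu> U0 T U"
      by (rule local_existence[OF nu U0])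
    then have "ereal T \<le> Tmax a \<nu> U0" by (rule sol_imp_le_Tmax)
    with T fin that show thesis by (cases "Tmax a \<nu> U0") auto
  qed
  show "\<exists>U. \<forall>T. 0 < T \<and> ereal T < Tmax a \<nu> U0 \<longrightarrow> mild_sol a \<nu> U0 T U \<and> L2_chi0 T U"
  proof -
    obtain U where "\<And>T. 0 < T \<Longrightarrow> T < S \<Longrightarrow> sol a \<nu> U0 T U"
      using maximal_solution[OF nu U0 S] by blast
    then show ?thesis
      unfolding sol_def S(2) by (intro exI[of _ U]) simp
  qed
  fix U assume "\<forall>T. 0 < T \<and> ereal T < Tmax a \<nu> U0 \<longrightarrow> mild_sol a \<nu> U0 T U \<and> L2_chi0 T U"
  then have "\<And>T. 0 < T \<Longrightarrow> T < S \<Longrightarrow> sol a \<nu> U0 T U"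
    by (simp add: S sol_def)
  from maximal_solution_blowup[OF nu U0 S this]
  show "(\<integral>\<^sup>+t\<in>{0..<real_of_ereal (Tmax a \<nu> U0)}. (chi_norm 0 (U t))\<^sup>2 \<partial>lborel) = \<infinity>"
    by (simp add: S)
qed

end
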